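(* For each $N$ let $\nu^N_0\in\mathcal{M}^N(\mathcal{M})$ be an initial state for the $\mathcal{M}^N(\mathcal{M})$-valued Markov process $(\nu^N_t)_t$ with generator $$G^N\phi(\nu):=N\int_{\mathcal{M}}\int_{\mathcal{M}}\left(\phi\Big(\nu-\frac1N\delta_m+\frac1N\delta_{m'}\Big)-\phi(\nu)\right)M_\nu(m')\,\mathrm{d}m'\,\mathrm{d}\nu(m).$$ Let $\nu_0\in\mathcal{P}(\mathcal{M})$ and assume that, as $N\to+\infty$, $$\forall\varphi\in C_b(\mathcal{M}),\qquad \langle\nu^N_0,\varphi\rangle\longrightarrow\langle\nu_0,\varphi\rangle .$$ Then, as $N\to+\infty$, the sequence $(\nu^N_t)_t$ converges weakly (in law) in $\mathcal{D}\big([0,\infty),\mathcal{P}(\mathcal{M})\big)$ towards $(\nu_t)_t$, the deterministic weak solution of the space homogeneous BGK equation $$\partial_t\nu_t=M_{\nu_t}-\nu_t$$ with initial condition $\nu_0$, where $\mathcal{D}\big([0,\infty),\mathcal{P}(\mathcal{M})\big)$ is the Skorohod space of càdlàg functions from $[0,\infty)$ to $\mathcal{P}(\mathcal{M})$.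
   Context: **Setting.** $(\mathcal{M},g)$ is a compact finite-dimensional Riemannian manifold with Riemannian distance $d_{\mathcal{M}}$ and normalised volume measure $\mathrm{d}m$ ($\int_{\mathcal{M}}\mathrm{d}m=1$), isometrically embedded in a Euclidean space $E$ with norm $|\cdot|$, and $|m|\le 1$ for all $m\in\mathcal{M}$. The interaction law assigns to each $J\in E$ a probability density $M_J$ on $\mathcal{M}$ (w.r.t. $\mathrm{d}m$), such that there are functions $\alpha,L,\theta$ of $a>0$ with, for all $a>0$ and all $J,J'\in E$ with $|J|,|J'|\le a$ and all $m_1,m_2\in\mathcal M$: $\|M_J\|_{L^\infty(\mathcal{M})}\le\alpha(a)$; $|M_J(m_1)-M_J(m_2)|\le L(a)d_{\mathcal{M}}(m_1,m_2)$; $\|M_J-M_{J'}\|_{L^\infty(\mathcal{M})}\le\theta(a)|J-J'|$. For a positive measure $\nu$ on $\mathcal{M}$, $J_\nu:=\int_{\mathcal{M}}m\,\mathrm{d}\nu(m)\in E$ and $M_\nu:=M_{J_\nu}$ (also viewed as the measure $M_\nu(m)\,\mathrm{d}m$). **Notation.** $\mathcal{P}(\mathcal{M})$ is the set of probability measures on $\mathcal{M}$ and $\mathcal{M}^N(\mathcal{M})=\{\frac1N\sum_{i=1}^N\delta_{m_i}:(m_1,\ldots,m_N)\in\mathcal{M}^N\}\subset\mathcal{P}(\mathcal{M})$ the set of empirical measures of size $N$. Test functions are bounded continuous functions. **Weak solution.** A $\mathcal{P}(\mathcal{M})$-valued process $(\nu_t)_t$ is a weak solution of the space homogeneous BGK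 equation if it is continuous almost everywhere in time and, for almost every $t\in\mathbb{R}_+$, $$\forall\varphi\in C_b(\mathcal{M}),\quad\langle\nu_t,\varphi\rangle=\langle\nu_0,\varphi\rangle+\int_0^tQ^*_{BGK}\varphi(\nu_s)\,\mathrm{d}s,$$ where $Q^*_{BGK}\varphi(\nu):=\int_{\mathcal{M}}\int_{\mathcal{M}}\{\varphi(m')-\varphi(m)\}M_\nu(m')\,\mathrm{d}m'\,\mathrm{d}\nu(m)$. *)

theory Defs
  imports "HOL-Probability.Probability"
begin

section \<open>Compact Riemannian manifolds isometrically embedded in a Euclidean space\<close>

text \<open>
  A Riemannian manifold that is isometrically embedded in a Euclidean space is represented by its
  image, an embedded smooth submanifold carrying the metric induced by the ambient inner product.
  Points of \<open>\<real>\<^sup>k\<close> are points of a coordinate subspace \<open>span B\<close> of the ambient space,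
  where \<open>B \<subseteq> Basis\<close> and \<open>card B = k\<close>. This keeps \<open>k\<close> a plain natural number and includes
  \<open>k = 0\<close>.
\<close>

fun Ck_on :: "nat \<Rightarrow> 'a::euclidean_space set \<Rightarrow> ('a \<Rightarrow> 'b::real_normed_vector) \<Rightarrow> bool" where
  "Ck_on 0 U f \<longleftrightarrow> continuous_on U f"
| "Ck_on (Suc n) U f \<longleftrightarrow>
     f differentiable_on U \<and> (\<forall>b\<in>Basis. Ck_on n U (\<lambda>x. frechet_derivative f (at x) b))"

text \<open>Only used for open \<open>U\<close>.\<close>

definition smooth_on :: "'a::euclidean_space set \<Rightarrow> ('a \<Rightarrow> 'b::real_normed_vector) \<Rightarrow> bool" where
  "smooth_on U f \<longleftrightarrow> (\<forall>n. Ck_on n U f)"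

text \<open>
  The parametrisation proper is the restriction of \<open>\<psi>\<close> to \<open>U \<inter> span B\<close>. Requiring \<open>\<psi>\<close> to be
  smooth on the full-dimensional open set \<open>U\<close> is no restriction, since a smooth map on a relatively
  open subset of \<open>span B\<close> can be precomposed with the orthogonal projection onto \<open>span B\<close>.
\<close>

definition local_parametrisation ::
    "'a::euclidean_space set \<Rightarrow> 'a set \<Rightarrow> 'a set \<Rightarrow> ('a \<Rightarrow> 'a) \<Rightarrow> bool" where
  "local_parametrisation M B U \<psi> \<longleftrightarrow>
     open U \<and> smooth_on U \<psi> \<and>
     openin (top_of_set M) (\<psi> ` (U \<inter> span B)) \<and>
     (\<exists>\<psi>'. homeomorphism (U \<inter> span B) (\<psi> ` (U \<inter> span B)) \<psi> \<psi>') \<and>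
     (\<forall>x\<in>U \<inter> span B. inj_on (frechet_derivative \<psi> (at x)) (span B))"

definition embedded_submanifold :: "nat \<Rightarrow> 'a::euclidean_space set \<Rightarrow> bool" where
  "embedded_submanifold k M \<longleftrightarrow>
     (\<forall>p\<in>M. \<exists>B U \<psi>. B \<subseteq> Basis \<and> card B = k \<and> local_parametrisation M B U \<psi> \<and> p \<in> \<psi> ` (U \<inter> span B))"

text \<open>
  The length is a nonnegative Lebesgue integral because the derivative of a \<^const>\<open>valid_path\<close> may
  blow up at the finitely many exceptional points, in which case the length may be infinite.
  Points in different connected components are at infinite distance.
\<close>

definition riemannian_dist :: "'a::euclidean_space set \<Rightarrow> 'a \<Rightarrow> 'a \<Rightarrow> ennreal" where
  "riemannian_dist M x y =
     (INF \<gamma>\<in>{\<gamma>. valid_path \<gamma> \<and> path_image \<gamma> \<subseteq> M \<and> pathstart \<gamma> = x \<and> pathfinish \<gamma> = y}.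
        \<integral>\<^sup>+t\<in>{0..1}. ennreal (norm (vector_derivative \<gamma> (at t))) \<partial>lborel)"

text \<open>Lebesgue measure on \<open>span B\<close>, viewed as a Borel measure on the ambient space.\<close>

definition coordinate_lebesgue :: "'a::euclidean_space set \<Rightarrow> 'a measure" where
  "coordinate_lebesgue B = distr (\<Pi>\<^sub>M b\<in>B. (lborel :: real measure)) borel (\<lambda>f. \<Sum>b\<in>B. f b *\<^sub>R b)"

text \<open>
  The determinant of the matrix of the induced metric in the coordinates given by \<open>\<psi>\<close>,
  \<open>g\<^sub>b\<^sub>c = \<langle>\<partial>\<^sub>b\<psi>, \<partial>\<^sub>c\<psi>\<rangle>\<close> for \<open>b, c \<in> B\<close>, by the Leibniz formula.
\<close>

definition metric_det :: "('a::euclidean_space \<Rightarrow> 'a) \<Rightarrow> 'a set \<Rightarrow> 'a \<Rightarrow> real" where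
  "metric_det \<psi> B x =
     (\<Sum>p | p permutes B. of_int (sign p) *
        (\<Prod>b\<in>B. frechet_derivative \<psi> (at x) b \<bullet> frechet_derivative \<psi> (at x) (p b)))"

abbreviation borel_on :: "'a::topological_space set \<Rightarrow> 'a measure" where
  "borel_on M \<equiv> restrict_space borel M"

definition riemannian_volume :: "nat \<Rightarrow> 'a::euclidean_space set \<Rightarrow> 'a measure \<Rightarrow> bool" where
  "riemannian_volume k M vol \<longleftrightarrow>
     sets vol = sets (borel_on M) \<and>
     (\<forall>B U \<psi> A. B \<subseteq> Basis \<and> card B = k \<and> local_parametrisation M B U \<psi> \<and>
        A \<in> sets borel \<and> A \<subseteq> U \<inter> span B \<longrightarrow>
        emeasure vol (\<psi> ` A) = (\<integral>\<^sup>+x\<in>A. ennreal (sqrt (metric_det \<psi> B x)) \<partial>coordinate_lebesgue B))"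

definition normalised_volume :: "nat \<Rightarrow> 'a::euclidean_space set \<Rightarrow> 'a measure \<Rightarrow> bool" where
  "normalised_volume k M \<mu> \<longleftrightarrow>
     (\<exists>vol. riemannian_volume k M vol \<and> \<mu> = scale_measure (inverse (emeasure vol (space vol))) vol)"


section \<open>Interaction laws and the BGK equation\<close>

text \<open>\<open>K J\<close> is the density \<open>M\<^sub>J\<close>.\<close>

definition interaction_law ::
    "'a::euclidean_space set \<Rightarrow> 'a measure \<Rightarrow> ('a \<Rightarrow> 'a \<Rightarrow> real) \<Rightarrow>
     (real \<Rightarrow> real) \<Rightarrow> (real \<Rightarrow> real) \<Rightarrow> (real \<Rightarrow> real) \<Rightarrow> bool" where
  "interaction_law M \<mu> K \<alpha> L \<theta> \<longleftrightarrow>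
     (\<forall>J. K J \<in> borel_measurable \<mu> \<and> (\<forall>m\<in>M. 0 \<le> K J m) \<and> (\<integral>\<^sup>+m. ennreal (K J m) \<partial>\<mu>) = 1) \<and>
     (\<forall>a>0. \<forall>J. norm J \<le> a \<longrightarrow> esssup \<mu> (\<lambda>m. ereal \<bar>K J m\<bar>) \<le> ereal (\<alpha> a)) \<and>
     (\<forall>a>0. \<forall>J. norm J \<le> a \<longrightarrow> (\<forall>m\<^sub>1\<in>M. \<forall>m\<^sub>2\<in>M.
        ennreal \<bar>K J m\<^sub>1 - K J m\<^sub>2\<bar> \<le> ennreal (L a) * riemannian_dist M m\<^sub>1 m\<^sub>2)) \<and>
     (\<forall>a>0. \<forall>J J'. norm J \<le> a \<and> norm J' \<le> a \<longrightarrow>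
        esssup \<mu> (\<lambda>m. ereal \<bar>K J m - K J' m\<bar>) \<le> ereal (\<theta> a * norm (J - J')))"

definition flux :: "'a::euclidean_space measure \<Rightarrow> 'a" where
  "flux \<nu> = (\<integral>m. m \<partial>\<nu>)"

abbreviation prob_measures :: "'a::topological_space set \<Rightarrow> 'a measure set" where
  "prob_measures M \<equiv> space (prob_algebra (borel_on M))"

definition Cb :: "'a::topological_space set \<Rightarrow> ('a \<Rightarrow> real) set" where
  "Cb M = {\<phi>. continuous_on M \<phi> \<and> bounded (\<phi> ` M)}"

definition weak_topology :: "'a::topological_space set \<Rightarrow> 'a measure topology" where
  "weak_topology M =
     topology_generated_by {{\<nu> \<in> prob_measures M. (\<integral>m. \<phi> m \<partial>\<nu>) \<in> V} | \<phi> V. \<phi> \<in> Cb M \<and> open V}"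

definition Q_BGK ::
    "'a::euclidean_space measure \<Rightarrow> ('a \<Rightarrow> 'a \<Rightarrow> real) \<Rightarrow> ('a \<Rightarrow> real) \<Rightarrow> 'a measure \<Rightarrow> real" where
  "Q_BGK \<mu> K \<phi> \<nu> = (\<integral>m. (\<integral>m'. (\<phi> m' - \<phi> m) * K (flux \<nu>) m' \<partial>\<mu>) \<partial>\<nu>)"

definition weak_solution_BGK ::
    "'a::euclidean_space set \<Rightarrow> 'a measure \<Rightarrow> ('a \<Rightarrow> 'a \<Rightarrow> real) \<Rightarrow> (real \<Rightarrow> 'a measure) \<Rightarrow> bool" where
  "weak_solution_BGK M \<mu> K \<nu> \<longleftrightarrow>
     (\<forall>t\<ge>0. \<nu> t \<in> prob_measures M) \<and>
     (AE t in lborel. 0 \<le> t \<longrightarrow> limitin (weak_topology M) \<nu> (\<nu> t) (at t within {0..})) \<and>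
     (AE t in lborel. 0 \<le> t \<longrightarrow> (\<forall>\<phi>\<in>Cb M.
        (\<integral>m. \<phi> m \<partial>\<nu> t) = (\<integral>m. \<phi> m \<partial>\<nu> 0) + integral {0..t} (\<lambda>s. Q_BGK \<mu> K \<phi> (\<nu> s))))"


section \<open>Markov processes and the particle process\<close>

definition transition_semigroup :: "'s measure \<Rightarrow> (real \<Rightarrow> 's \<Rightarrow> 's measure) \<Rightarrow> bool" where
  "transition_semigroup S P \<longleftrightarrow>
     (\<forall>t\<ge>0. P t \<in> S \<rightarrow>\<^sub>M prob_algebra S) \<and>
     (\<forall>x\<in>space S. P 0 x = return S x) \<and>
     (\<forall>s\<ge>0. \<forall>t\<ge>0. \<forall>x\<in>space S. P (s + t) x = P s x \<bind> P t)"

definition natural_filtration ::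
    "'w measure \<Rightarrow> 's measure \<Rightarrow> (real \<Rightarrow> 'w \<Rightarrow> 's) \<Rightarrow> real \<Rightarrow> 'w measure" where
  "natural_filtration \<Omega> S X t =
     sigma (space \<Omega>) {X u -` A \<inter> space \<Omega> | u A. 0 \<le> u \<and> u \<le> t \<and> A \<in> sets S}"

text \<open>Time-homogeneous Markov processes, with respect to the natural filtration.\<close>

definition markov_process ::
    "'s measure \<Rightarrow> (real \<Rightarrow> 's \<Rightarrow> 's measure) \<Rightarrow> 'w measure \<Rightarrow> (real \<Rightarrow> 'w \<Rightarrow> 's) \<Rightarrow> bool" where
  "markov_process S P \<Omega> X \<longleftrightarrow>
     prob_space \<Omega> \<and> transition_semigroup S P \<and> (\<forall>t\<ge>0. X t \<in> \<Omega> \<rightarrow>\<^sub>M S) \<and>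
     (\<forall>s\<ge>0. \<forall>t\<ge>0. \<forall>A\<in>sets S. AE \<omega> in \<Omega>.
        real_cond_exp \<Omega> (natural_filtration \<Omega> S X s) (\<lambda>\<omega>. indicator A (X (s + t) \<omega>)) \<omega>
          = measure (P t (X s \<omega>)) A)"

text \<open>
  \<open>C\<close> is the space of test functions: on all of \<open>C\<close>, the generator of the semigroup \<open>P\<close>, in the
  sense of the supremum norm, is defined and equal to \<open>G\<close>.
\<close>

definition has_generator ::
    "'s measure \<Rightarrow> (real \<Rightarrow> 's \<Rightarrow> 's measure) \<Rightarrow> ('s \<Rightarrow> real) set \<Rightarrow>
     (('s \<Rightarrow> real) \<Rightarrow> 's \<Rightarrow> real) \<Rightarrow> bool" where
  "has_generator S P C G \<longleftrightarrow>
     (\<forall>\<phi>\<in>C. uniform_limit (space S) (\<lambda>h x. ((\<integral>y. \<phi> y \<partial>P h x) - \<phi> x) / h) (G \<phi>) (at_right 0))"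

text \<open>The set \<open>{(\<delta>\<^bsub>x 0\<^esub> + \<dots> + \<delta>\<^bsub>x (N-1)\<^esub>) / N | x \<in> M\<^sup>N}\<close>.\<close>

definition empirical_measures :: "nat \<Rightarrow> 'a::topological_space set \<Rightarrow> 'a measure set" where
  "empirical_measures N M =
     {\<nu> \<in> prob_measures M. \<exists>x. (\<forall>i<N. x i \<in> M) \<and>
        (\<forall>A\<in>sets \<nu>. measure \<nu> A = (\<Sum>i<N. indicator A (x i)) / real N)}"

text \<open>
  \<open>\<nu> - \<delta>\<^sub>m/N + \<delta>\<^bsub>m'\<^esub>/N\<close>. The truncated subtraction of \<^typ>\<open>ennreal\<close> is exact if \<open>\<nu>\<close> gives mass at
  least \<open>1/N\<close> to \<open>m\<close>; for \<open>\<nu>\<close> an empirical measure of size \<open>N\<close>, this holds for \<open>\<nu>\<close>-almost all \<open>m\<close>.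
\<close>

definition jump :: "nat \<Rightarrow> 'a measure \<Rightarrow> 'a \<Rightarrow> 'a \<Rightarrow> 'a measure" where
  "jump N \<nu> m m' = measure_of (space \<nu>) (sets \<nu>)
     (\<lambda>A. emeasure \<nu> A - ennreal (1 / real N) * indicator A m + ennreal (1 / real N) * indicator A m')"

definition particle_generator ::
    "nat \<Rightarrow> 'a::euclidean_space measure \<Rightarrow> ('a \<Rightarrow> 'a \<Rightarrow> real) \<Rightarrow>
     ('a measure \<Rightarrow> real) \<Rightarrow> 'a measure \<Rightarrow> real" where
  "particle_generator N \<mu> K \<phi> \<nu> =
     real N * (\<integral>m. (\<integral>m'. (\<phi> (jump N \<nu> m m') - \<phi> \<nu>) * K (flux \<nu>) m' \<partial>\<mu>) \<partial>\<nu>)"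

abbreviation particle_state_space :: "nat \<Rightarrow> 'a::topological_space set \<Rightarrow> 'a measure measure" where
  "particle_state_space N M \<equiv> restrict_space (prob_algebra (borel_on M)) (empirical_measures N M)"

definition particle_test_functions ::
    "nat \<Rightarrow> 'a::topological_space set \<Rightarrow> ('a measure \<Rightarrow> real) set" where
  "particle_test_functions N M =
     {\<phi>. continuous_map (subtopology (weak_topology M) (empirical_measures N M)) euclideanreal \<phi> \<and>
         bounded (\<phi> ` empirical_measures N M)}"

definition particle_process ::
    "nat \<Rightarrow> 'a::euclidean_space set \<Rightarrow> 'a measure \<Rightarrow> ('a \<Rightarrow> 'a \<Rightarrow> real) \<Rightarrow>
     'w measure \<Rightarrow> (real \<Rightarrow> 'w \<Rightarrow> 'a measure) \<Rightarrow> bool" where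
  "particle_process N M \<mu> K \<Omega> X \<longleftrightarrow>
     (\<exists>P. markov_process (particle_state_space N M) P \<Omega> X \<and>
          has_generator (particle_state_space N M) P (particle_test_functions N M)
            (particle_generator N \<mu> K))"


section \<open>The Skorohod space and convergence in law\<close>

text \<open>
  Elements of the Skorohod space are \<^const>\<open>undefined\<close> at negative times, so that they are
  determined by their values on \<open>[0,\<infinity>)\<close>.
\<close>

definition skorohod_space :: "'s set \<Rightarrow> ('s \<Rightarrow> 's \<Rightarrow> real) \<Rightarrow> (real \<Rightarrow> 's) set" where
  "skorohod_space S r =
     {x \<in> {0..} \<rightarrow>\<^sub>E S.
        (\<forall>t\<ge>0. limitin (Metric_space.mtopology S r) x (x t) (at_right t)) \<and>
        (\<forall>t>0. \<exists>l. limitin (Metric_space.mtopology S r) x l (at_left t))}"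

text \<open>
  The usual complete metric for the J1 topology on \<open>[0,\<infinity>)\<close> (Ethier and Kurtz, Markov Processes,
  Section 3.5): the infimum over all time changes \<open>\<lambda>\<close> with \<open>\<gamma>(\<lambda>) < \<infinity>\<close> of
  \<open>max (\<gamma>(\<lambda>)) (\<integral>\<^bsub>[0,\<infinity>)\<^esub> exp(-u) d(x, y, \<lambda>, u) du)\<close>, where
  \<open>\<gamma>(\<lambda>) = sup\<^bsub>s<t\<^esub> |ln ((\<lambda>(t) - \<lambda>(s)) / (t - s))|\<close> and
  \<open>d(x, y, \<lambda>, u) = sup\<^bsub>t\<ge>0\<^esub> min 1 (r (x (min t u)) (y (min (\<lambda>(t)) u)))\<close>.
\<close>

definition log_slopes :: "(real \<Rightarrow> real) \<Rightarrow> real set" where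
  "log_slopes \<tau> = {\<bar>ln ((\<tau> t - \<tau> s) / (t - s))\<bar> | s t. 0 \<le> s \<and> s < t}"

definition time_changes :: "(real \<Rightarrow> real) set" where
  "time_changes = {\<tau>. strict_mono_on {0..} \<tau> \<and> \<tau> ` {0..} = {0..} \<and> bdd_above (log_slopes \<tau>)}"

definition skorohod_dist ::
    "('s \<Rightarrow> 's \<Rightarrow> real) \<Rightarrow> (real \<Rightarrow> 's) \<Rightarrow> (real \<Rightarrow> 's) \<Rightarrow> real" where
  "skorohod_dist r x y =
     (INF \<tau>\<in>time_changes. max (Sup (log_slopes \<tau>))
        (LINT u:{0..}|lborel. exp (- u) * (SUP t\<in>{0..}. min 1 (r (x (min t u)) (y (min (\<tau> t) u))))))"

definition skorohod_topology :: "'s set \<Rightarrow> ('s \<Rightarrow> 's \<Rightarrow> real) \<Rightarrow> (real \<Rightarrow> 's) topology" where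
  "skorohod_topology S r = Metric_space.mtopology (skorohod_space S r) (skorohod_dist r)"

definition borel_of :: "'b topology \<Rightarrow> 'b measure" where
  "borel_of T = sigma (topspace T) {U. openin T U}"

text \<open>
  Convergence in law of random elements \<open>Y n\<close> of a topological space, defined on possibly
  different probability spaces, to a law \<open>Q\<close> on its Borel sets.
\<close>

definition converges_in_law ::
    "'b topology \<Rightarrow> (nat \<Rightarrow> 'w measure) \<Rightarrow> (nat \<Rightarrow> 'w \<Rightarrow> 'b) \<Rightarrow> 'b measure \<Rightarrow> bool" where
  "converges_in_law T \<Omega> Y Q \<longleftrightarrow>
     (\<forall>F. continuous_map T euclideanreal F \<and> bounded (F ` topspace T) \<longrightarrow>
        (\<lambda>n. \<integral>\<omega>. F (Y n \<omega>) \<partial>\<Omega> n) \<longlonglongrightarrow> (\<integral>x. F x \<partial>Q))"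

end

theory Submission
  imports Defs
begin

text \<open>
  Integrating the BGK equation against a test function \<open>\<phi>\<close> gives \<open>d/dt \<langle>\<nu>, \<phi>\<rangle> = \<integral>\<phi> M\<^bsub>J\<^esub> - \<langle>\<nu>, \<phi>\<rangle>\<close>, which depends on
  \<open>\<nu>\<close> only through \<open>\<langle>\<nu>, \<phi>\<rangle>\<close> and the flux \<open>J\<close>. The coordinates of the flux are themselves integrals of test
  functions, so the equations for \<open>\<phi>\<close> and for the coordinates form a closed, finite-dimensional system of
  Lipschitz differential equations (\<open>Q_BGK_lipschitz\<close>). All parts of the theorem
  rest on this observation.

  Uniqueness is Gronwall's inequality for this system (\<open>weak_solution_unique\<close>). For existence, Picard's
  theorem yields the flux, and \<open>\<nu> t\<close> is then the law of a particle that is redrawn at rate one from the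
  density given by the flux, a mixture over the exponential time since the last redrawing
  (\<open>solution_exists\<close>).

  For the particle system, the generator maps the linear functional \<open>\<langle>\<nu>, \<phi>\<rangle>\<close> to the same drift as in the
  limit equation, for every \<open>N\<close>, and the conditional variance of \<open>\<langle>\<nu>, \<phi>\<rangle>\<close> over a time step \<open>h\<close> is of order
  \<open>h/N\<close> (\<open>one_step_moments\<close>). On a time grid, \<open>\<langle>X, \<phi>\<rangle>\<close> is therefore an Euler scheme of the closed system,
  perturbed by a martingale whose maximum is small by Kolmogorov's inequality. Gronwall's inequality on
  the grid, refinement of the grid and right-continuity of the paths give uniform convergence in
  probability on bounded time intervals, for finitely many test functions at once
  (\<open>particle_concentration\<close>).

  As the limit path is continuous, finitely many test functions control its distance \<open>r\<close> to other
  measures uniformly on \<open>[0, T]\<close> (\<open>uniform_weak_neighbourhood_of_path\<close>), and convergence that is uniform on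
  bounded intervals implies convergence in the Skorohod metric with the identity as time change. The
  limit being deterministic, convergence in probability is convergence in law. Two facts on the
  Skorohod space are needed for this: its distance is a metric (\<open>Metric_space_skorohod\<close>), and a continuous
  functional of the particle process is measurable, since a path is the limit of its samples on finer
  and finer grids (\<open>sampled_path_dist_tendsto\<close>) and a measure on \<open>M\<close> the weak limit of measures with finitely
  many atoms (\<open>finite_dimensional_approximation\<close>).
\<close>

section \<open>Time changes\<close>

lemma time_changeD:
  assumes "\<tau> \<in> time_changes"
  shows "strict_mono_on {0..} \<tau>" "\<tau> ` {0..} = {0..}" "bdd_above (log_slopes \<tau>)"
    "\<tau> 0 = 0" "\<And>t. t \<ge> 0 \<Longrightarrow> \<tau> t \<ge> 0"
proof -
  show sm: "strict_mono_on {0..} \<tau>" and im: "\<tau> ` {0..} = {0..}" and "bdd_above (log_slopes \<tau>)"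
    using assms by (auto simp: time_changes_def)
  show pos: "\<tau> t \<ge> 0" if "t \<ge> 0" for t using im that by auto
  obtain s where s: "s \<ge> 0" "\<tau> s = 0" using im by (metis atLeast_iff imageE order_refl)
  have "\<tau> 0 \<le> \<tau> s" using sm s by (metis atLeast_iff less_eq_real_def order_refl strict_mono_on_def)
  with pos[of 0] s show "\<tau> 0 = 0" by simp
qed

lemma time_change_le_iff:
  assumes "\<tau> \<in> time_changes" "0 \<le> s" "0 \<le> t"
  shows "\<tau> s \<le> \<tau> t \<longleftrightarrow> s \<le> t"
  using time_changeD(1)[OF assms(1)] assms(2,3)
  by (smt (verit) atLeast_iff strict_mono_on_def)

lemma log_slopesE:
  assumes "z \<in> log_slopes \<tau>"
  obtains s t where "0 \<le> s" "s < t" "z = \<bar>ln ((\<tau> t - \<tau> s) / (t - s))\<bar>"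
  using assms unfolding log_slopes_def mem_Collect_eq by (elim exE conjE) (rule that)

lemma log_slopes_nonempty: "log_slopes \<tau> \<noteq> {}"
  unfolding log_slopes_def using zero_less_one by blast

lemma Sup_log_slopes_nonneg:
  assumes "\<tau> \<in> time_changes" shows "0 \<le> Sup (log_slopes \<tau>)"
proof -
  obtain z where z: "z \<in> log_slopes \<tau>" using log_slopes_nonempty by blast
  then have "0 \<le> z" by (auto simp: log_slopes_def)
  then show ?thesis using cSup_upper[OF z time_changeD(3)[OF assms]] by linarith
qed

text \<open>
  Slopes between \<open>exp (-g)\<close> and \<open>exp g\<close> move a point of a bounded interval by little. Through this
  bound a small Skorohod distance controls the paths pointwise.
\<close>

lemma time_change_deviation:
  assumes \<tau>: "\<tau> \<in> time_changes" and t: "0 \<le> t"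
  shows "\<bar>\<tau> t - t\<bar> \<le> (exp (Sup (log_slopes \<tau>)) - 1) * t"
proof (cases "t = 0")
  case True then show ?thesis using time_changeD(4)[OF \<tau>] by simp
next
  case False
  then have t: "0 < t" using t by simp
  let ?g = "Sup (log_slopes \<tau>)"
  have pos: "0 < \<tau> t" using time_changeD(1)[OF \<tau>] t time_changeD(4)[OF \<tau>]
    by (metis atLeast_iff less_imp_le order_refl strict_mono_on_def)
  have "\<bar>ln (\<tau> t / t)\<bar> \<in> log_slopes \<tau>"
    unfolding log_slopes_def using t time_changeD(4)[OF \<tau>]
    by (intro CollectI exI[of _ 0] exI[of _ t]) simp
  then have le: "\<bar>ln (\<tau> t / t)\<bar> \<le> ?g" by (rule cSup_upper[OF _ time_changeD(3)[OF \<tau>]])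
  have q: "0 < \<tau> t / t" using pos t by simp
  have up: "\<tau> t / t \<le> exp ?g" using le q by (metis abs_le_D1 exp_le_cancel_iff exp_ln)
  have "exp (- ?g) \<le> \<tau> t / t"
    using le q by (metis abs_le_iff exp_le_cancel_iff exp_ln minus_le_iff)
  moreover have "2 - exp ?g \<le> exp (- ?g)"
    using cosh_real_ge_1[of ?g] by (simp add: cosh_def)
  ultimately have "\<bar>\<tau> t / t - 1\<bar> \<le> exp ?g - 1" using up by auto
  moreover have "\<tau> t / t - 1 = (\<tau> t - t) / t" using t by (simp add: field_simps)
  ultimately have "\<bar>\<tau> t - t\<bar> / t \<le> exp ?g - 1" using t by simp
  then show ?thesis using t by (simp add: field_simps)
qed

text \<open>
  The source of all explicit time changes below. The bound on the slopes comes from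
  \<open>\<bar>ln (1 + y)\<bar> \<le> 2 \<bar>y\<bar>\<close> for \<open>\<bar>y\<bar> \<le> 1/2\<close>.
\<close>

lemma perturbed_identity_time_change:
  assumes g: "\<And>s t. 0 \<le> s \<Longrightarrow> 0 \<le> t \<Longrightarrow> \<bar>g t - g s\<bar> \<le> \<eta> * \<bar>t - s\<bar>"
    and \<eta>: "0 \<le> \<eta>" "\<eta> \<le> 1/2" and g0: "g 0 = 0"
  shows "(\<lambda>t. t + g t) \<in> time_changes" and "\<And>z. z \<in> log_slopes (\<lambda>t. t + g t) \<Longrightarrow> z \<le> 2 * \<eta>"
proof -
  let ?\<tau> = "\<lambda>t::real. t + g t"
  have slope: "\<bar>(g t - g s) / (t - s)\<bar> \<le> \<eta>" if "0 \<le> s" "s < t" for s t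
    using g[of s t] that by (simp add: field_simps abs_if split: if_splits)
  show le: "z \<le> 2 * \<eta>" if zs: "z \<in> log_slopes ?\<tau>" for z
  proof -
    obtain s t where st: "0 \<le> s" "s < t" "z = \<bar>ln ((?\<tau> t - ?\<tau> s) / (t - s))\<bar>"
      using zs by (rule log_slopesE)
    define y where "y = (g t - g s) / (t - s)"
    have y: "\<bar>y\<bar> \<le> \<eta>" using slope[OF st(1,2)] by (simp add: y_def)
    have "(?\<tau> t - ?\<tau> s) / (t - s) = 1 + y" using st(2) by (simp add: y_def field_simps)
    then have z: "z = \<bar>ln (1 + y)\<bar>" using st(3) by simp
    have "\<bar>ln (1 + y) - y\<bar> \<le> 2 * y\<^sup>2"
      using y \<eta> by (intro abs_ln_one_plus_x_minus_x_bound) linarith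
    moreover have "y\<^sup>2 \<le> (1/2) * \<bar>y\<bar>"
    proof -
      have "\<bar>y\<bar> * \<bar>y\<bar> \<le> (1/2) * \<bar>y\<bar>" using y \<eta> by (intro mult_right_mono) linarith+
      then show ?thesis by (simp add: power2_eq_square)
    qed
    ultimately show ?thesis using z y by linarith
  qed
  have mono: "?\<tau> s < ?\<tau> t" if "0 \<le> s" "s < t" for s t
  proof -
    have "\<eta> * \<bar>t - s\<bar> \<le> (1/2) * \<bar>t - s\<bar>" using \<eta> by (intro mult_right_mono) auto
    then have "\<bar>g t - g s\<bar> \<le> (1/2) * \<bar>t - s\<bar>" using g[of s t] that by linarith
    then show ?thesis using that abs_ge_minus_self[of "g t - g s"] by simp
  qed
  have half: "t / 2 \<le> ?\<tau> t" if "0 \<le> t" for t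
  proof -
    have "\<eta> * \<bar>t\<bar> \<le> (1/2) * \<bar>t\<bar>" using \<eta> by (intro mult_right_mono) auto
    then have "\<bar>g t - g 0\<bar> \<le> (1/2) * \<bar>t - 0\<bar>" using g[of 0 t] that by simp
    then show ?thesis using that g0 abs_ge_minus_self[of "g t - g 0"] by simp
  qed
  have lip: "\<eta>-lipschitz_on {0..} g"
    by (rule lipschitz_onI) (use g \<eta> in \<open>auto simp: dist_real_def abs_minus_commute\<close>)
  have cont: "continuous_on {0..} ?\<tau>"
    by (intro continuous_intros lipschitz_on_continuous_on[OF lip])
  have surj: "\<exists>x\<ge>0. ?\<tau> x = y" if "0 \<le> y" for y
  proof -
    have "\<exists>x\<ge>0. x \<le> 2 * y \<and> ?\<tau> x = y"
      by (rule IVT') (use half[of "2*y"] g0 that in \<open>auto intro: continuous_on_subset[OF cont]\<close>)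
    then show ?thesis by blast
  qed
  have "?\<tau> ` {0..} = {0..}"
  proof
    show "?\<tau> ` {0..} \<subseteq> {0..}" using half by (force intro: order_trans[of 0 "_ / 2"])
    show "{0..} \<subseteq> ?\<tau> ` {0..}" using surj by (auto simp: image_iff)
  qed
  moreover have "strict_mono_on {0..} ?\<tau>" by (auto simp: strict_mono_on_def intro: mono)
  moreover have "bdd_above (log_slopes ?\<tau>)" using le by (rule bdd_aboveI)
  ultimately show "?\<tau> \<in> time_changes" by (simp add: time_changes_def)
qed

lemma id_time_change: "(\<lambda>t. t) \<in> time_changes" "Sup (log_slopes (\<lambda>t. t)) = 0"
proof -
  show id: "(\<lambda>t. t) \<in> time_changes" and "Sup (log_slopes (\<lambda>t. t)) = 0"
    using perturbed_identity_time_change[of "\<lambda>_. 0" 0] Sup_log_slopes_nonneg[of "\<lambda>t. t"]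
      cSup_least[OF log_slopes_nonempty[of "\<lambda>t. t"], of 0]
    by auto
qed

text \<open>
  Time changes form a group on which the size of the slopes is symmetric and subadditive. These two
  facts are the symmetry and the triangle inequality of the Skorohod distance.
\<close>

lemma inverse_time_change:
  assumes \<tau>: "\<tau> \<in> time_changes"
  defines "\<sigma> \<equiv> inv_into {0..} \<tau>"
  shows "\<sigma> \<in> time_changes" and "log_slopes \<sigma> = log_slopes \<tau>"
    and "\<And>t. t \<ge> 0 \<Longrightarrow> \<tau> (\<sigma> t) = t" and "\<And>t. t \<ge> 0 \<Longrightarrow> \<sigma> (\<tau> t) = t"
proof -
  note D = time_changeD[OF \<tau>]
  have inj: "inj_on \<tau> {0..}" using D(1) by (rule strict_mono_on_imp_inj_on)
  show R: "\<tau> (\<sigma> t) = t" if "t \<ge> 0" for t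
    unfolding \<sigma>_def using that D(2) by (intro f_inv_into_f) auto
  show Lf: "\<sigma> (\<tau> t) = t" if "t \<ge> 0" for t
    unfolding \<sigma>_def using that inj by (intro inv_into_f_f) auto
  have pos: "\<sigma> t \<ge> 0" if "t \<ge> 0" for t
    using that D(2) inv_into_into[of t \<tau> "{0..}"] by (auto simp: \<sigma>_def)
  have mono: "\<sigma> s < \<sigma> t" if "0 \<le> s" "s < t" for s t
    using that time_change_le_iff[OF \<tau> pos[of t] pos[of s]] R[of s] R[of t] by simp
  have img: "\<sigma> ` {0..} = {0..}"
  proof
    show "\<sigma> ` {0..} \<subseteq> {0..}" using pos by auto
    show "{0..} \<subseteq> \<sigma> ` {0..}"
    proof
      fix t :: real assume "t \<in> {0..}"
      then show "t \<in> \<sigma> ` {0..}"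
        using Lf[of t] D(5)[of t] by (intro image_eqI[of _ _ "\<tau> t"]) auto
    qed
  qed
  have flip: "\<bar>ln ((\<sigma> t - \<sigma> s) / (t - s))\<bar> = \<bar>ln ((t - s) / (\<sigma> t - \<sigma> s))\<bar>"
    if "0 \<le> s" "s < t" for s t
  proof -
    have "(\<sigma> t - \<sigma> s) / (t - s) = inverse ((t - s) / (\<sigma> t - \<sigma> s))" by simp
    moreover have "0 < (t - s) / (\<sigma> t - \<sigma> s)" using mono[OF that] that by simp
    ultimately show ?thesis by (simp only: ln_inverse abs_minus_cancel)
  qed
  show eq: "log_slopes \<sigma> = log_slopes \<tau>"
  proof
    show "log_slopes \<sigma> \<subseteq> log_slopes \<tau>"
    proof
      fix z assume "z \<in> log_slopes \<sigma>"
      then obtain s t where st: "0 \<le> s" "s < t" "z = \<bar>ln ((\<sigma> t - \<sigma> s) / (t - s))\<bar>"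
        by (auto simp: log_slopes_def)
      have "z = \<bar>ln ((\<tau> (\<sigma> t) - \<tau> (\<sigma> s)) / (\<sigma> t - \<sigma> s))\<bar>"
        using st flip[OF st(1,2)] R[of t] R[of s] by simp
      then show "z \<in> log_slopes \<tau>"
        unfolding log_slopes_def using mono[OF st(1,2)] pos[OF st(1)] by blast
    qed
    show "log_slopes \<tau> \<subseteq> log_slopes \<sigma>"
    proof
      fix z assume "z \<in> log_slopes \<tau>"
      then obtain s t where st: "0 \<le> s" "s < t" "z = \<bar>ln ((\<tau> t - \<tau> s) / (t - s))\<bar>"
        by (auto simp: log_slopes_def)
      have lt: "\<tau> s < \<tau> t" using D(1) st by (auto simp: strict_mono_on_def)
      have "z = \<bar>ln ((\<sigma> (\<tau> t) - \<sigma> (\<tau> s)) / (\<tau> t - \<tau> s))\<bar>"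
        using st flip[OF D(5)[OF st(1)] lt] Lf[of t] Lf[of s] by simp
      then show "z \<in> log_slopes \<sigma>"
        unfolding log_slopes_def using lt D(5)[OF st(1)] by blast
    qed
  qed
  show "\<sigma> \<in> time_changes"
    using img D(3) eq mono by (auto simp: time_changes_def strict_mono_on_def)
qed

lemma compose_time_change:
  assumes \<tau>: "\<tau> \<in> time_changes" and \<sigma>: "\<sigma> \<in> time_changes"
  shows "(\<lambda>t. \<sigma> (\<tau> t)) \<in> time_changes"
    and "Sup (log_slopes (\<lambda>t. \<sigma> (\<tau> t))) \<le> Sup (log_slopes \<tau>) + Sup (log_slopes \<sigma>)"
proof -
  note D = time_changeD[OF \<tau>] and E = time_changeD[OF \<sigma>]
  have bound: "z \<le> Sup (log_slopes \<tau>) + Sup (log_slopes \<sigma>)"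
    if zs: "z \<in> log_slopes (\<lambda>t. \<sigma> (\<tau> t))" for z
  proof -
    obtain s t where st: "0 \<le> s" "s < t" "z = \<bar>ln ((\<sigma> (\<tau> t) - \<sigma> (\<tau> s)) / (t - s))\<bar>"
      using zs by (rule log_slopesE)
    have lt: "\<tau> s < \<tau> t" using D(1) st by (auto simp: strict_mono_on_def)
    have lt': "\<sigma> (\<tau> s) < \<sigma> (\<tau> t)" using E(1) lt D(5) st by (auto simp: strict_mono_on_def)
    have "(\<sigma> (\<tau> t) - \<sigma> (\<tau> s)) / (t - s)
        = ((\<tau> t - \<tau> s) / (t - s)) * ((\<sigma> (\<tau> t) - \<sigma> (\<tau> s)) / (\<tau> t - \<tau> s))"
      using lt by simp
    then have "ln ((\<sigma> (\<tau> t) - \<sigma> (\<tau> s)) / (t - s))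
        = ln ((\<tau> t - \<tau> s) / (t - s)) + ln ((\<sigma> (\<tau> t) - \<sigma> (\<tau> s)) / (\<tau> t - \<tau> s))"
      using lt lt' st by (simp only:) (intro ln_mult_pos, auto)
    moreover have "\<bar>ln ((\<tau> t - \<tau> s) / (t - s))\<bar> \<le> Sup (log_slopes \<tau>)"
      by (rule cSup_upper[OF _ D(3)]) (use st in \<open>auto simp: log_slopes_def\<close>)
    moreover have "\<bar>ln ((\<sigma> (\<tau> t) - \<sigma> (\<tau> s)) / (\<tau> t - \<tau> s))\<bar> \<le> Sup (log_slopes \<sigma>)"
      by (rule cSup_upper[OF _ E(3)]) (use lt D(5)[OF st(1)] in \<open>auto simp: log_slopes_def\<close>)
    ultimately show ?thesis using st(3) by linarith
  qed
  have "strict_mono_on {0..} (\<lambda>t. \<sigma> (\<tau> t))"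
    using D(1,5) E(1) by (auto simp: strict_mono_on_def)
  moreover have "(\<lambda>t. \<sigma> (\<tau> t)) ` {0..} = {0..}" using D(2) E(2) by (metis image_image)
  moreover have "bdd_above (log_slopes (\<lambda>t. \<sigma> (\<tau> t)))" using bound by (rule bdd_aboveI)
  ultimately show "(\<lambda>t. \<sigma> (\<tau> t)) \<in> time_changes" by (simp add: time_changes_def)
  show "Sup (log_slopes (\<lambda>t. \<sigma> (\<tau> t))) \<le> Sup (log_slopes \<tau>) + Sup (log_slopes \<sigma>)"
    by (rule cSup_least[OF log_slopes_nonempty bound])
qed

section \<open>The Skorohod metric\<close>

text \<open>
  Such a function is the pointwise limit of its samples at the next point of a finer and finer grid,
  taken strictly to the right.
\<close>

lemma borel_measurable_right_continuous:
  fixes h :: "real \<Rightarrow> real"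
  assumes h: "\<And>u. (h \<longlongrightarrow> h u) (at_right u)"
  shows "h \<in> borel_measurable borel"
proof (rule borel_measurable_LIMSEQ_real)
  let ?g = "\<lambda>n u. (real_of_int \<lfloor>real (Suc n) * u\<rfloor> + 1) / real (Suc n)"
  show "(\<lambda>n. h (?g n u)) \<longlonglongrightarrow> h u" for u
  proof -
    have gt: "u < ?g n u" "?g n u \<le> u + 1 / real (Suc n)" for n
    proof -
      have "real (Suc n) * u < real_of_int \<lfloor>real (Suc n) * u\<rfloor> + 1" by linarith
      then show "u < ?g n u" by (simp add: field_simps del: of_nat_Suc)
      have "real_of_int \<lfloor>real (Suc n) * u\<rfloor> + 1 \<le> real (Suc n) * u + 1" by linarith
      then have "?g n u \<le> (real (Suc n) * u + 1) / real (Suc n)" by (rule divide_right_mono) simp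
      then show "?g n u \<le> u + 1 / real (Suc n)" by (simp add: add_divide_distrib)
    qed
    have "(\<lambda>n. ?g n u) \<longlonglongrightarrow> u"
    proof (rule tendsto_sandwich[OF _ _ tendsto_const])
      show "\<forall>\<^sub>F n in sequentially. u \<le> ?g n u" using gt(1) less_imp_le by (intro always_eventually) blast
      show "\<forall>\<^sub>F n in sequentially. ?g n u \<le> u + 1 / real (Suc n)" using gt(2) by (intro always_eventually) blast
      have "(\<lambda>n. 1 / real (Suc n)) \<longlonglongrightarrow> 0" using LIMSEQ_inverse_real_of_nat by (simp add: inverse_eq_divide)
      then show "(\<lambda>n. u + 1 / real (Suc n)) \<longlonglongrightarrow> u" using tendsto_add[OF tendsto_const] by fastforce
    qed
    then have "filterlim (\<lambda>n. ?g n u) (at_right u) sequentially"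
      by (intro tendsto_imp_filterlim_at_right always_eventually allI gt(1))
    then show ?thesis by (rule filterlim_compose[OF h])
  qed
  show "(\<lambda>u. h (?g n u)) \<in> borel_measurable borel" for n by measurable
qed

lemma exp_minus_atLeast:
  fixes a :: real
  shows "set_integrable lborel {a..} (\<lambda>u. exp (- u))"
    and "(LINT u:{a..}|lborel. exp (- u)) = exp (- a)"
proof -
  have lim: "((\<lambda>x::real. - exp (- x)) \<longlongrightarrow> - 0) at_top"
    by (intro tendsto_minus filterlim_compose[OF exp_at_bot] filterlim_uminus_at_bot_at_top)
  have "(\<integral>\<^sup>+x. ennreal (exp (- x)) * indicator {a..} x \<partial>lborel) = ennreal (- 0 - (- exp (- a)))"
    by (rule nn_integral_FTC_atLeast[OF _ _ _ lim]) (auto intro!: derivative_eq_intros)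
  then have "(\<integral>\<^sup>+x. ennreal (indicator {a..} x *\<^sub>R exp (- x)) \<partial>lborel) = ennreal (exp (- a))"
    by (simp add: ennreal_mult'' ennreal_indicator mult.commute)
  then have "has_bochner_integral lborel (\<lambda>x. indicator {a..} x *\<^sub>R exp (- x)) (exp (- a))"
    by (intro has_bochner_integral_nn_integral) auto
  then show "set_integrable lborel {a..} (\<lambda>u. exp (- u))"
    and "(LINT u:{a..}|lborel. exp (- u)) = exp (- a)"
    by (auto simp: set_integrable_def set_lebesgue_integral_def has_bochner_integral_iff)
qed

text \<open>
  The integrand and the objective of the infimum in \<^const>\<open>skorohod_dist\<close>. That this is a metric
  rests on the measurability of the integrand, without which the integrals of two comparisons could
  not be added in the triangle inequality.
\<close>

definition skorohod_gap ::
  "('s \<Rightarrow> 's \<Rightarrow> real) \<Rightarrow> (real \<Rightarrow> 's) \<Rightarrow> (real \<Rightarrow> 's) \<Rightarrow> (real \<Rightarrow> real) \<Rightarrow> real \<Rightarrow> real" where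
  "skorohod_gap r x y \<tau> u = (SUP t\<in>{0..}. min 1 (r (x (min t u)) (y (min (\<tau> t) u))))"

definition skorohod_cost ::
  "('s \<Rightarrow> 's \<Rightarrow> real) \<Rightarrow> (real \<Rightarrow> 's) \<Rightarrow> (real \<Rightarrow> 's) \<Rightarrow> (real \<Rightarrow> real) \<Rightarrow> real" where
  "skorohod_cost r x y \<tau> =
     max (Sup (log_slopes \<tau>)) (LINT u:{0..}|lborel. exp (- u) * skorohod_gap r x y \<tau> u)"

lemma skorohod_dist_eq_INF_cost: "skorohod_dist r x y = (INF \<tau>\<in>time_changes. skorohod_cost r x y \<tau>)"
  by (simp add: skorohod_dist_def skorohod_cost_def skorohod_gap_def)

locale skorohod = Metric_space S r for S :: "'s set" and r
begin

lemma gap_le: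
  assumes "\<And>t. t \<ge> 0 \<Longrightarrow> min 1 (r (x (min t u)) (y (min (\<tau> t) u))) \<le> c"
  shows "skorohod_gap r x y \<tau> u \<le> c"
  unfolding skorohod_gap_def using assms by (intro cSUP_least) auto

lemma gap_ge:
  assumes "t \<ge> 0"
  shows "min 1 (r (x (min t u)) (y (min (\<tau> t) u))) \<le> skorohod_gap r x y \<tau> u"
  unfolding skorohod_gap_def
  by (rule cSUP_upper) (use assms in \<open>auto intro!: bdd_aboveI2[of _ _ 1]\<close>)

lemma gap_bounds: "0 \<le> skorohod_gap r x y \<tau> u" "skorohod_gap r x y \<tau> u \<le> 1"
proof -
  have "0 \<le> min 1 (r (x (min 0 u)) (y (min (\<tau> 0) u)))" by simp
  then show "0 \<le> skorohod_gap r x y \<tau> u" using gap_ge[of 0 x u y \<tau>] by linarith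
  show "skorohod_gap r x y \<tau> u \<le> 1" by (rule gap_le) simp
qed

lemma cost_nonneg: "0 \<le> skorohod_cost r x y \<tau>"
proof -
  have "0 \<le> (LINT u:{0..}|lborel. exp (- u) * skorohod_gap r x y \<tau> u)"
    unfolding set_lebesgue_integral_def using gap_bounds(1) by (intro integral_nonneg_AE AE_I2) simp
  then show ?thesis by (simp add: skorohod_cost_def)
qed

lemma time_changes_nonempty: "time_changes \<noteq> {}" using id_time_change(1) by blast

lemma bdd_below_cost: "bdd_below (skorohod_cost r x y ` time_changes)"
  using cost_nonneg by (intro bdd_belowI2[of _ 0]) blast

lemma dist_le_cost: "\<tau> \<in> time_changes \<Longrightarrow> skorohod_dist r x y \<le> skorohod_cost r x y \<tau>"
  unfolding skorohod_dist_eq_INF_cost by (rule cINF_lower[OF bdd_below_cost])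

lemma dist_nonneg: "0 \<le> skorohod_dist r x y"
  unfolding skorohod_dist_eq_INF_cost using time_changes_nonempty cost_nonneg by (rule cINF_greatest)

lemma dist_obtains_cost:
  assumes "skorohod_dist r x y < c"
  obtains \<tau> where "\<tau> \<in> time_changes" "skorohod_cost r x y \<tau> < c"
  using assms cINF_less_iff[OF time_changes_nonempty bdd_below_cost] that
  unfolding skorohod_dist_eq_INF_cost by blast

text \<open>
  Substituting the inverse time change turns a comparison of \<open>x\<close> with \<open>y\<close> into one of \<open>y\<close>
  with \<open>x\<close> of the same cost, because the gaps are the same supremum, parametrised differently.
\<close>

lemma cost_inverse_time_change:
  assumes "\<tau> \<in> time_changes"
  shows "skorohod_cost r y x (inv_into {0..} \<tau>) = skorohod_cost r x y \<tau>"
proof -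
  let ?\<sigma> = "inv_into {0..} \<tau>"
  note I = inverse_time_change[OF assms]
  have "skorohod_gap r y x ?\<sigma> u = skorohod_gap r x y \<tau> u" for u
  proof -
    have "(\<lambda>t. min 1 (r (y (min t u)) (x (min (?\<sigma> t) u)))) ` {0..}
      = (\<lambda>t. min 1 (r (y (min t u)) (x (min (?\<sigma> t) u)))) ` \<tau> ` {0..}"
      using time_changeD(2)[OF assms] by simp
    also have "\<dots> = (\<lambda>t. min 1 (r (x (min t u)) (y (min (\<tau> t) u)))) ` {0..}"
      unfolding image_image by (rule image_cong) (auto simp: I(4) commute)
    finally show ?thesis by (simp add: skorohod_gap_def)
  qed
  then show ?thesis by (simp add: skorohod_cost_def I(2))
qed

lemma dist_commute: "skorohod_dist r x y = skorohod_dist r y x"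
proof -
  have "skorohod_dist r x y \<le> skorohod_dist r y x" for x y
    unfolding skorohod_dist_eq_INF_cost[of r y x]
  proof (rule cINF_greatest[OF time_changes_nonempty])
    fix \<tau> assume "\<tau> \<in> time_changes"
    then show "skorohod_dist r x y \<le> skorohod_cost r y x \<tau>"
      using dist_le_cost[OF inverse_time_change(1)] cost_inverse_time_change by metis
  qed
  then show ?thesis by (simp add: antisym)
qed

abbreviation cadlag :: "(real \<Rightarrow> 's) set" where "cadlag \<equiv> skorohod_space S r"

lemma cadlag_in: "x \<in> cadlag \<Longrightarrow> t \<ge> 0 \<Longrightarrow> x t \<in> S"
  by (auto simp: skorohod_space_def PiE_def Pi_def)

lemma cadlag_right:
  assumes x: "x \<in> cadlag" and t: "t \<ge> 0" and e: "e > 0"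
  obtains d where "d > 0" "\<And>s. t \<le> s \<Longrightarrow> s < t + d \<Longrightarrow> r (x s) (x t) < e"
proof -
  have "limitin mtopology x (x t) (at_right t)" using x t by (simp add: skorohod_space_def)
  then have "eventually (\<lambda>s. x s \<in> S \<and> r (x s) (x t) < e) (at_right t)"
    using e by (simp add: limitin_metric)
  then obtain b where b: "b > t" "\<And>s. t < s \<Longrightarrow> s < b \<Longrightarrow> r (x s) (x t) < e"
    unfolding eventually_at_right_field by blast
  have "r (x s) (x t) < e" if "t \<le> s" "s < t + (b - t)" for s
    using that b(2)[of s] cadlag_in[OF x t] e by (cases "s = t") auto
  then show thesis using that[of "b - t"] b(1) by simp
qed

lemma cadlag_left:
  assumes x: "x \<in> cadlag" and t: "t > 0" and e: "e > 0"
  obtains d where "d > 0" "\<And>s s'. t - d < s \<Longrightarrow> s < t \<Longrightarrow> t - d < s' \<Longrightarrow> s' < t \<Longrightarrow> r (x s) (x s') < e"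
proof -
  obtain l where "limitin mtopology x l (at_left t)" using x t by (auto simp: skorohod_space_def)
  then have l: "l \<in> S" and "eventually (\<lambda>s. x s \<in> S \<and> r (x s) l < e / 2) (at_left t)"
    using e half_gt_zero[OF e] unfolding limitin_metric by blast+
  then obtain b where b: "b < t" "\<And>s. b < s \<Longrightarrow> s < t \<Longrightarrow> x s \<in> S \<and> r (x s) l < e / 2"
    unfolding eventually_at_left_field by blast
  have "r (x s) (x s') < e" if "t - (t - b) < s" "s < t" "t - (t - b) < s'" "s' < t" for s s'
    using b(2)[of s] b(2)[of s'] triangle[of "x s" l "x s'"] commute[of l "x s'"] l that by simp
  then show thesis using that[of "t - b"] b(1) by simp
qed

lemma min_one_lipschitz:
  assumes "a \<in> S" "a' \<in> S" "b \<in> S" "b' \<in> S"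
  shows "min 1 (r a b) \<le> min 1 (r a' b') + r a a' + r b b'"
  using triangle[of a a' b] triangle[of a' b' b] assms nonneg[of a a'] nonneg[of b b'] commute[of b b']
  by (smt (verit))

lemma min_one_triangle:
  assumes "a \<in> S" "b \<in> S" "c \<in> S"
  shows "min 1 (r a c) \<le> min 1 (r a b) + min 1 (r b c)"
  using triangle[of a b c] assms nonneg[of a b] nonneg[of b c] by (smt (verit))

text \<open>
  Moving the horizon from \<open>u\<close> to a slightly later \<open>u'\<close> changes the stopped paths only by their
  oscillation on \<open>[u, u']\<close>. This makes the gap right-continuous in the horizon.
\<close>

lemma gap_right_continuous:
  assumes x: "x \<in> cadlag" and y: "y \<in> cadlag" and \<tau>: "\<tau> \<in> time_changes" and u: "u \<ge> 0"
  shows "(skorohod_gap r x y \<tau> \<longlongrightarrow> skorohod_gap r x y \<tau> u) (at_right u)"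
proof (rule tendstoI)
  fix e :: real assume e: "e > 0"
  obtain d where d: "d > 0" "\<And>s. u \<le> s \<Longrightarrow> s < u + d \<Longrightarrow> r (x s) (x u) < e / 3"
    using cadlag_right[OF x u, of "e/3"] e by auto
  obtain d' where d': "d' > 0" "\<And>s. u \<le> s \<Longrightarrow> s < u + d' \<Longrightarrow> r (y s) (y u) < e / 3"
    using cadlag_right[OF y u, of "e/3"] e by auto
  have "dist (skorohod_gap r x y \<tau> v) (skorohod_gap r x y \<tau> u) < e"
    if v: "u < v" "v < u + min d d'" for v
  proof -
    have near: "r (x (min t v)) (x (min t u)) \<le> e / 3" "r (y (min t v)) (y (min t u)) \<le> e / 3"
      if "t \<ge> 0" for t
    proof -
      have "min t v = min t u \<or> (u \<le> min t v \<and> min t v < u + min d d' \<and> min t u = u)"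
        using v by linarith
      then show "r (x (min t v)) (x (min t u)) \<le> e / 3" "r (y (min t v)) (y (min t u)) \<le> e / 3"
        using d(2)[of "min t v"] d'(2)[of "min t v"] e cadlag_in[OF x, of "min t u"]
          cadlag_in[OF y, of "min t u"] that u
        by (auto simp: less_imp_le)
    qed
    have in_S: "x (min t w) \<in> S" "y (min (\<tau> t) w) \<in> S" if "t \<ge> 0" "w \<ge> 0" for t w
      using that cadlag_in[OF x] cadlag_in[OF y] time_changeD(5)[OF \<tau>] by auto
    have "skorohod_gap r x y \<tau> v \<le> skorohod_gap r x y \<tau> u + 2 * (e / 3)"
    proof (rule gap_le)
      fix t :: real assume t: "t \<ge> 0"
      have "min 1 (r (x (min t v)) (y (min (\<tau> t) v))) \<le> min 1 (r (x (min t u)) (y (min (\<tau> t) u)))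
        + r (x (min t v)) (x (min t u)) + r (y (min (\<tau> t) v)) (y (min (\<tau> t) u))"
        using in_S[OF t] u v by (intro min_one_lipschitz) auto
      then show "min 1 (r (x (min t v)) (y (min (\<tau> t) v))) \<le> skorohod_gap r x y \<tau> u + 2 * (e / 3)"
        using near(1)[OF t] near(2)[OF time_changeD(5)[OF \<tau> t]] gap_ge[OF t, of x u y \<tau>] by linarith
    qed
    moreover have "skorohod_gap r x y \<tau> u \<le> skorohod_gap r x y \<tau> v + 2 * (e / 3)"
    proof (rule gap_le)
      fix t :: real assume t: "t \<ge> 0"
      have "min 1 (r (x (min t u)) (y (min (\<tau> t) u))) \<le> min 1 (r (x (min t v)) (y (min (\<tau> t) v)))
        + r (x (min t u)) (x (min t v)) + r (y (min (\<tau> t) u)) (y (min (\<tau> t) v))"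
        using in_S[OF t] u v by (intro min_one_lipschitz) auto
      then show "min 1 (r (x (min t u)) (y (min (\<tau> t) u))) \<le> skorohod_gap r x y \<tau> v + 2 * (e / 3)"
        using near(1)[OF t] near(2)[OF time_changeD(5)[OF \<tau> t]] gap_ge[OF t, of x v y \<tau>]
          commute[of "x (min t u)" "x (min t v)"] commute[of "y (min (\<tau> t) u)" "y (min (\<tau> t) v)"] by linarith
    qed
    ultimately show ?thesis using e by (simp add: dist_real_def)
  qed
  then show "\<forall>\<^sub>F v in at_right u. dist (skorohod_gap r x y \<tau> v) (skorohod_gap r x y \<tau> u) < e"
    unfolding eventually_at_right_field using d(1) d'(1) by (intro exI[of _ "u + min d d'"]) auto
qed

lemma gap_integrable:
  assumes x: "x \<in> cadlag" and y: "y \<in> cadlag" and \<tau>: "\<tau> \<in> time_changes"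
  shows "set_integrable lborel {0..} (\<lambda>u. exp (- u) * skorohod_gap r x y \<tau> u)"
proof -
  let ?h = "\<lambda>u. indicat_real {0..} u *\<^sub>R (exp (- u) * skorohod_gap r x y \<tau> u)"
  have "(?h \<longlongrightarrow> ?h u) (at_right u)" for u
  proof (cases "u \<ge> 0")
    case True
    have "((\<lambda>u. exp (- u) * skorohod_gap r x y \<tau> u) \<longlongrightarrow> ?h u) (at_right u)"
      using True by (auto intro!: tendsto_intros gap_right_continuous[OF x y \<tau>])
    then show ?thesis
      by (rule Lim_transform_eventually)
        (use True in \<open>auto simp: eventually_at_right_field intro!: exI[of _ "u + 1"]\<close>)
  next
    case False
    have "((\<lambda>u. 0) \<longlongrightarrow> ?h u) (at_right u)" using False by simp
    then show ?thesis
      by (rule Lim_transform_eventually)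
        (use False in \<open>auto simp: eventually_at_right_field intro!: exI[of _ 0]\<close>)
  qed
  then have "?h \<in> borel_measurable lborel" by (simp add: borel_measurable_right_continuous)
  moreover have "norm (?h u) \<le> norm (indicat_real {0..} u *\<^sub>R exp (- u))" for u
    using gap_bounds[of x y \<tau> u] by (simp add: indicator_def)
  ultimately show ?thesis
    using exp_minus_atLeast(1)[of 0] unfolding set_integrable_def
    by (intro Bochner_Integration.integrable_bound[of lborel _ ?h]) auto
qed

lemma cost_compose:
  assumes x: "x \<in> cadlag" and y: "y \<in> cadlag" and z: "z \<in> cadlag"
    and \<tau>: "\<tau> \<in> time_changes" and \<sigma>: "\<sigma> \<in> time_changes"
  shows "skorohod_cost r x z (\<lambda>t. \<sigma> (\<tau> t)) \<le> skorohod_cost r x y \<tau> + skorohod_cost r y z \<sigma>"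
proof -
  note C = compose_time_change[OF \<tau> \<sigma>]
  have gap: "skorohod_gap r x z (\<lambda>t. \<sigma> (\<tau> t)) u \<le> skorohod_gap r x y \<tau> u + skorohod_gap r y z \<sigma> u"
    if u: "u \<ge> 0" for u
  proof (rule gap_le)
    fix t :: real assume t: "t \<ge> 0"
    have t': "\<tau> t \<ge> 0" "\<sigma> (\<tau> t) \<ge> 0" using time_changeD(5)[OF \<tau>] time_changeD(5)[OF \<sigma>] t by auto
    have "min 1 (r (x (min t u)) (z (min (\<sigma> (\<tau> t)) u)))
      \<le> min 1 (r (x (min t u)) (y (min (\<tau> t) u))) + min 1 (r (y (min (\<tau> t) u)) (z (min (\<sigma> (\<tau> t)) u)))"
      using t t' u by (intro min_one_triangle cadlag_in[OF x] cadlag_in[OF y] cadlag_in[OF z]) auto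
    also have "\<dots> \<le> skorohod_gap r x y \<tau> u + skorohod_gap r y z \<sigma> u"
      by (intro add_mono gap_ge t t')
    finally show "min 1 (r (x (min t u)) (z (min (\<sigma> (\<tau> t)) u)))
      \<le> skorohod_gap r x y \<tau> u + skorohod_gap r y z \<sigma> u" .
  qed
  have "(LINT u:{0..}|lborel. exp (- u) * skorohod_gap r x z (\<lambda>t. \<sigma> (\<tau> t)) u)
    \<le> (LINT u:{0..}|lborel. exp (- u) * skorohod_gap r x y \<tau> u + exp (- u) * skorohod_gap r y z \<sigma> u)"
    using gap by (intro set_integral_mono set_integral_add gap_integrable x y z \<tau> \<sigma> C(1))
      (simp flip: distrib_left)
  also have "\<dots> = (LINT u:{0..}|lborel. exp (- u) * skorohod_gap r x y \<tau> u)
      + (LINT u:{0..}|lborel. exp (- u) * skorohod_gap r y z \<sigma> u)"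
    by (intro set_integral_add gap_integrable x y z \<tau> \<sigma>)
  finally show ?thesis
    using C(2) unfolding skorohod_cost_def
    by (intro max.boundedI order_trans[OF C(2)] add_mono max.cobounded1)
      (elim order_trans, intro add_mono max.cobounded2)
qed

lemma dist_triangle:
  assumes x: "x \<in> cadlag" and y: "y \<in> cadlag" and z: "z \<in> cadlag"
  shows "skorohod_dist r x z \<le> skorohod_dist r x y + skorohod_dist r y z"
proof (rule field_le_epsilon)
  fix e :: real assume e: "e > 0"
  obtain \<tau> where \<tau>: "\<tau> \<in> time_changes" "skorohod_cost r x y \<tau> < skorohod_dist r x y + e / 2"
    using dist_obtains_cost[of x y "skorohod_dist r x y + e / 2"] e by auto
  obtain \<sigma> where \<sigma>: "\<sigma> \<in> time_changes" "skorohod_cost r y z \<sigma> < skorohod_dist r y z + e / 2"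
    using dist_obtains_cost[of y z "skorohod_dist r y z + e / 2"] e by auto
  show "skorohod_dist r x z \<le> skorohod_dist r x y + skorohod_dist r y z + e"
    using dist_le_cost[OF compose_time_change(1)[OF \<tau>(1) \<sigma>(1)], of x z]
      cost_compose[OF x y z \<tau>(1) \<sigma>(1)] \<tau>(2) \<sigma>(2) by linarith
qed

lemma dist_self:
  assumes x: "x \<in> cadlag"
  shows "skorohod_dist r x x = 0"
proof -
  have gap: "skorohod_gap r x x (\<lambda>t. t) u = 0" if "u \<ge> 0" for u
  proof -
    have "skorohod_gap r x x (\<lambda>t. t) u \<le> 0"
    proof (rule gap_le)
      fix t :: real assume "t \<ge> 0"
      then have "x (min t u) \<in> S" using that by (intro cadlag_in[OF x]) simp
      then show "min 1 (r (x (min t u)) (x (min t u))) \<le> 0" by simp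
    qed
    then show ?thesis using gap_bounds(1)[of x x "\<lambda>t. t" u] by simp
  qed
  have "(LINT u:{0..}|lborel. exp (- u) * skorohod_gap r x x (\<lambda>t. t) u) = 0"
    unfolding set_lebesgue_integral_def
    by (intro integral_eq_zero_AE AE_I2) (auto simp: gap indicator_def)
  then have "skorohod_cost r x x (\<lambda>t. t) = 0"
    by (simp add: skorohod_cost_def id_time_change(2))
  then show ?thesis
    using dist_le_cost[OF id_time_change(1), of x x] dist_nonneg[of x x] by simp
qed

text \<open>
  If \<open>x\<close> and \<open>y\<close> differ at \<open>t\<close>, they stay apart on some interval \<open>[t, t + \<kappa>)\<close>. A time change of
  small cost moves \<open>t + \<kappa>/4\<close> only within this interval, so that the gap is bounded below for all
  horizons in \<open>[t + \<kappa>/2, t + \<kappa>)\<close>, which contradicts the small cost.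
\<close>

lemma dist_zero_imp_eq:
  assumes x: "x \<in> cadlag" and y: "y \<in> cadlag" and 0: "skorohod_dist r x y = 0"
  shows "x = y"
proof (rule ccontr)
  assume "x \<noteq> y"
  moreover have "x t = y t" if "\<not> t \<ge> 0" for t
    using x y that by (auto simp: skorohod_space_def PiE_def extensional_def)
  ultimately obtain t where t: "t \<ge> 0" "x t \<noteq> y t" by auto
  define \<rho> where "\<rho> = r (x t) (y t)"
  have S: "x t \<in> S" "y t \<in> S" using t cadlag_in x y by auto
  have \<rho>: "\<rho> > 0" using t S by (simp add: \<rho>_def)
  obtain d where d: "d > 0" "\<And>s. t \<le> s \<Longrightarrow> s < t + d \<Longrightarrow> r (x s) (x t) < \<rho> / 4"
    using cadlag_right[OF x t(1), of "\<rho> / 4"] \<rho> by auto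
  obtain d' where d': "d' > 0" "\<And>s. t \<le> s \<Longrightarrow> s < t + d' \<Longrightarrow> r (y s) (y t) < \<rho> / 4"
    using cadlag_right[OF y t(1), of "\<rho> / 4"] \<rho> by auto
  define k where "k = min d d'"
  have k: "k > 0" using d d' by (simp add: k_def)
  have apart: "r (x s) (y s') > \<rho> / 2" if "t \<le> s" "s < t + k" "t \<le> s'" "s' < t + k" for s s'
  proof -
    have "r (x s) (x t) < \<rho> / 4" "r (y s') (y t) < \<rho> / 4" using that d d' by (auto simp: k_def)
    moreover have "\<rho> \<le> r (x t) (x s) + r (x s) (y s') + r (y s') (y t)"
      unfolding \<rho>_def using triangle[of "x t" "x s" "y t"] triangle[of "x s" "y s'" "y t"] S
        cadlag_in[OF x, of s] cadlag_in[OF y, of s'] that t(1) by auto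
    ultimately show ?thesis using commute[of "x s" "x t"] by linarith
  qed
  define m where "m = min 1 (\<rho> / 2) * exp (- (t + k)) * (k / 2)"
  have m: "m > 0" using \<rho> k by (simp add: m_def)
  define s where "s = t + k / 4"
  define e where "e = min m (ln (1 + k / (4 * s)))"
  have s: "s > 0" "t \<le> s" using t k by (auto simp: s_def)
  have e: "e > 0" using m k s by (auto simp: e_def intro!: ln_gt_zero)
  obtain \<tau> where \<tau>: "\<tau> \<in> time_changes" "skorohod_cost r x y \<tau> < e"
    using dist_obtains_cost[of x y e] e 0 by auto
  have "Sup (log_slopes \<tau>) < ln (1 + k / (4 * s))"
    using \<tau>(2) by (simp add: skorohod_cost_def e_def)
  then have "exp (Sup (log_slopes \<tau>)) - 1 < k / (4 * s)"
    using k s by (subst (asm) exp_less_cancel_iff[symmetric], subst (asm) exp_ln) (auto intro: add_pos_pos)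
  then have "(exp (Sup (log_slopes \<tau>)) - 1) * s < k / (4 * s) * s" using s by (intro mult_strict_right_mono) auto
  then have dev: "\<bar>\<tau> s - s\<bar> < k / 4" using time_change_deviation[OF \<tau>(1), of s] s by simp
  then have ts: "t \<le> \<tau> s" "\<tau> s < t + k / 2" unfolding abs_less_iff by (auto simp: s_def)
  have gap: "min 1 (\<rho> / 2) \<le> skorohod_gap r x y \<tau> u" if u: "t + k / 2 \<le> u" "u \<le> t + k" for u
  proof -
    have eq: "min s u = s" "min (\<tau> s) u = \<tau> s" using u ts k by (auto simp: s_def)
    have "\<rho> / 2 < r (x s) (y (\<tau> s))" using apart[of s "\<tau> s"] s ts k by (simp add: s_def)
    then show ?thesis using gap_ge[of s x u y \<tau>] s(1) unfolding eq by linarith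
  qed
  have "m = (LINT u:{t + k/2..t + k}|lborel. min 1 (\<rho> / 2) * exp (- (t + k)))"
    using k by (simp add: m_def set_integral_const field_simps)
  also have "\<dots> \<le> (LINT u:{0..}|lborel. exp (- u) * skorohod_gap r x y \<tau> u)"
    unfolding set_lebesgue_integral_def
  proof (rule integral_mono')
    show "integrable lborel (\<lambda>u. indicat_real {0..} u *\<^sub>R (exp (- u) * skorohod_gap r x y \<tau> u))"
      using gap_integrable[OF x y \<tau>(1)] by (simp add: set_integrable_def)
    fix u :: real
    show "0 \<le> indicat_real {0..} u *\<^sub>R (exp (- u) * skorohod_gap r x y \<tau> u)"
      using gap_bounds(1) by simp
    show "indicat_real {t + k / 2..t + k} u *\<^sub>R (min 1 (\<rho> / 2) * exp (- (t + k)))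
      \<le> indicat_real {0..} u *\<^sub>R (exp (- u) * skorohod_gap r x y \<tau> u)"
    proof (cases "u \<in> {t + k / 2..t + k}")
      case True
      then have "min 1 (\<rho> / 2) * exp (- (t + k)) \<le> skorohod_gap r x y \<tau> u * exp (- u)"
        using gap[of u] \<rho> gap_bounds(1) by (intro mult_mono) auto
      then show ?thesis using True t(1) k by (simp add: mult.commute)
    next
      case False
      then show ?thesis using gap_bounds(1) by simp
    qed
  qed
  also have "\<dots> < m" using \<tau>(2) by (simp add: skorohod_cost_def e_def)
  finally show False by simp
qed

lemma Metric_space_skorohod: "Metric_space cadlag (skorohod_dist r)"
  by unfold_locales (auto simp: dist_nonneg dist_commute dist_self dist_triangle intro: dist_zero_imp_eq)

sublocale paths: Metric_space cadlag "skorohod_dist r"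
  by (rule Metric_space_skorohod)

text \<open>
  An upper bound of the distance from one time change: the integral defining the cost may be
  estimated pointwise by \<open>c\<close>, outside a set of horizons of small measure and up to a time \<open>T\<close>.
\<close>

lemma dist_le_bound:
  assumes \<tau>: "\<tau> \<in> time_changes" "\<And>z. z \<in> log_slopes \<tau> \<Longrightarrow> z \<le> \<eta>"
    and B: "B \<in> sets lborel" "emeasure lborel B < \<infinity>" and c: "0 \<le> c"
    and near: "\<And>u t. 0 \<le> u \<Longrightarrow> u < T \<Longrightarrow> u \<notin> B \<Longrightarrow> 0 \<le> t \<Longrightarrow>
        r (x (min t u)) (y (min (\<tau> t) u)) \<le> c"
  shows "skorohod_dist r x y \<le> max \<eta> (c + measure lborel B + exp (- T))"
proof -
  let ?f = "\<lambda>u. indicat_real {0..} u *\<^sub>R exp (- u) * c + indicat_real B u + indicat_real {T..} u *\<^sub>R exp (- u)"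
  have int1: "integrable lborel (\<lambda>u. indicat_real {a..} u *\<^sub>R exp (- u))" for a :: real
    using exp_minus_atLeast(1)[of a] by (simp add: set_integrable_def)
  have int2: "integrable lborel (indicat_real B)" using B by (intro integrable_real_indicator) auto
  have val: "(LINT u|lborel. indicat_real {a..} u *\<^sub>R exp (- u)) = exp (- a)" for a :: real
    using exp_minus_atLeast(2)[of a] by (simp add: set_lebesgue_integral_def)
  have "(LINT u:{0..}|lborel. exp (- u) * skorohod_gap r x y \<tau> u) \<le> (LINT u|lborel. ?f u)"
    unfolding set_lebesgue_integral_def
  proof (rule integral_mono')
    show "integrable lborel ?f" using int1 int2 by (intro Bochner_Integration.integrable_add integrable_mult_left)
    fix u :: real
    show "0 \<le> ?f u" using c by (simp add: indicator_def)
    have le1: "exp (- u) * skorohod_gap r x y \<tau> u \<le> exp (- u)" using gap_bounds(2) by simp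
    have le2: "exp (- u) * skorohod_gap r x y \<tau> u \<le> exp (- u) * c + 1" if "0 \<le> u"
      using mult_mono[of "exp (- u)" 1 "skorohod_gap r x y \<tau> u" 1] gap_bounds[of x y \<tau> u] that c
      by (intro add_increasing) auto
    have "exp (- u) * skorohod_gap r x y \<tau> u \<le> exp (- u) * c" if "0 \<le> u" "u < T" "u \<notin> B"
    proof -
      have "skorohod_gap r x y \<tau> u \<le> c" using near[OF that] by (intro gap_le) (simp add: min.coboundedI2)
      then show ?thesis by simp
    qed
    then show "indicat_real {0..} u *\<^sub>R (exp (- u) * skorohod_gap r x y \<tau> u) \<le> ?f u"
      using le1 le2 c
      by (cases "u \<ge> 0"; cases "u < T"; cases "u \<in> B") (auto simp: indicator_def intro: add_increasing)
  qed
  also have "\<dots> = c + measure lborel B + exp (- T)"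
    using int1 int2 val[of 0] val[of T] by (simp add: B)
  finally have "(LINT u:{0..}|lborel. exp (- u) * skorohod_gap r x y \<tau> u) \<le> c + measure lborel B + exp (- T)" .
  moreover have "Sup (log_slopes \<tau>) \<le> \<eta>" using \<tau>(2) by (rule cSup_least[OF log_slopes_nonempty])
  ultimately show ?thesis using dist_le_cost[OF \<tau>(1), of x y] by (simp add: skorohod_cost_def)
qed

lemma continuous_functional_at:
  assumes F: "continuous_map (skorohod_topology S r) euclideanreal F" and x: "x \<in> cadlag" and e: "e > 0"
  obtains d where "d > 0" "\<And>y. y \<in> cadlag \<Longrightarrow> skorohod_dist r x y < d \<Longrightarrow> \<bar>F y - F x\<bar> < e"
proof -
  have "openin paths.mtopology {y \<in> cadlag. F y \<in> ball (F x) e}"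
    using F openin_continuous_map_preimage[of paths.mtopology euclideanreal F "ball (F x) e"]
    by (simp add: skorohod_topology_def)
  then obtain d where d: "d > 0" "paths.mball x d \<subseteq> {y \<in> cadlag. F y \<in> ball (F x) e}"
    unfolding paths.openin_mtopology using x e by (smt (verit) centre_in_ball mem_Collect_eq)
  show thesis
    using d x by (intro that[of d]) (auto simp: paths.in_mball subset_iff dist_real_def abs_minus_commute)
qed

lemma continuous_functional_sequence:
  assumes F: "continuous_map (skorohod_topology S r) euclideanreal F" and x: "x \<in> cadlag"
    and y: "\<And>n. y n \<in> cadlag" and lim: "(\<lambda>n. skorohod_dist r x (y n)) \<longlonglongrightarrow> 0"
  shows "(\<lambda>n. F (y n)) \<longlonglongrightarrow> F x"
proof (rule tendstoI)
  fix e :: real assume "e > 0"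
  then obtain d where d: "d > 0" "\<And>y. y \<in> cadlag \<Longrightarrow> skorohod_dist r x y < d \<Longrightarrow> \<bar>F y - F x\<bar> < e"
    using continuous_functional_at[OF F x] by metis
  show "\<forall>\<^sub>F n in sequentially. dist (F (y n)) (F x) < e"
    using order_tendstoD(2)[OF lim d(1)] by eventually_elim (simp add: d(2) y dist_real_def)
qed

end

section \<open>Step paths and measurability of continuous functionals\<close>

lemma finite_set_separation:
  fixes D :: "real set"
  assumes "finite D"
  obtains \<delta> where "\<delta> > 0" "\<And>a b. a \<in> D \<Longrightarrow> b \<in> D \<Longrightarrow> a \<noteq> b \<Longrightarrow> \<delta> \<le> \<bar>a - b\<bar>"
proof -
  let ?P = "(\<lambda>(a, b). \<bar>a - b\<bar>) ` {(a, b) \<in> D \<times> D. a \<noteq> b}"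
  have fin: "finite ({(a, b) \<in> D \<times> D. a \<noteq> b})" by (rule finite_subset[of _ "D \<times> D"]) (use assms in auto)
  show thesis
  proof (rule that[of "Min (insert 1 ?P)"])
    show "Min (insert 1 ?P) > 0" using fin by (subst Min_gr_iff) auto
    fix a b assume ab: "a \<in> D" "b \<in> D" "a \<noteq> b"
    show "Min (insert 1 ?P) \<le> \<bar>a - b\<bar>" using fin ab by (intro Min_le) force+
  qed
qed

text \<open>
  McShane's extension of a function given on a finite set \<open>D\<close>.
\<close>

lemma lipschitz_interpolation:
  fixes v :: "real \<Rightarrow> real"
  assumes D: "finite D" "D \<noteq> {}" and \<eta>: "\<eta> \<ge> 0"
    and v: "\<And>a b. a \<in> D \<Longrightarrow> b \<in> D \<Longrightarrow> v a \<le> v b + \<eta> * \<bar>a - b\<bar>"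
  obtains g where "\<And>a. a \<in> D \<Longrightarrow> g a = v a" "\<And>s t. \<bar>g t - g s\<bar> \<le> \<eta> * \<bar>t - s\<bar>"
proof -
  define g where "g t = (MIN a\<in>D. v a + \<eta> * \<bar>t - a\<bar>)" for t
  have one_side: "g t \<le> g s + \<eta> * \<bar>t - s\<bar>" for s t
  proof -
    have "g s \<in> (\<lambda>a. v a + \<eta> * \<bar>s - a\<bar>) ` D" unfolding g_def using D by (intro Min_in) auto
    then obtain a where a: "a \<in> D" "g s = v a + \<eta> * \<bar>s - a\<bar>" by auto
    have "g t \<le> v a + \<eta> * \<bar>t - a\<bar>" unfolding g_def using D a by (intro Min_le) auto
    also have "\<dots> \<le> v a + \<eta> * (\<bar>t - s\<bar> + \<bar>s - a\<bar>)"
      using \<eta> by (intro add_left_mono mult_left_mono) auto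
    finally show ?thesis using a(2) by (simp add: algebra_simps)
  qed
  show thesis
  proof (rule that[of g])
    fix a assume a: "a \<in> D"
    have "g a \<le> v a + \<eta> * \<bar>a - a\<bar>" unfolding g_def using D a by (intro Min_le finite_imageI imageI)
    moreover have "v a \<le> g a" unfolding g_def using D v[OF a] by (intro Min.boundedI) auto
    ultimately show "g a = v a" by simp
  next
    fix s t
    show "\<bar>g t - g s\<bar> \<le> \<eta> * \<bar>t - s\<bar>"
      using one_side[of t s] one_side[of s t] by (simp add: abs_le_iff abs_minus_commute)
  qed
qed

context skorohod begin

text \<open>
  Around each time the path oscillates by less than \<open>e\<close> on either side. Finitely many such
  neighbourhoods cover \<open>[0, T]\<close>, and \<open>D\<close> consists of their centres and end points, so that two times
  that no point of \<open>D\<close> separates lie on the same side of the same centre.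
\<close>

lemma oscillation_partition:
  assumes x: "x \<in> cadlag" and e: "e > 0"
  obtains D where "finite D" "0 \<in> D"
    "\<And>p q. 0 \<le> p \<Longrightarrow> p \<le> T \<Longrightarrow> 0 \<le> q \<Longrightarrow> (\<And>d. d \<in> D \<Longrightarrow> d \<le> p \<longleftrightarrow> d \<le> q) \<Longrightarrow> r (x p) (x q) < e"
proof -
  define P where "P s \<delta> \<longleftrightarrow> \<delta> > 0 \<and> (\<forall>a. s \<le> a \<longrightarrow> a < s + \<delta> \<longrightarrow> r (x a) (x s) < e / 2) \<and>
      (\<forall>a b. 0 \<le> a \<longrightarrow> s - \<delta> < a \<longrightarrow> a < s \<longrightarrow> 0 \<le> b \<longrightarrow> s - \<delta> < b \<longrightarrow> b < s \<longrightarrow> r (x a) (x b) < e)"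
    for s \<delta>
  have "\<exists>\<delta>. P s \<delta>" if s: "s \<ge> 0" for s
  proof -
    obtain d where d: "d > 0" "\<And>a. s \<le> a \<Longrightarrow> a < s + d \<Longrightarrow> r (x a) (x s) < e / 2"
      using cadlag_right[OF x s half_gt_zero[OF e]] by metis
    show ?thesis
    proof (cases "s = 0")
      case True then show ?thesis using d by (intro exI[of _ d]) (auto simp: P_def)
    next
      case False
      then have "s > 0" using s by simp
      then obtain d' where d': "d' > 0"
        "\<And>a b. s - d' < a \<Longrightarrow> a < s \<Longrightarrow> s - d' < b \<Longrightarrow> b < s \<Longrightarrow> r (x a) (x b) < e"
        using cadlag_left[OF x _ e] by metis
      then show ?thesis using d by (intro exI[of _ "min d d'"]) (auto simp: P_def)
    qed
  qed
  then obtain \<delta> where "\<And>s. s \<ge> 0 \<Longrightarrow> P s (\<delta> s)" by metis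
  then have \<delta>: "s \<ge> 0 \<Longrightarrow> \<delta> s > 0"
    "s \<ge> 0 \<Longrightarrow> s \<le> a \<Longrightarrow> a < s + \<delta> s \<Longrightarrow> r (x a) (x s) < e / 2"
    "s \<ge> 0 \<Longrightarrow> 0 \<le> a \<Longrightarrow> s - \<delta> s < a \<Longrightarrow> a < s \<Longrightarrow> 0 \<le> b \<Longrightarrow> s - \<delta> s < b \<Longrightarrow> b < s \<Longrightarrow>
       r (x a) (x b) < e" for s a b
    unfolding P_def by blast+
  have "{0..T} \<subseteq> (\<Union>s\<in>{0..T}. ball s (\<delta> s / 2))" using \<delta>(1) by force
  then obtain C where C: "C \<subseteq> {0..T}" "finite C" "{0..T} \<subseteq> (\<Union>s\<in>C. ball s (\<delta> s / 2))"
    using compactE_image[of "{0..T}" "{0..T}" "\<lambda>s. ball s (\<delta> s / 2)"] by (metis compact_Icc open_ball)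
  define D where "D = insert 0 (C \<union> (\<lambda>s. s + \<delta> s / 2) ` C \<union> (\<lambda>s. max 0 (s - \<delta> s / 2)) ` C)"
  show thesis
  proof (rule that[of D])
    show "finite D" "0 \<in> D" using C by (auto simp: D_def)
    fix p q :: real
    assume p: "0 \<le> p" "p \<le> T" and q: "0 \<le> q" and cut: "\<And>d. d \<in> D \<Longrightarrow> d \<le> p \<longleftrightarrow> d \<le> q"
    obtain s where s: "s \<in> C" "p \<in> ball s (\<delta> s / 2)" using C p by force
    have s0: "s \<ge> 0" "\<delta> s > 0" using s C \<delta>(1)[of s] by auto
    have pp: "s - \<delta> s / 2 < p" "p < s + \<delta> s / 2" using s(2) unfolding mem_ball dist_real_def abs_less_iff by auto
    have "s + \<delta> s / 2 \<le> p \<longleftrightarrow> s + \<delta> s / 2 \<le> q"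
      and "max 0 (s - \<delta> s / 2) \<le> p \<longleftrightarrow> max 0 (s - \<delta> s / 2) \<le> q"
      and side: "s \<le> p \<longleftrightarrow> s \<le> q"
      using s(1) by (intro cut; simp add: D_def)+
    then have qq: "s - \<delta> s / 2 \<le> q" "q < s + \<delta> s / 2" using pp p by auto
    show "r (x p) (x q) < e"
    proof (cases "s \<le> p")
      case True
      then have "s \<le> q" using side by simp
      have "r (x p) (x s) < e / 2" using True pp s0 by (intro \<delta>(2)) linarith+
      moreover have "r (x q) (x s) < e / 2" using \<open>s \<le> q\<close> qq s0 by (intro \<delta>(2)) linarith+
      moreover have "r (x p) (x q) \<le> r (x p) (x s) + r (x s) (x q)"
        using cadlag_in[OF x] p q s0 by (intro triangle) auto
      ultimately show ?thesis using commute[of "x s" "x q"] by linarith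
    next
      case False
      then show ?thesis using side pp qq s0 p q by (intro \<delta>(3)[of s]) linarith+
    qed
  qed
qed

text \<open>
  The path that takes the value \<open>z k\<close> on \<open>[k/n, (k+1)/n)\<close>. It is frozen from time \<open>n\<close> on, which makes
  it depend on finitely many of the \<open>z k\<close>.
\<close>

definition step_path :: "nat \<Rightarrow> (nat \<Rightarrow> 's) \<Rightarrow> real \<Rightarrow> 's" where
  "step_path n z = (\<lambda>t\<in>{0..}. z (min (nat \<lfloor>real n * t\<rfloor>) (n * n)))"

lemma step_path_cadlag:
  assumes n: "n > 0" and z: "\<And>k. z k \<in> S"
  shows "step_path n z \<in> cadlag"
  unfolding skorohod_space_def
proof (intro CollectI conjI allI impI)
  show "step_path n z \<in> {0..} \<rightarrow>\<^sub>E S" using z by (auto simp: step_path_def)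
  have lim: "limitin mtopology (step_path n z) (z (min (nat m) (n * n))) F"
    if "\<forall>\<^sub>F s in F. s \<ge> 0 \<and> \<lfloor>real n * s\<rfloor> = m" for F m
  proof (rule limitin_transform_eventually)
    show "limitin mtopology (\<lambda>_. z (min (nat m) (n * n))) (z (min (nat m) (n * n))) F"
      using z by (simp add: limitin_const)
    show "\<forall>\<^sub>F s in F. z (min (nat m) (n * n)) = step_path n z s"
      using that by eventually_elim (auto simp: step_path_def)
  qed
  fix t :: real
  show "limitin mtopology (step_path n z) (step_path n z t) (at_right t)" if t: "0 \<le> t"
  proof -
    have "\<forall>\<^sub>F s in at_right t. s \<ge> 0 \<and> \<lfloor>real n * s\<rfloor> = \<lfloor>real n * t\<rfloor>"
      unfolding eventually_at_right_field
    proof (intro exI[of _ "(real_of_int \<lfloor>real n * t\<rfloor> + 1) / real n"] conjI allI impI)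
      have "real n * t < real_of_int \<lfloor>real n * t\<rfloor> + 1" by linarith
      then show "t < (real_of_int \<lfloor>real n * t\<rfloor> + 1) / real n" using n by (simp add: field_simps)
      fix s assume s: "t < s" "s < (real_of_int \<lfloor>real n * t\<rfloor> + 1) / real n"
      show "0 \<le> s" using s t by simp
      have "real n * t < real n * s" "real n * s < real_of_int \<lfloor>real n * t\<rfloor> + 1"
        using s n by (auto simp: field_simps)
      then show "\<lfloor>real n * s\<rfloor> = \<lfloor>real n * t\<rfloor>" by linarith
    qed
    from lim[OF this] show ?thesis using t by (simp add: step_path_def)
  qed
  show "\<exists>l. limitin mtopology (step_path n z) l (at_left t)" if t: "0 < t"
  proof -
    have "\<forall>\<^sub>F s in at_left t. s \<ge> 0 \<and> \<lfloor>real n * s\<rfloor> = \<lceil>real n * t\<rceil> - 1"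
      unfolding eventually_at_left_field
    proof (intro exI[of _ "max 0 ((real_of_int \<lceil>real n * t\<rceil> - 1) / real n)"] conjI allI impI)
      have "real_of_int \<lceil>real n * t\<rceil> - 1 < real n * t" by linarith
      then show "max 0 ((real_of_int \<lceil>real n * t\<rceil> - 1) / real n) < t" using n t by (simp add: field_simps)
      fix s assume s: "max 0 ((real_of_int \<lceil>real n * t\<rceil> - 1) / real n) < s" "s < t"
      show "0 \<le> s" using s by simp
      have "real n * s < real n * t" "real_of_int \<lceil>real n * t\<rceil> - 1 < real n * s"
        using s n by (auto simp: field_simps)
      then show "\<lfloor>real n * s\<rfloor> = \<lceil>real n * t\<rceil> - 1" by linarith
    qed
    from lim[OF this] show ?thesis by blast
  qed
qed

lemma step_path_dist_tendsto:
  assumes n: "n > 0" and z: "\<And>k. z k \<in> S" "\<And>m k. z' m k \<in> S"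
    and lim: "\<And>k. (\<lambda>m. r (z k) (z' m k)) \<longlonglongrightarrow> 0"
  shows "(\<lambda>m. skorohod_dist r (step_path n z) (step_path n (z' m))) \<longlonglongrightarrow> 0"
proof (rule LIMSEQ_I)
  fix e :: real assume e: "e > 0"
  define T where "T = ln (4 / e)"
  have T: "exp (- T) < e / 2" using e by (simp add: T_def exp_minus)
  have "\<forall>\<^sub>F m in sequentially. \<forall>k\<in>{..n * n}. r (z k) (z' m k) < e / 2"
    using order_tendstoD(2)[OF lim half_gt_zero[OF e]] by (intro eventually_ball_finite) auto
  then obtain m0 where m0: "\<And>m k. m \<ge> m0 \<Longrightarrow> k \<le> n * n \<Longrightarrow> r (z k) (z' m k) < e / 2"
    by (auto simp: eventually_sequentially)
  have "norm (skorohod_dist r (step_path n z) (step_path n (z' m)) - 0) < e" if m: "m \<ge> m0" for m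
  proof -
    have "skorohod_dist r (step_path n z) (step_path n (z' m)) \<le> max 0 (e / 2 + measure lborel ({} :: real set) + exp (- T))"
    proof (rule dist_le_bound[OF id_time_change(1)])
      show "w \<le> 0" if "w \<in> log_slopes (\<lambda>t. t)" for w
        using cSup_upper[OF that time_changeD(3)[OF id_time_change(1)]] by (simp add: id_time_change(2))
      fix u t :: real assume "0 \<le> u" "0 \<le> t"
      then show "r (step_path n z (min t u)) (step_path n (z' m) (min t u)) \<le> e / 2"
        using m0[OF m, of "min (nat \<lfloor>real n * min t u\<rfloor>) (n * n)"] by (simp add: step_path_def)
    qed (use e in auto)
    then show ?thesis using T e dist_nonneg by simp
  qed
  then show "\<exists>m0. \<forall>m\<ge>m0. norm (skorohod_dist r (step_path n z) (step_path n (z' m)) - 0) < e" by blast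
qed

text \<open>
  The time change sends each point \<open>d\<close> of a partition adapted to \<open>x\<close> to the next grid point, and is
  close to the identity because these points are separated while the grid is fine. A sampled path
  then jumps exactly when the time-changed path crosses a point of the partition; the only horizons
  that must be discarded lie between some \<open>d\<close> and its grid point.
\<close>

lemma sampled_path_dist_tendsto:
  assumes x: "x \<in> cadlag"
  shows "(\<lambda>n. skorohod_dist r x (step_path (Suc n) (\<lambda>k. x (real k / real (Suc n))))) \<longlonglongrightarrow> 0"
proof (rule LIMSEQ_I)
  fix e' :: real assume e': "e' > 0"
  define e where "e = min (1/2) (e' / 4)"
  have e: "e > 0" "e \<le> 1/2" "3 * e < e'" using e' by (auto simp: e_def)
  define T where "T = max 1 (ln (1 / e))"
  have T: "exp (- T) \<le> e" "T > 0"
  proof -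
    have "exp (- T) \<le> exp (- ln (1 / e))" by (simp add: T_def)
    also have "\<dots> = e" using e by (simp add: exp_minus)
    finally show "exp (- T) \<le> e" .
  qed (simp add: T_def)
  obtain D where D: "finite D" "0 \<in> D"
    and osc: "\<And>p q. 0 \<le> p \<Longrightarrow> p \<le> T \<Longrightarrow> 0 \<le> q \<Longrightarrow> (\<And>d. d \<in> D \<Longrightarrow> d \<le> p \<longleftrightarrow> d \<le> q) \<Longrightarrow> r (x p) (x q) < e"
    using oscillation_partition[OF x e(1), of T] by metis
  define D0 where "D0 = D \<inter> {0..}"
  have D0: "finite D0" "0 \<in> D0" "\<And>d. d \<in> D0 \<Longrightarrow> d \<ge> 0" using D by (auto simp: D0_def)
  obtain \<delta> where \<delta>: "\<delta> > 0" "\<And>a b. a \<in> D0 \<Longrightarrow> b \<in> D0 \<Longrightarrow> a \<noteq> b \<Longrightarrow> \<delta> \<le> \<bar>a - b\<bar>"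
    using finite_set_separation[OF D0(1)] by metis
  have osc0: "r (x p) (x q) < e"
    if "0 \<le> p" "p \<le> T" "0 \<le> q" "\<And>d. d \<in> D0 \<Longrightarrow> d \<le> p \<longleftrightarrow> d \<le> q" for p q
  proof (rule osc)
    fix d assume "d \<in> D"
    then show "d \<le> p \<longleftrightarrow> d \<le> q" using that by (cases "d \<ge> 0") (auto simp: D0_def)
  qed (use that in auto)
  define n0 where "n0 = nat \<lceil>max T (max (1 / (e * \<delta>)) (real (card D0) / e))\<rceil>"
  have "norm (skorohod_dist r x (step_path (Suc m) (\<lambda>k. x (real k / real (Suc m)))) - 0) < e'"
    if m: "m \<ge> n0" for m
  proof -
    define n where "n = Suc m"
    have n: "n > 0" by (simp add: n_def)
    have "real n \<ge> max T (max (1 / (e * \<delta>)) (real (card D0) / e))"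
      using m unfolding n_def n0_def by linarith
    then have n_T: "T \<le> real n" and n_\<delta>: "1 / real n \<le> e * \<delta>" and n_D: "real (card D0) / real n \<le> e"
      using e(1) \<delta>(1) n by (auto simp: field_simps)
    define s where "s d = real_of_int \<lceil>real n * d\<rceil> / real n" for d
    have s: "d \<le> s d" "s d \<le> d + 1 / real n" for d
    proof -
      have "real n * d \<le> real_of_int \<lceil>real n * d\<rceil>" "real_of_int \<lceil>real n * d\<rceil> \<le> real n * d + 1" by linarith+
      then show "d \<le> s d" "s d \<le> d + 1 / real n" unfolding s_def using n by (auto simp: field_simps)
    qed
    obtain g where g: "\<And>d. d \<in> D0 \<Longrightarrow> g d = s d - d" "\<And>a b. \<bar>g b - g a\<bar> \<le> e * \<bar>b - a\<bar>"
    proof (rule lipschitz_interpolation[of D0 e "\<lambda>d. s d - d"])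
      fix a b assume ab: "a \<in> D0" "b \<in> D0"
      show "s a - a \<le> s b - b + e * \<bar>a - b\<bar>"
      proof (cases "a = b")
        case False
        then have "e * \<delta> \<le> e * \<bar>a - b\<bar>" using \<delta>(2)[OF ab] e(1) by simp
        then show ?thesis using s(2)[of a] s(1)[of b] n_\<delta> by linarith
      qed simp
    qed (use D0 e in auto)
    have g0: "g 0 = 0" using g(1)[OF D0(2)] by (simp add: s_def)
    define \<tau> where "\<tau> t = t + g t" for t
    have \<tau>: "\<tau> \<in> time_changes" "\<And>w. w \<in> log_slopes \<tau> \<Longrightarrow> w \<le> 2 * e"
      using perturbed_identity_time_change[of g e] g(2) e g0 unfolding \<tau>_def by auto
    have \<tau>_D: "\<tau> d = s d" if "d \<in> D0" for d using g(1)[OF that] by (simp add: \<tau>_def)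
    define B where "B = (\<Union>d\<in>D0. {d..s d})"
    have B: "B \<in> sets lborel" "emeasure lborel B < \<infinity>" "measure lborel B \<le> e"
    proof -
      show "B \<in> sets lborel" unfolding B_def using D0(1) by (intro sets.finite_UN) auto
      have "emeasure lborel B \<le> (\<Sum>d\<in>D0. emeasure lborel {d..s d})"
        unfolding B_def using D0(1) by (intro emeasure_subadditive_finite) auto
      also have "\<dots> = ennreal (\<Sum>d\<in>D0. s d - d)" using s(1) by (subst sum_ennreal[symmetric]) auto
      finally have le: "emeasure lborel B \<le> ennreal (\<Sum>d\<in>D0. s d - d)" .
      then show "emeasure lborel B < \<infinity>" using le_less_trans by fastforce
      have "measure lborel B \<le> (\<Sum>d\<in>D0. s d - d)"
        unfolding measure_def using le s(1) by (intro enn2real_leI sum_nonneg) auto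
      also have "\<dots> \<le> (\<Sum>d\<in>D0. 1 / real n)" using s(2) by (intro sum_mono) (simp add: algebra_simps)
      also have "\<dots> \<le> e" using n_D by simp
      finally show "measure lborel B \<le> e" .
    qed
    have near: "r (x (min t u)) (step_path n (\<lambda>k. x (real k / real n)) (min (\<tau> t) u)) \<le> e"
      if u: "0 \<le> u" "u < T" "u \<notin> B" and t: "0 \<le> t" for u t
    proof -
      define b where "b = min (\<tau> t) u"
      have b: "0 \<le> b" "b \<le> u" using u time_changeD(5)[OF \<tau>(1) t] by (auto simp: b_def)
      define w where "w = real_of_int \<lfloor>real n * b\<rfloor> / real n"
      have "real n * b \<le> real n * real n" using b u n_T by (intro mult_left_mono) auto
      then have small: "\<lfloor>real n * b\<rfloor> \<le> int (n * n)" by (metis floor_mono floor_of_nat of_nat_mult)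
      have nonneg: "0 \<le> \<lfloor>real n * b\<rfloor>" using b by simp
      have "real (min (nat \<lfloor>real n * b\<rfloor>) (n * n)) / real n = w"
        unfolding w_def using small nonneg by (simp add: min_def nat_le_iff)
      then have val: "step_path n (\<lambda>k. x (real k / real n)) (min (\<tau> t) u) = x w"
        using b(1) unfolding b_def[symmetric] step_path_def by simp
      have "d \<le> min t u \<longleftrightarrow> d \<le> w" if d: "d \<in> D0" for d
      proof -
        have "d \<le> t \<longleftrightarrow> s d \<le> \<tau> t"
          using time_change_le_iff[OF \<tau>(1) D0(3)[OF d] t] \<tau>_D[OF d] by simp
        moreover have "u \<notin> {d..s d}" using u(3) d unfolding B_def by blast
        then have "d \<le> u \<longleftrightarrow> s d \<le> u" using s(1)[of d] by auto
        ultimately have "d \<le> min t u \<longleftrightarrow> s d \<le> b" by (simp add: b_def)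
        also have "\<dots> \<longleftrightarrow> real_of_int \<lceil>real n * d\<rceil> \<le> real n * b"
          unfolding s_def using n by (simp add: field_simps)
        also have "\<dots> \<longleftrightarrow> real n * d \<le> real_of_int \<lfloor>real n * b\<rfloor>"
          by (simp only: le_floor_iff[symmetric] ceiling_le_iff)
        also have "\<dots> \<longleftrightarrow> d \<le> w" unfolding w_def using n by (simp add: field_simps)
        finally show ?thesis .
      qed
      then have "r (x (min t u)) (x w) < e"
        using u t nonneg by (intro osc0) (auto simp: w_def)
      then show ?thesis unfolding val by simp
    qed
    have "skorohod_dist r x (step_path n (\<lambda>k. x (real k / real n)))
        \<le> max (2 * e) (e + measure lborel B + exp (- T))"
      using e(1) near by (intro dist_le_bound[OF \<tau>(1) \<tau>(2) B(1,2)]) auto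
    also have "\<dots> < e'" using B(3) T(1) e by simp
    finally show ?thesis using dist_nonneg by (simp add: n_def)
  qed
  then show "\<exists>n0. \<forall>m\<ge>n0. norm (skorohod_dist r x (step_path (Suc m) (\<lambda>k. x (real k / real (Suc m)))) - 0) < e'"
    by blast
qed

text \<open>
  A random path that is sampled on a grid and whose values are then replaced by approximations given
  by real coordinates depends on countably many real random variables, and \<open>F\<close> is a continuous function
  of them. Refining first the approximation of the values and then the grid gives
  \<open>F\<close> of the path itself as a limit of measurable functions.
\<close>

lemma borel_measurable_continuous_functional:
  fixes coord :: "nat \<Rightarrow> 's \<Rightarrow> nat \<Rightarrow> real" and decode :: "nat \<Rightarrow> (nat \<Rightarrow> real) \<Rightarrow> 's"
  assumes F: "continuous_map (skorohod_topology S r) euclideanreal F"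
    and Y: "\<And>\<omega>. \<omega> \<in> space \<Omega> \<Longrightarrow> Y \<omega> \<in> cadlag"
    and coord: "\<And>j z. z \<in> S \<Longrightarrow> coord j z \<in> C j"
    and decode: "\<And>j. continuous_map (top_of_set (C j)) mtopology (decode j)"
    and approx: "\<And>z. z \<in> S \<Longrightarrow> limitin mtopology (\<lambda>j. decode j (coord j z)) z sequentially"
    and meas: "\<And>t i j. t \<ge> 0 \<Longrightarrow> (\<lambda>\<omega>. coord j (Y \<omega> t) i) \<in> borel_measurable \<Omega>"
  shows "(\<lambda>\<omega>. F (Y \<omega>)) \<in> borel_measurable \<Omega>"
proof -
  have decode_S: "decode j c \<in> S" if "c \<in> C j" for j c
    using continuous_map_image_subset_topspace[OF decode[of j]] that by auto
  have Y_S: "Y \<omega> (real k / real n) \<in> S" if "\<omega> \<in> space \<Omega>" for \<omega> k n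
    using cadlag_in[OF Y[OF that]] by simp
  have coded: "(\<lambda>\<omega>. F (step_path n (\<lambda>k. decode j (coord j (Y \<omega> (real k / real n)))))) \<in> borel_measurable \<Omega>"
    if n: "n > 0" for n j
  proof -
    define CC where "CC = {c :: nat \<times> nat \<Rightarrow> real. \<forall>k. (\<lambda>i. c (k, i)) \<in> C j}"
    define G where "G c = F (step_path n (\<lambda>k. decode j (\<lambda>i. c (k, i))))" for c
    have "continuous_on CC G"
      unfolding continuous_on_sequentially
    proof (intro allI ballI impI, elim conjE)
      fix c :: "nat \<Rightarrow> nat \<times> nat \<Rightarrow> real" and a
      assume a: "a \<in> CC" and c: "\<forall>m. c m \<in> CC" and lim: "c \<longlonglongrightarrow> a"
      have "(\<lambda>m. r (decode j (\<lambda>i. a (k, i))) (decode j (\<lambda>i. c m (k, i)))) \<longlonglongrightarrow> 0" for k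
      proof -
        have "continuous_on UNIV (\<lambda>c :: nat \<times> nat \<Rightarrow> real. \<lambda>i. c (k, i))"
          by (intro continuous_on_coordinatewise_then_product continuous_on_product_coordinates)
        from continuous_on_tendsto_compose[OF this lim]
        have "(\<lambda>m i. c m (k, i)) \<longlonglongrightarrow> (\<lambda>i. a (k, i))" by simp
        then have "limitin (top_of_set (C j)) (\<lambda>m i. c m (k, i)) (\<lambda>i. a (k, i)) sequentially"
          using a c by (auto simp: limitin_subtopology CC_def)
        then have "limitin mtopology (decode j \<circ> (\<lambda>m i. c m (k, i))) (decode j (\<lambda>i. a (k, i))) sequentially"
          by (rule continuous_map_limit[OF decode])
        then show ?thesis by (simp add: limitin_metric_dist_null comp_def commute[of "decode j (\<lambda>i. a (k, i))"])
      qed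
      then have "(\<lambda>m. F (step_path n (\<lambda>k. decode j (\<lambda>i. c m (k, i)))))
          \<longlonglongrightarrow> F (step_path n (\<lambda>k. decode j (\<lambda>i. a (k, i))))"
        using a c decode_S
        by (intro continuous_functional_sequence[OF F] step_path_cadlag step_path_dist_tendsto n)
          (auto simp: CC_def)
      then show "(G \<circ> c) \<longlonglongrightarrow> G a" by (simp add: G_def comp_def)
    qed
    then have G: "G \<in> borel_measurable (restrict_space borel CC)"
      by (rule borel_measurable_continuous_on_restrict)
    define cY where "cY \<omega> = (\<lambda>(k, i). coord j (Y \<omega> (real k / real n)) i)" for \<omega>
    have "cY \<in> borel_measurable \<Omega>"
      unfolding cY_def
      by (intro measurable_coordinatewise_then_product) (auto simp: case_prod_beta intro!: meas)
    then have "cY \<in> measurable \<Omega> (restrict_space borel CC)"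
      using coord Y_S by (intro measurable_restrict_space2) (auto simp: cY_def CC_def)
    then have "(\<lambda>\<omega>. G (cY \<omega>)) \<in> borel_measurable \<Omega>" using G by (rule measurable_compose)
    then show ?thesis by (simp add: G_def cY_def)
  qed
  have sampled: "(\<lambda>\<omega>. F (step_path n (\<lambda>k. Y \<omega> (real k / real n)))) \<in> borel_measurable \<Omega>"
    if n: "n > 0" for n
  proof (rule borel_measurable_LIMSEQ_real[OF _ coded[OF n]])
    fix \<omega> assume \<omega>: "\<omega> \<in> space \<Omega>"
    have "(\<lambda>j. r (Y \<omega> (real k / real n)) (decode j (coord j (Y \<omega> (real k / real n))))) \<longlonglongrightarrow> 0" for k
      using approx[OF Y_S[OF \<omega>, of k n]]
      by (simp add: limitin_metric_dist_null commute[of "Y \<omega> (real k / real n)"])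
    then show "(\<lambda>j. F (step_path n (\<lambda>k. decode j (coord j (Y \<omega> (real k / real n))))))
        \<longlonglongrightarrow> F (step_path n (\<lambda>k. Y \<omega> (real k / real n)))"
      using Y_S[OF \<omega>] decode_S coord
      by (intro continuous_functional_sequence[OF F] step_path_cadlag step_path_dist_tendsto n) auto
  qed
  show ?thesis
  proof (rule borel_measurable_LIMSEQ_real)
    show "(\<lambda>\<omega>. F (step_path (Suc n) (\<lambda>k. Y \<omega> (real k / real (Suc n))))) \<in> borel_measurable \<Omega>" for n
      by (rule sampled) simp
    fix \<omega> assume \<omega>: "\<omega> \<in> space \<Omega>"
    show "(\<lambda>n. F (step_path (Suc n) (\<lambda>k. Y \<omega> (real k / real (Suc n))))) \<longlonglongrightarrow> F (Y \<omega>)"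
      by (intro continuous_functional_sequence[OF F Y[OF \<omega>]] step_path_cadlag
          sampled_path_dist_tendsto Y[OF \<omega>] Y_S[OF \<omega>] zero_less_Suc)
  qed
qed

end

section \<open>The weak topology on probability measures\<close>

lemma prob_measuresD:
  assumes "\<nu> \<in> prob_measures M"
  shows "prob_space \<nu>" "sets \<nu> = sets (borel_on M)" "space \<nu> = M"
  using assms sets_eq_imp_space_eq[of \<nu> "borel_on M"] by (auto simp: space_prob_algebra space_restrict_space)

lemma prob_measuresI:
  assumes "prob_space \<nu>" "sets \<nu> = sets (borel_on M)"
  shows "\<nu> \<in> prob_measures M"
  using assms by (simp add: space_prob_algebra)

lemma Cb_measurable:
  assumes "\<phi> \<in> Cb M" "\<nu> \<in> prob_measures M"
  shows "\<phi> \<in> borel_measurable \<nu>"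
  using assms borel_measurable_continuous_on_restrict[of M \<phi>]
  by (simp add: Cb_def prob_measuresD measurable_cong_sets[OF prob_measuresD(2) refl])

lemma Cb_integrable:
  assumes "\<phi> \<in> Cb M" "\<nu> \<in> prob_measures M"
  shows "integrable \<nu> \<phi>"
proof -
  interpret prob_space \<nu> using assms prob_measuresD by blast
  obtain B where "\<And>m. m \<in> M \<Longrightarrow> norm (\<phi> m) \<le> B"
    using assms(1) by (auto simp: Cb_def bounded_iff)
  then show ?thesis
    using assms Cb_measurable[OF assms] prob_measuresD(3)[OF assms(2)]
    by (intro integrable_const_bound[of _ B]) auto
qed

lemma abs_integral_le_bound:
  assumes \<nu>: "\<nu> \<in> prob_measures M" and B: "\<And>m. m \<in> M \<Longrightarrow> \<bar>\<phi> m\<bar> \<le> B" "\<phi> \<in> Cb M"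
  shows "\<bar>\<integral>m. \<phi> m \<partial>\<nu>\<bar> \<le> (B :: real)"
proof -
  interpret prob_space \<nu> using \<nu> prob_measuresD by blast
  have "\<bar>\<integral>m. \<phi> m \<partial>\<nu>\<bar> \<le> (\<integral>m. \<bar>\<phi> m\<bar> \<partial>\<nu>)" by (rule integral_abs_bound)
  also have "\<dots> \<le> (\<integral>m. B \<partial>\<nu>)"
    using B Cb_integrable[OF B(2) \<nu>] prob_measuresD(3)[OF \<nu>] by (intro integral_mono) auto
  finally show ?thesis by (simp add: prob_space)
qed

lemma compact_Cb: "compact M \<Longrightarrow> continuous_on M \<phi> \<Longrightarrow> \<phi> \<in> Cb M"
  by (simp add: Cb_def compact_continuous_image compact_imp_bounded)

lemma Cb_bounded:
  assumes "\<phi> \<in> Cb M"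
  obtains B where "B \<ge> 0" "\<And>m. m \<in> M \<Longrightarrow> \<bar>\<phi> m\<bar> \<le> B"
proof -
  obtain B where "\<And>m. m \<in> M \<Longrightarrow> \<bar>\<phi> m\<bar> \<le> B" using assms by (auto simp: Cb_def bounded_iff)
  then show thesis using that[of "max B 0"] by (simp add: le_max_iff_disj)
qed

lemma topspace_weak_topology: "topspace (weak_topology M) = prob_measures M"
proof -
  have "prob_measures M \<in> {{\<nu> \<in> prob_measures M. (\<integral>m. \<phi> m \<partial>\<nu>) \<in> V} | \<phi> V. \<phi> \<in> Cb M \<and> open V}"
    by (intro CollectI exI[of _ "\<lambda>_. 0"] exI[of _ UNIV]) (auto simp: Cb_def bounded_iff)
  then show ?thesis unfolding weak_topology_def topology_generated_by_topspace by blast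
qed

text \<open>
  Test functions with finitely many constraints form a neighbourhood basis, although the topology is
  given by a subbasis: a finite intersection of subbasic sets only takes the union of the constraints
  and the least tolerance.
\<close>

lemma weak_neighbourhood:
  assumes "openin (weak_topology M) U" "l \<in> U"
  obtains \<Phi> \<delta> where "finite \<Phi>" "\<Phi> \<subseteq> Cb M" "\<delta> > 0"
    "\<And>\<sigma>. \<sigma> \<in> prob_measures M \<Longrightarrow> (\<And>\<phi>. \<phi> \<in> \<Phi> \<Longrightarrow> \<bar>(\<integral>m. \<phi> m \<partial>\<sigma>) - (\<integral>m. \<phi> m \<partial>l)\<bar> < \<delta>) \<Longrightarrow> \<sigma> \<in> U"
proof -
  define P where "P U l \<longleftrightarrow> (\<exists>\<Phi> \<delta>. finite \<Phi> \<and> \<Phi> \<subseteq> Cb M \<and> \<delta> > (0::real) \<and>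
    (\<forall>\<sigma>\<in>prob_measures M. (\<forall>\<phi>\<in>\<Phi>. \<bar>(\<integral>m. \<phi> m \<partial>\<sigma>) - (\<integral>m. \<phi> m \<partial>l)\<bar> < \<delta>) \<longrightarrow> \<sigma> \<in> U))" for U and l :: "'a measure"
  have gen: "generate_topology_on {{\<nu> \<in> prob_measures M. (\<integral>m. \<phi> m \<partial>\<nu>) \<in> V} | \<phi> V. \<phi> \<in> Cb M \<and> open V} U"
    using assms(1) by (simp add: weak_topology_def openin_topology_generated_by_iff)
  have "P U l" using gen assms(2)
  proof (induction arbitrary: l)
    case Empty then show ?case by simp
  next
    case (Int a b)
    then have "P a l" "P b l" by auto
    then obtain \<Phi> \<delta> \<Phi>' \<delta>' where 1: "finite \<Phi>" "\<Phi> \<subseteq> Cb M" "\<delta> > 0"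
      "\<forall>\<sigma>\<in>prob_measures M. (\<forall>\<phi>\<in>\<Phi>. \<bar>(\<integral>m. \<phi> m \<partial>\<sigma>) - (\<integral>m. \<phi> m \<partial>l)\<bar> < \<delta>) \<longrightarrow> \<sigma> \<in> a"
      and 2: "finite \<Phi>'" "\<Phi>' \<subseteq> Cb M" "\<delta>' > 0"
      "\<forall>\<sigma>\<in>prob_measures M. (\<forall>\<phi>\<in>\<Phi>'. \<bar>(\<integral>m. \<phi> m \<partial>\<sigma>) - (\<integral>m. \<phi> m \<partial>l)\<bar> < \<delta>') \<longrightarrow> \<sigma> \<in> b"
      unfolding P_def by metis
    show ?case unfolding P_def
      using 1 2 by (intro exI[of _ "\<Phi> \<union> \<Phi>'"] exI[of _ "min \<delta> \<delta>'"]) auto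
  next
    case (UN K)
    then obtain k where "k \<in> K" "P k l" by auto
    then show ?case unfolding P_def by blast
  next
    case (Basis s)
    then obtain \<phi> V where s: "s = {\<nu> \<in> prob_measures M. (\<integral>m. \<phi> m \<partial>\<nu>) \<in> V}" "\<phi> \<in> Cb M" "open V" by blast
    then have "(\<integral>m. \<phi> m \<partial>l) \<in> V" using Basis by blast
    then obtain \<delta> where "\<delta> > 0" "\<And>y. dist y (\<integral>m. \<phi> m \<partial>l) < \<delta> \<Longrightarrow> y \<in> V"
      using s(3) open_dist by metis
    then show ?case unfolding P_def using s
      by (intro exI[of _ "{\<phi>}"] exI[of _ \<delta>]) (auto simp: dist_real_def)
  qed
  then obtain \<Phi> \<delta> where *: "finite \<Phi>" "\<Phi> \<subseteq> Cb M" "\<delta> > 0"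
    and "\<forall>\<sigma>\<in>prob_measures M. (\<forall>\<phi>\<in>\<Phi>. \<bar>(\<integral>m. \<phi> m \<partial>\<sigma>) - (\<integral>m. \<phi> m \<partial>l)\<bar> < \<delta>) \<longrightarrow> \<sigma> \<in> U"
    unfolding P_def by (elim exE conjE)
  then show thesis by (intro that[OF *]) simp
qed

lemma limitin_weak_topology:
  "limitin (weak_topology M) f l F \<longleftrightarrow>
     l \<in> prob_measures M \<and> (\<forall>\<^sub>F x in F. f x \<in> prob_measures M) \<and>
     (\<forall>\<phi>\<in>Cb M. ((\<lambda>x. \<integral>m. \<phi> m \<partial>f x) \<longlongrightarrow> (\<integral>m. \<phi> m \<partial>l)) F)" (is "?L \<longleftrightarrow> ?R")
proof
  assume L: ?L
  have "((\<lambda>x. \<integral>m. \<phi> m \<partial>f x) \<longlongrightarrow> (\<integral>m. \<phi> m \<partial>l)) F" if \<phi>: "\<phi> \<in> Cb M" for \<phi>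
  proof (rule topological_tendstoI)
    fix V assume V: "open V" "(\<integral>m. \<phi> m \<partial>l) \<in> V"
    have "openin (weak_topology M) {\<nu> \<in> prob_measures M. (\<integral>m. \<phi> m \<partial>\<nu>) \<in> V}"
      unfolding weak_topology_def using \<phi> V by (intro topology_generated_by_Basis) blast
    moreover have "l \<in> {\<nu> \<in> prob_measures M. (\<integral>m. \<phi> m \<partial>\<nu>) \<in> V}"
      using L V limitin_topspace[OF L] by (simp add: topspace_weak_topology)
    ultimately have "\<forall>\<^sub>F x in F. f x \<in> {\<nu> \<in> prob_measures M. (\<integral>m. \<phi> m \<partial>\<nu>) \<in> V}"
      using L unfolding limitin_def by blast
    then show "\<forall>\<^sub>F x in F. (\<integral>m. \<phi> m \<partial>f x) \<in> V" by eventually_elim simp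
  qed
  moreover have "l \<in> prob_measures M" using limitin_topspace[OF L] by (simp add: topspace_weak_topology)
  moreover have "\<forall>\<^sub>F x in F. f x \<in> prob_measures M"
    using L \<open>l \<in> prob_measures M\<close> openin_topspace[of "weak_topology M"]
    unfolding limitin_def topspace_weak_topology by blast
  ultimately show ?R by blast
next
  assume R: ?R
  show ?L unfolding limitin_def
  proof (intro conjI allI impI)
    show "l \<in> topspace (weak_topology M)" using R by (simp add: topspace_weak_topology)
    fix U assume U: "openin (weak_topology M) U \<and> l \<in> U"
    obtain \<Phi> \<delta> where \<Phi>: "finite \<Phi>" "\<Phi> \<subseteq> Cb M" "\<delta> > 0"
      "\<And>\<sigma>. \<sigma> \<in> prob_measures M \<Longrightarrow> (\<And>\<phi>. \<phi> \<in> \<Phi> \<Longrightarrow> \<bar>(\<integral>m. \<phi> m \<partial>\<sigma>) - (\<integral>m. \<phi> m \<partial>l)\<bar> < \<delta>) \<Longrightarrow> \<sigma> \<in> U"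
      using weak_neighbourhood U by metis
    have "\<forall>\<^sub>F x in F. \<forall>\<phi>\<in>\<Phi>. \<bar>(\<integral>m. \<phi> m \<partial>f x) - (\<integral>m. \<phi> m \<partial>l)\<bar> < \<delta>"
      using \<Phi>(1-3) R by (intro eventually_ball_finite ballI) (auto dest!: tendstoD[where e=\<delta>] simp: dist_real_def)
    moreover have "\<forall>\<^sub>F x in F. f x \<in> prob_measures M" using R by blast
    ultimately show "\<forall>\<^sub>F x in F. f x \<in> U" by eventually_elim (simp add: \<Phi>(4))
  qed
qed

text \<open>
  A constant sequence \<open>\<nu>\<close> converges weakly to every measure with the same integrals, and limits in a
  metrisable topology are unique.
\<close>

lemma prob_measures_eqI:
  assumes r: "Metric_space (prob_measures M) r" "Metric_space.mtopology (prob_measures M) r = weak_topology M"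
    and \<nu>: "\<nu> \<in> prob_measures M" "\<nu>' \<in> prob_measures M"
    and eq: "\<And>\<phi>. \<phi> \<in> Cb M \<Longrightarrow> (\<integral>m. \<phi> m \<partial>\<nu>) = (\<integral>m. \<phi> m \<partial>\<nu>')"
  shows "\<nu> = \<nu>'"
proof -
  have "limitin (weak_topology M) (\<lambda>_. \<nu>) \<nu> (sequentially)" "limitin (weak_topology M) (\<lambda>_. \<nu>) \<nu>' sequentially"
    using \<nu> eq by (auto simp: limitin_weak_topology topspace_weak_topology)
  then show ?thesis using Metric_space.limitin_metric_unique[OF r(1)] r(2) by (metis sequentially_bot)
qed

text \<open>
  By compactness of the time interval, finitely many test functions suffice to control the distance
  to a weakly continuous path at all times at once.
\<close>

lemma uniform_weak_neighbourhood_of_path: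
  fixes x :: "real \<Rightarrow> 'a::topological_space measure"
  assumes r: "Metric_space (prob_measures M) r" "Metric_space.mtopology (prob_measures M) r = weak_topology M"
    and x: "\<And>t. t \<in> {0..T} \<Longrightarrow> limitin (weak_topology M) x (x t) (at t within {0..T})" and e: "e > 0"
  obtains \<Phi> \<delta> where "finite \<Phi>" "\<Phi> \<subseteq> Cb M" "\<delta> > 0"
    "\<And>t \<sigma>. t \<in> {0..T} \<Longrightarrow> \<sigma> \<in> prob_measures M \<Longrightarrow>
       (\<And>\<phi>. \<phi> \<in> \<Phi> \<Longrightarrow> \<bar>(\<integral>m. \<phi> m \<partial>\<sigma>) - (\<integral>m. \<phi> m \<partial>x t)\<bar> < \<delta>) \<Longrightarrow> r (x t) \<sigma> < e"
proof -
  interpret Metric_space "prob_measures M" r by (rule r(1))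
  have x_in: "x t \<in> prob_measures M" if "t \<in> {0..T}" for t
    using x[OF that] by (simp add: limitin_weak_topology)
  define P where "P t \<Phi> \<delta> \<kappa> \<longleftrightarrow> finite \<Phi> \<and> \<Phi> \<subseteq> Cb M \<and> \<delta> > 0 \<and> \<kappa> > 0 \<and>
    (\<forall>\<sigma>\<in>prob_measures M. (\<forall>\<phi>\<in>\<Phi>. \<bar>(\<integral>m. \<phi> m \<partial>\<sigma>) - (\<integral>m. \<phi> m \<partial>x t)\<bar> < 2 * \<delta>) \<longrightarrow> r (x t) \<sigma> < e / 2) \<and>
    (\<forall>s\<in>{0..T}. dist s t < \<kappa> \<longrightarrow> (\<forall>\<phi>\<in>\<Phi>. \<bar>(\<integral>m. \<phi> m \<partial>x s) - (\<integral>m. \<phi> m \<partial>x t)\<bar> < \<delta>))"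
    for t \<Phi> and \<delta> \<kappa> :: real
  have "\<exists>\<Phi> \<delta> \<kappa>. P t \<Phi> \<delta> \<kappa>" if t: "t \<in> {0..T}" for t
  proof -
    have "openin (weak_topology M) (mball (x t) (e / 2))" "x t \<in> mball (x t) (e / 2)"
      using openin_mball[of "x t" "e / 2"] r(2) x_in[OF t] e by auto
    then obtain \<Phi> \<delta> where \<Phi>: "finite \<Phi>" "\<Phi> \<subseteq> Cb M" "\<delta> > 0"
      "\<And>\<sigma>. \<sigma> \<in> prob_measures M \<Longrightarrow> (\<And>\<phi>. \<phi> \<in> \<Phi> \<Longrightarrow> \<bar>(\<integral>m. \<phi> m \<partial>\<sigma>) - (\<integral>m. \<phi> m \<partial>x t)\<bar> < \<delta>) \<Longrightarrow> \<sigma> \<in> mball (x t) (e / 2)"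
      using weak_neighbourhood by metis
    have "\<forall>\<^sub>F s in at t within {0..T}. \<forall>\<phi>\<in>\<Phi>. \<bar>(\<integral>m. \<phi> m \<partial>x s) - (\<integral>m. \<phi> m \<partial>x t)\<bar> < \<delta> / 2"
    proof (intro eventually_ball_finite ballI \<Phi>(1))
      fix \<phi> assume "\<phi> \<in> \<Phi>"
      then have "((\<lambda>s. \<integral>m. \<phi> m \<partial>x s) \<longlongrightarrow> (\<integral>m. \<phi> m \<partial>x t)) (at t within {0..T})"
        using x[OF t] \<Phi>(2) by (auto simp: limitin_weak_topology)
      from tendstoD[OF this half_gt_zero[OF \<Phi>(3)]]
      show "\<forall>\<^sub>F s in at t within {0..T}. \<bar>(\<integral>m. \<phi> m \<partial>x s) - (\<integral>m. \<phi> m \<partial>x t)\<bar> < \<delta> / 2"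
        by (simp add: dist_real_def)
    qed
    then obtain \<kappa> where \<kappa>: "\<kappa> > 0" "\<And>s. s \<in> {0..T} \<Longrightarrow> s \<noteq> t \<Longrightarrow> dist s t < \<kappa> \<Longrightarrow>
        (\<forall>\<phi>\<in>\<Phi>. \<bar>(\<integral>m. \<phi> m \<partial>x s) - (\<integral>m. \<phi> m \<partial>x t)\<bar> < \<delta> / 2)"
      unfolding eventually_at by blast
    have "\<forall>\<phi>\<in>\<Phi>. \<bar>(\<integral>m. \<phi> m \<partial>x s) - (\<integral>m. \<phi> m \<partial>x t)\<bar> < \<delta> / 2" if "s \<in> {0..T}" "dist s t < \<kappa>" for s
      using \<kappa>(2)[OF that(1) _ that(2)] \<Phi>(3) by (cases "s = t") auto
    then have "P t \<Phi> (\<delta> / 2) \<kappa>"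
      unfolding P_def using \<Phi> \<kappa>(1) by auto
    then show ?thesis by blast
  qed
  then obtain \<Phi> \<delta> \<kappa> where "\<And>t. t \<in> {0..T} \<Longrightarrow> P t (\<Phi> t) (\<delta> t) (\<kappa> t)" by metis
  then have \<Phi>: "t \<in> {0..T} \<Longrightarrow> finite (\<Phi> t)" "t \<in> {0..T} \<Longrightarrow> \<Phi> t \<subseteq> Cb M" "t \<in> {0..T} \<Longrightarrow> \<delta> t > 0" "t \<in> {0..T} \<Longrightarrow> \<kappa> t > 0"
    and near: "t \<in> {0..T} \<Longrightarrow> \<sigma> \<in> prob_measures M \<Longrightarrow> (\<And>\<phi>. \<phi> \<in> \<Phi> t \<Longrightarrow> \<bar>(\<integral>m. \<phi> m \<partial>\<sigma>) - (\<integral>m. \<phi> m \<partial>x t)\<bar> < 2 * \<delta> t) \<Longrightarrow> r (x t) \<sigma> < e / 2"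
    and cont: "t \<in> {0..T} \<Longrightarrow> s \<in> {0..T} \<Longrightarrow> dist s t < \<kappa> t \<Longrightarrow> \<phi> \<in> \<Phi> t \<Longrightarrow> \<bar>(\<integral>m. \<phi> m \<partial>x s) - (\<integral>m. \<phi> m \<partial>x t)\<bar> < \<delta> t"
    for t s \<sigma> \<phi>
    unfolding P_def by blast+
  have "{0..T} \<subseteq> (\<Union>t\<in>{0..T}. ball t (\<kappa> t))" using \<Phi>(4) by force
  then obtain C where C: "C \<subseteq> {0..T}" "finite C" "{0..T} \<subseteq> (\<Union>t\<in>C. ball t (\<kappa> t))"
    using compactE_image[of "{0..T}" "{0..T}" "\<lambda>t. ball t (\<kappa> t)"] by (metis compact_Icc open_ball)
  define d where "d = Min (insert 1 (\<delta> ` C))"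
  have d: "d > 0" "\<And>t. t \<in> C \<Longrightarrow> d \<le> \<delta> t"
    unfolding d_def using C \<Phi>(3) by (auto simp: subset_iff)
  show thesis
  proof (rule that[of "\<Union>(\<Phi> ` C)" d])
    show "finite (\<Union>(\<Phi> ` C))" "\<Union>(\<Phi> ` C) \<subseteq> Cb M" "d > 0" using C \<Phi> d by (auto simp: subset_iff)
    fix s \<sigma> assume s: "s \<in> {0..T}" and \<sigma>: "\<sigma> \<in> prob_measures M"
      and close: "\<And>\<phi>. \<phi> \<in> \<Union>(\<Phi> ` C) \<Longrightarrow> \<bar>(\<integral>m. \<phi> m \<partial>\<sigma>) - (\<integral>m. \<phi> m \<partial>x s)\<bar> < d"
    obtain t where t: "t \<in> C" "dist s t < \<kappa> t" using C(3) s by (auto simp: dist_commute)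
    then have t0: "t \<in> {0..T}" using C by auto
    have *: "\<bar>(\<integral>m. \<phi> m \<partial>x s) - (\<integral>m. \<phi> m \<partial>x t)\<bar> < \<delta> t" if "\<phi> \<in> \<Phi> t" for \<phi>
      using cont[OF t0 s t(2) that] .
    have "r (x t) \<sigma> < e / 2"
    proof (rule near[OF t0 \<sigma>])
      fix \<phi> assume \<phi>: "\<phi> \<in> \<Phi> t"
      have "\<bar>(\<integral>m. \<phi> m \<partial>\<sigma>) - (\<integral>m. \<phi> m \<partial>x s)\<bar> < \<delta> t" using close[of \<phi>] \<phi> t(1) d(2)[OF t(1)] by fastforce
      then show "\<bar>(\<integral>m. \<phi> m \<partial>\<sigma>) - (\<integral>m. \<phi> m \<partial>x t)\<bar> < 2 * \<delta> t" using *[OF \<phi>] by arith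
    qed
    moreover have "r (x t) (x s) < e / 2"
    proof (rule near[OF t0 x_in[OF s]])
      fix \<phi> assume "\<phi> \<in> \<Phi> t"
      then show "\<bar>(\<integral>m. \<phi> m \<partial>x s) - (\<integral>m. \<phi> m \<partial>x t)\<bar> < 2 * \<delta> t" using *[of \<phi>] \<Phi>(3)[OF t0] by linarith
    qed
    ultimately show "r (x s) \<sigma> < e"
      using triangle[OF x_in[OF s] x_in[OF t0] \<sigma>] commute[of "x s" "x t"] by linarith
  qed
qed

section \<open>Measures with finitely many atoms\<close>

definition atoms :: "'a::euclidean_space set \<Rightarrow> nat \<Rightarrow> (nat \<Rightarrow> real) \<Rightarrow> (nat \<Rightarrow> 'a) \<Rightarrow> 'a measure" where
  "atoms M p c x = distr (point_measure {..<p} (\<lambda>i. ennreal (c i))) (borel_on M) x"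

lemma sets_atoms: "sets (atoms M p c x) = sets (borel_on M)"
  by (simp add: atoms_def)

context
  fixes M :: "'a::euclidean_space set" and p :: nat and c :: "nat \<Rightarrow> real" and x :: "nat \<Rightarrow> 'a"
  assumes x: "\<And>i. i < p \<Longrightarrow> x i \<in> M" and c: "\<And>i. i < p \<Longrightarrow> 0 \<le> c i"
begin

lemma measurable_atoms: "x \<in> point_measure {..<p} (\<lambda>i. ennreal (c i)) \<rightarrow>\<^sub>M borel_on M"
  using x by (auto simp: measurable_def space_point_measure sets_point_measure space_restrict_space)

lemma emeasure_atoms:
  assumes A: "A \<in> sets (borel_on M)"
  shows "emeasure (atoms M p c x) A = ennreal (\<Sum>i<p. c i * indicator A (x i))"
proof -
  have "emeasure (atoms M p c x) A = (\<Sum>i\<in>{..<p} \<inter> x -` A. ennreal (c i))"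
    unfolding atoms_def using measurable_atoms A
    by (subst emeasure_distr) (auto simp: space_point_measure emeasure_point_measure_finite Int_commute)
  also have "\<dots> = (\<Sum>i<p. ennreal (c i * indicator A (x i)))"
    by (intro sum.mono_neutral_cong_left) (auto simp: indicator_def)
  also have "\<dots> = ennreal (\<Sum>i<p. c i * indicator A (x i))"
    using c by (intro sum_ennreal) auto
  finally show ?thesis .
qed

lemma integral_atoms:
  fixes \<phi> :: "'a \<Rightarrow> real"
  assumes "\<phi> \<in> borel_measurable (borel_on M)"
  shows "(\<integral>m. \<phi> m \<partial>atoms M p c x) = (\<Sum>i<p. c i * \<phi> (x i))"
  unfolding atoms_def integral_distr[OF measurable_atoms assms]
  using c by (subst lebesgue_integral_point_measure_finite) auto

lemma atoms_prob:
  assumes "(\<Sum>i<p. c i) = 1"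
  shows "atoms M p c x \<in> prob_measures M"
proof (rule prob_measuresI[OF prob_spaceI sets_atoms])
  have sp: "space (atoms M p c x) = M" by (simp add: atoms_def space_restrict_space)
  have "M \<in> sets (borel_on M)" using sets.top[of "borel_on M"] by (simp add: space_restrict_space)
  then have "emeasure (atoms M p c x) M = ennreal (\<Sum>i<p. c i * indicator M (x i))" by (rule emeasure_atoms)
  also have "(\<Sum>i<p. c i * indicator M (x i)) = (\<Sum>i<p. c i)" using x by (intro sum.cong) auto
  finally show "emeasure (atoms M p c x) (space (atoms M p c x)) = 1" using assms sp by simp
qed

end

lemma Cb_borel: "\<phi> \<in> Cb M \<Longrightarrow> \<phi> \<in> borel_measurable (borel_on M)"
  by (simp add: Cb_def borel_measurable_continuous_on_restrict)

lemma compact_partition: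
  fixes M :: "'a::euclidean_space set"
  assumes M: "compact M" and e: "e > 0"
  obtains p :: nat and x A where "\<And>i. i < p \<Longrightarrow> x i \<in> M" "\<And>i. A i \<in> sets (borel_on M)" "disjoint_family A"
    "(\<Union>i<p. A i) = M" "\<And>i m. i < p \<Longrightarrow> m \<in> A i \<Longrightarrow> dist (x i) m < e"
proof -
  have "M \<subseteq> (\<Union>c\<in>M. ball c e)" using e by force
  then obtain C where C: "C \<subseteq> M" "finite C" "M \<subseteq> (\<Union>c\<in>C. ball c e)"
    using compactE_image[OF M, of M "\<lambda>c. ball c e"] by (metis open_ball)
  obtain x where x: "bij_betw x {..<card C} C" using ex_bij_betw_nat_finite[OF C(2)] by (auto simp: atLeast0LessThan)
  define B where "B i = (if i < card C then M \<inter> ball (x i) e else {})" for i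
  have B: "B i \<in> sets (borel_on M)" for i
    unfolding B_def by (auto simp: sets_restrict_space)
  have "(\<Union>i<card C. disjointed B i) = M"
  proof -
    have "disjointed B i = {}" if "\<not> i < card C" for i using that disjointed_subset[of B i] by (auto simp: B_def)
    then have "(\<Union>i<card C. disjointed B i) = (\<Union>i. disjointed B i)" by blast
    also have "\<dots> = (\<Union>i. B i)" by (rule UN_disjointed_eq)
    also have "\<dots> = (\<Union>i<card C. M \<inter> ball (x i) e)" by (auto simp: B_def split: if_splits)
    also have "\<dots> = M \<inter> (\<Union>c\<in>x ` {..<card C}. ball c e)" by blast
    also have "\<dots> = M" using C(3) bij_betw_imp_surj_on[OF x] by auto
    finally show ?thesis .
  qed
  moreover have "x i \<in> M" if "i < card C" for i using x that C(1) by (auto simp: bij_betw_def)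
  moreover have "disjointed B i \<in> sets (borel_on M)" for i
    using sets.range_disjointed_sets[of B "borel_on M"] B by auto
  moreover have "dist (x i) m < e" if "i < card C" "m \<in> disjointed B i" for i m
    using that disjointed_subset[of B i] by (auto simp: B_def)
  ultimately show thesis using disjoint_family_disjointed[of B] by (intro that[of "card C" x "disjointed B"])
qed

text \<open>
  Concentrating the mass of each cell of a fine partition in one point approximates a measure weakly,
  and the approximation depends on the measure through finitely many real numbers only.
\<close>

lemma finite_dimensional_approximation:
  fixes M :: "'a::euclidean_space set"
  assumes M: "compact M"
  obtains coord :: "nat \<Rightarrow> 'a measure \<Rightarrow> nat \<Rightarrow> real" and C decode where
    "\<And>j \<nu>. \<nu> \<in> prob_measures M \<Longrightarrow> coord j \<nu> \<in> C j"
    "\<And>j. continuous_map (top_of_set (C j)) (weak_topology M) (decode j)"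
    "\<And>\<nu>. \<nu> \<in> prob_measures M \<Longrightarrow> limitin (weak_topology M) (\<lambda>j. decode j (coord j \<nu>)) \<nu> sequentially"
    "\<And>j i. (\<lambda>\<nu>. coord j \<nu> i) \<in> borel_measurable (prob_algebra (borel_on M))"
proof -
  define P where "P j p x A \<longleftrightarrow> (\<forall>i<p. x i \<in> M) \<and> (\<forall>i. A i \<in> sets (borel_on M)) \<and> disjoint_family A \<and>
    (\<Union>i<p. A i) = M \<and> (\<forall>i m. i < p \<longrightarrow> m \<in> A i \<longrightarrow> dist (x i) m < 1 / real (Suc j))"
    for j p :: nat and x and A :: "nat \<Rightarrow> 'a set"
  have "\<exists>p x A. P j p x A" for j
  proof -
    have "1 / real (Suc j) > 0" by simp
    then show ?thesis
    proof (rule compact_partition[OF M])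
      fix p :: nat and x A
      assume "\<And>i. i < p \<Longrightarrow> x i \<in> M" "\<And>i. A i \<in> sets (borel_on M)" "disjoint_family A" "(\<Union>i<p. A i) = M"
        "\<And>i m. i < p \<Longrightarrow> m \<in> A i \<Longrightarrow> dist (x i) m < 1 / real (Suc j)"
      then show ?thesis unfolding P_def
        by (intro exI[of _ p] exI[of _ x] exI[of _ A]) (simp del: of_nat_Suc)
    qed
  qed
  then obtain p x A where "\<And>j. P j (p j) (x j) (A j)" by metis
  then have x: "i < p j \<Longrightarrow> x j i \<in> M" and A: "A j i \<in> sets (borel_on M)"
    "disjoint_family (A j)" "(\<Union>i<p j. A j i) = M"
    "i < p j \<Longrightarrow> m \<in> A j i \<Longrightarrow> dist (x j i) m < 1 / real (Suc j)" for j i m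
    unfolding P_def by blast+
  have AM: "A j i \<inter> M = A j i" for j i
    using sets.sets_into_space[OF A(1)[of j i]] by (auto simp: space_restrict_space)
  define coord where "coord j \<nu> i = measure \<nu> (A j i)" for j i and \<nu> :: "'a measure"
  define C where "C j = {c :: nat \<Rightarrow> real. (\<forall>i. 0 \<le> c i) \<and> (\<Sum>i<p j. c i) = 1}" for j
  define decode where "decode j c = atoms M (p j) c (x j)" for j c
  have decode_S: "decode j c \<in> prob_measures M" if "c \<in> C j" for j c
    unfolding decode_def using that x by (intro atoms_prob) (auto simp: C_def)
  have decode_int: "(\<integral>m. \<phi> m \<partial>decode j c) = (\<Sum>i<p j. c i * \<phi> (x j i))" if "c \<in> C j" "\<phi> \<in> Cb M" for j c \<phi>
    unfolding decode_def using that x by (intro integral_atoms) (auto simp: C_def Cb_borel)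
  show thesis
  proof (rule that[of coord C decode])
    show coord_in: "coord j \<nu> \<in> C j" if \<nu>: "\<nu> \<in> prob_measures M" for j \<nu>
    proof -
      interpret prob_space \<nu> using prob_measuresD(1)[OF \<nu>] .
      have "(\<Sum>i<p j. measure \<nu> (A j i)) = measure \<nu> (\<Union>i<p j. A j i)"
        using A(1,2) prob_measuresD(2)[OF \<nu>]
        by (intro finite_measure_finite_Union[symmetric]) (auto simp: disjoint_family_on_def)
      also have "\<dots> = 1" using A(3) prob_space prob_measuresD(3)[OF \<nu>] by simp
      finally show ?thesis by (simp add: C_def coord_def)
    qed
    show "continuous_map (top_of_set (C j)) (weak_topology M) (decode j)" for j
      unfolding weak_topology_def continuous_on_generated_topo_iff
    proof (intro conjI allI impI)
      fix U assume "U \<in> {{\<nu> \<in> prob_measures M. (\<integral>m. \<phi> m \<partial>\<nu>) \<in> V} | \<phi> V. \<phi> \<in> Cb M \<and> open V}"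
      then obtain \<phi> V where U: "U = {\<nu> \<in> prob_measures M. (\<integral>m. \<phi> m \<partial>\<nu>) \<in> V}" "\<phi> \<in> Cb M" "open V" by blast
      have "decode j -` U \<inter> topspace (top_of_set (C j)) = C j \<inter> (\<lambda>c. \<Sum>i<p j. c i * \<phi> (x j i)) -` V"
        using decode_S decode_int U by auto
      moreover have "continuous_on (C j) (\<lambda>c. \<Sum>i<p j. c i * \<phi> (x j i))"
        by (intro continuous_intros continuous_on_product_coordinates[THEN continuous_on_subset]) auto
      ultimately show "openin (top_of_set (C j)) (decode j -` U \<inter> topspace (top_of_set (C j)))"
        using continuous_openin_preimage_gen[OF _ U(3), of "C j"] by simp
    next
      have "decode j ` C j \<subseteq> topspace (weak_topology M)" using decode_S by (auto simp: topspace_weak_topology)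
      then show "decode j ` topspace (top_of_set (C j))
        \<subseteq> \<Union>{{\<nu> \<in> prob_measures M. (\<integral>m. \<phi> m \<partial>\<nu>) \<in> V} | \<phi> V. \<phi> \<in> Cb M \<and> open V}"
        by (simp add: weak_topology_def topology_generated_by_topspace)
    qed
    show "limitin (weak_topology M) (\<lambda>j. decode j (coord j \<nu>)) \<nu> sequentially" if \<nu>: "\<nu> \<in> prob_measures M" for \<nu>
      unfolding limitin_weak_topology
    proof (intro conjI ballI \<nu>)
      show "\<forall>\<^sub>F j in sequentially. decode j (coord j \<nu>) \<in> prob_measures M"
        using decode_S coord_in[OF \<nu>] by auto
      fix \<phi> assume \<phi>: "\<phi> \<in> Cb M"
      interpret prob_space \<nu> using prob_measuresD(1)[OF \<nu>] .
      note [simp] = prob_measuresD(2,3)[OF \<nu>]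
      show "(\<lambda>j. \<integral>m. \<phi> m \<partial>decode j (coord j \<nu>)) \<longlonglongrightarrow> (\<integral>m. \<phi> m \<partial>\<nu>)"
      proof (rule LIMSEQ_I)
        fix e :: real assume e: "e > 0"
        have "uniformly_continuous_on M \<phi>" using \<phi> M by (intro compact_uniformly_continuous) (auto simp: Cb_def)
        then obtain d where d: "d > 0" "\<And>a b. a \<in> M \<Longrightarrow> b \<in> M \<Longrightarrow> dist a b < d \<Longrightarrow> dist (\<phi> a) (\<phi> b) < e / 2"
          unfolding uniformly_continuous_on_def using half_gt_zero[OF e] by (metis dist_commute)
        obtain j0 where j0: "1 / real (Suc j0) < d" using d(1) nat_approx_posE by blast
        have "norm ((\<integral>m. \<phi> m \<partial>decode j (coord j \<nu>)) - (\<integral>m. \<phi> m \<partial>\<nu>)) < e" if j: "j \<ge> j0" for j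
        proof -
          have "1 / real (Suc j) \<le> 1 / real (Suc j0)" using j by (simp add: field_simps)
          then have mesh: "1 / real (Suc j) < d" using j0 by linarith
          define q where "q m = (\<Sum>i<p j. indicator (A j i) m * \<phi> (x j i))" for m
          have int_ind: "integrable \<nu> (\<lambda>m. indicator (A j i) m * \<phi> (x j i))" for i
            using A(1)[of j i] by (intro integrable_mult_left integrable_real_indicator) (auto simp: emeasure_eq_measure)
          then have q_int: "integrable \<nu> q" unfolding q_def by (intro Bochner_Integration.integrable_sum)
          have "(\<integral>m. \<phi> m \<partial>decode j (coord j \<nu>)) = (\<integral>m. q m \<partial>\<nu>)"
            unfolding decode_int[OF coord_in[OF \<nu>] \<phi>] q_def
            using int_ind A(1) by (subst Bochner_Integration.integral_sum) (auto simp: coord_def AM)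
          then have "norm ((\<integral>m. \<phi> m \<partial>decode j (coord j \<nu>)) - (\<integral>m. \<phi> m \<partial>\<nu>)) = norm (\<integral>m. q m - \<phi> m \<partial>\<nu>)"
            using q_int Cb_integrable[OF \<phi> \<nu>] by simp
          also have "\<dots> \<le> (\<integral>m. norm (q m - \<phi> m) \<partial>\<nu>)" by (rule integral_norm_bound)
          also have "\<dots> \<le> (\<integral>m. e / 2 \<partial>\<nu>)"
          proof (rule integral_mono)
            show "integrable \<nu> (\<lambda>m. norm (q m - \<phi> m))" using q_int Cb_integrable[OF \<phi> \<nu>] by simp
            show "integrable \<nu> (\<lambda>m. e / 2)" by simp
            fix m assume "m \<in> space \<nu>"
            then have m: "m \<in> M" by simp
            then obtain i where i: "i < p j" "m \<in> A j i" using A(3)[of j] by blast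
            have "q m = (\<Sum>i'\<in>{i}. indicator (A j i') m * \<phi> (x j i'))"
              unfolding q_def using i A(2)[of j]
              by (intro sum.mono_neutral_right) (auto simp: indicator_def disjoint_family_on_def)
            then have "q m = \<phi> (x j i)" using i by simp
            moreover have "dist (x j i) m < d" using A(4)[OF i] mesh by linarith
            ultimately show "norm (q m - \<phi> m) \<le> e / 2"
              using d(2)[OF x[OF i(1)] m] by (simp add: dist_norm)
          qed
          also have "\<dots> < e" using e prob_space by simp
          finally show ?thesis .
        qed
        then show "\<exists>j0. \<forall>j\<ge>j0. norm ((\<integral>m. \<phi> m \<partial>decode j (coord j \<nu>)) - (\<integral>m. \<phi> m \<partial>\<nu>)) < e" by blast
      qed
    qed
    show "(\<lambda>\<nu>. coord j \<nu> i) \<in> borel_measurable (prob_algebra (borel_on M))" for j i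
      unfolding coord_def prob_algebra_def measure_def
      by (intro measurable_restrict_space1 borel_measurable_enn2real measurable_emeasure_subprob_algebra A(1))
  qed
qed

section \<open>Two facts on ordinary differential equations\<close>

lemma FTC_atLeast:
  fixes f :: "real \<Rightarrow> 'b::euclidean_space"
  assumes f: "continuous_on {0..} f" and t: "t \<ge> 0"
  shows "((\<lambda>t. integral {0..t} f) has_vector_derivative f t) (at t within {0..})"
proof -
  have "((\<lambda>t. integral {0..t} f) has_vector_derivative f t) (at t within {0..t + 1})"
    using t by (intro integral_has_vector_derivative continuous_on_subset[OF f]) auto
  moreover have "at t within {0..t + 1} = at t within {0..}"
    by (rule at_within_nhd[of _ "{..<t + 1}"]) auto
  ultimately show ?thesis by simp
qed

lemma has_vector_derivative_atLeast_continuous: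
  assumes "\<And>t. t \<ge> 0 \<Longrightarrow> (x has_vector_derivative x' t) (at t within {0..})"
  shows "continuous_on {0..} x"
  using assms has_vector_derivative_continuous unfolding continuous_on_eq_continuous_within by (metis atLeast_iff)

lemma FTC_difference_atLeast:
  fixes x :: "real \<Rightarrow> 'b::euclidean_space"
  assumes "\<And>t. t \<ge> 0 \<Longrightarrow> (x has_vector_derivative x' t) (at t within {0..})" and "t \<ge> 0"
  shows "(x' has_integral (x t - x 0)) {0..t}"
proof (rule fundamental_theorem_of_calculus[OF assms(2)])
  fix s assume "s \<in> {0..t}"
  then show "(x has_vector_derivative x' s) (at s within {0..t})"
    by (intro has_vector_derivative_within_subset[OF assms(1)]) auto
qed

text \<open>
  Integration keeps exponential growth of rate \<open>l\<close> and gains a factor \<open>1/l\<close>, the source of the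
  contraction in Picard's iteration.
\<close>

lemma norm_integral_exp_bound:
  fixes f :: "real \<Rightarrow> 'b::euclidean_space"
  assumes f: "continuous_on {0..} f" and bound: "\<And>s. s \<ge> 0 \<Longrightarrow> norm (f s) \<le> c * exp (l * s)"
    and l: "l > 0" and t: "t \<ge> 0"
  shows "norm (integral {0..t} f) \<le> c / l * exp (l * t)"
proof -
  have hi: "((\<lambda>s. c * exp (l * s)) has_integral (c / l * exp (l * t) - c / l * exp (l * 0))) {0..t}"
    using l by (intro fundamental_theorem_of_calculus t)
      (auto intro!: derivative_eq_intros simp: has_real_derivative_iff_has_vector_derivative[symmetric])
  have "f integrable_on {0..t}"
    by (intro integrable_continuous_interval continuous_on_subset[OF f]) auto
  then have "norm (integral {0..t} f) \<le> integral {0..t} (\<lambda>s. c * exp (l * s))"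
    using bound has_integral_integrable[OF hi] by (intro integral_norm_bound_integral) auto
  then have "norm (integral {0..t} f) \<le> c / l * exp (l * t) - c / l"
    unfolding integral_unique[OF hi] by simp
  moreover have "0 \<le> c" using bound[of 0] norm_ge_zero[of "f 0"] by (simp del: norm_ge_zero)
  ultimately show ?thesis using l by (smt (verit) divide_nonneg_pos)
qed

text \<open>
  Picard's operator on the functions of at most exponential growth, rescaled to bounded functions,
  is a contraction once the rate \<open>l\<close> exceeds the Lipschitz constant.
\<close>

lemma picard_lindelof_global:
  fixes g :: "'b::euclidean_space \<Rightarrow> 'b"
  assumes lip: "\<And>x y. norm (g x - g y) \<le> L * norm (x - y)"
  obtains x where "x 0 = x0" "\<And>t. t \<ge> 0 \<Longrightarrow> (x has_vector_derivative g (x t)) (at t within {0..})"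
proof -
  define \<Lambda> where "\<Lambda> = max L 1"
  define l where "l = 2 * \<Lambda>"
  have l: "\<Lambda> > 0" "l > 0" by (auto simp: \<Lambda>_def l_def)
  have lip': "norm (g x - g y) \<le> \<Lambda> * norm (x - y)" for x y
    using lip[of x y] mult_right_mono[of L \<Lambda> "norm (x - y)"] by (simp add: \<Lambda>_def)
  have "\<Lambda>-lipschitz_on UNIV g" by (rule lipschitz_onI) (use lip' l in \<open>auto simp: dist_norm\<close>)
  then have g_cont: "continuous_on UNIV g" by (rule lipschitz_on_continuous_on)
  define v where "v u s = g (exp (l * s) *\<^sub>R apply_bcontfun u s)" for u s
  define P where "P u t = exp (- (l * max 0 t)) *\<^sub>R (x0 + integral {0..max 0 t} (v u))" for u t
  have v_cont: "continuous_on {0..} (v u)" for u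
    unfolding v_def by (intro continuous_on_compose2[OF g_cont] continuous_intros) auto
  have P_bcont: "P u \<in> bcontfun" for u
  proof (rule bcontfun_normI)
    have "continuous_on {0..} (\<lambda>t. integral {0..t} (v u))"
      using FTC_atLeast[OF v_cont[of u]] by (rule has_vector_derivative_atLeast_continuous)
    then have "continuous_on UNIV (\<lambda>t. integral {0..max 0 t} (v u))"
      by (rule continuous_on_compose2[where f = "\<lambda>t. max 0 t"]) (auto intro!: continuous_intros simp: le_max_iff_disj)
    then show "continuous_on UNIV (P u)"
      unfolding P_def by (intro continuous_intros)
    fix t :: real
    define s where "s = max 0 t"
    have s: "s \<ge> 0" by (simp add: s_def)
    define c where "c = norm (g 0) + \<Lambda> * norm u"
    have "norm (integral {0..s} (v u)) \<le> c / l * exp (l * s)"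
    proof (rule norm_integral_exp_bound[OF v_cont _ l(2) s])
      fix s :: real assume s: "s \<ge> 0"
      have "norm (v u s) \<le> norm (g 0) + norm (g (exp (l * s) *\<^sub>R apply_bcontfun u s) - g 0)"
        unfolding v_def by (metis norm_triangle_sub)
      also have "\<dots> \<le> norm (g 0) + \<Lambda> * (exp (l * s) * norm (apply_bcontfun u s))"
        using lip'[of "exp (l * s) *\<^sub>R apply_bcontfun u s" 0] by simp
      also have "\<dots> \<le> norm (g 0) * exp (l * s) + \<Lambda> * (exp (l * s) * norm u)"
        using s l norm_bounded[of u s] mult_left_mono[of 1 "exp (l * s)" "norm (g 0)"]
        by (intro add_mono mult_left_mono) auto
      finally show "norm (v u s) \<le> c * exp (l * s)" by (simp add: c_def algebra_simps)
    qed
    then have "norm (x0 + integral {0..s} (v u)) \<le> norm x0 + c / l * exp (l * s)"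
      by (rule order_trans[OF norm_triangle_ineq add_left_mono])
    also have "\<dots> \<le> norm x0 * exp (l * s) + c / l * exp (l * s)"
      using s l mult_left_mono[of 1 "exp (l * s)" "norm x0"] by simp
    finally have "exp (- (l * s)) * norm (x0 + integral {0..s} (v u))
        \<le> exp (- (l * s)) * (norm x0 * exp (l * s) + c / l * exp (l * s))"
      by (intro mult_left_mono) auto
    also have "\<dots> = norm x0 + c / l" by (simp add: exp_minus field_simps)
    finally show "norm (P u t) \<le> norm x0 + (norm (g 0) + \<Lambda> * norm u) / l"
      by (simp add: P_def s_def[symmetric] c_def)
  qed
  define \<P> where "\<P> u = Bcontfun (P u)" for u
  have \<P>: "apply_bcontfun (\<P> u) t = P u t" for u t
    unfolding \<P>_def by (simp add: Bcontfun_inverse[OF P_bcont])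
  have "dist (\<P> u) (\<P> w) \<le> (1/2) * dist u w" for u w
  proof (rule dist_bound)
    fix t :: real
    define s where "s = max 0 t"
    have s: "s \<ge> 0" by (simp add: s_def)
    have int: "v u integrable_on {0..s}" for u
      by (intro integrable_continuous_interval continuous_on_subset[OF v_cont]) auto
    have "norm (integral {0..s} (\<lambda>r. v u r - v w r)) \<le> (\<Lambda> * dist u w) / l * exp (l * s)"
    proof (rule norm_integral_exp_bound[OF _ _ l(2) s])
      show "continuous_on {0..} (\<lambda>r. v u r - v w r)" by (intro continuous_intros v_cont)
      fix r :: real
      have "norm (v u r - v w r) \<le> \<Lambda> * norm (exp (l * r) *\<^sub>R (apply_bcontfun u r - apply_bcontfun w r))"
        unfolding v_def using lip' by (metis scaleR_diff_right)
      also have "\<dots> \<le> \<Lambda> * (exp (l * r) * dist u w)"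
        using l dist_bounded[of u r w] by (intro mult_left_mono) (auto simp: dist_norm)
      finally show "norm (v u r - v w r) \<le> \<Lambda> * dist u w * exp (l * r)" by (simp add: algebra_simps)
    qed
    from mult_left_mono[OF this, of "exp (- (l * s))"]
    have "exp (- (l * s)) * norm (integral {0..s} (\<lambda>r. v u r - v w r))
      \<le> exp (- (l * s)) * ((\<Lambda> * dist u w) / l * exp (l * s))" by simp
    moreover have "\<P> u t - \<P> w t = exp (- (l * s)) *\<^sub>R integral {0..s} (\<lambda>r. v u r - v w r)"
      using int by (simp add: \<P> P_def s_def[symmetric] scaleR_diff_right[symmetric] Henstock_Kurzweil_Integration.integral_diff)
    ultimately have "norm (\<P> u t - \<P> w t) \<le> exp (- (l * s)) * ((\<Lambda> * dist u w) / l * exp (l * s))"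
      by (simp only: norm_scaleR abs_exp_cancel)
    also have "\<dots> = (1/2) * dist u w" using l by (simp add: l_def exp_minus field_simps)
    finally show "dist (\<P> u t) (\<P> w t) \<le> (1/2) * dist u w" by (simp add: dist_norm)
  qed
  then obtain u where u: "\<P> u = u" using banach_fix_type[of "1/2" \<P>] by auto
  define x where "x t = exp (l * t) *\<^sub>R apply_bcontfun u t" for t
  have x: "x t = x0 + integral {0..t} (v u)" if "t \<ge> 0" for t
  proof -
    have "apply_bcontfun u t = exp (- (l * t)) *\<^sub>R (x0 + integral {0..t} (v u))"
      using \<P>[of u t] u that by (simp add: P_def)
    then show ?thesis by (simp add: x_def exp_minus)
  qed
  show thesis
  proof (rule that[of x])
    show "x 0 = x0" using x[of 0] by simp
    fix t :: real assume t: "t \<ge> 0"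
    have "((\<lambda>t. x0 + integral {0..t} (v u)) has_vector_derivative 0 + v u t) (at t within {0..})"
      by (intro has_vector_derivative_add has_vector_derivative_const FTC_atLeast v_cont t)
    then have "((\<lambda>t. x0 + integral {0..t} (v u)) has_vector_derivative g (x t)) (at t within {0..})"
      by (simp add: v_def x_def)
    then show "(x has_vector_derivative g (x t)) (at t within {0..})"
      by (rule has_vector_derivative_transform[rotated 2]) (use t x in auto)
  qed
qed

lemma gronwall_zero:
  fixes w :: "real \<Rightarrow> real"
  assumes w: "continuous_on {0..} w" and nonneg: "\<And>t. t \<ge> 0 \<Longrightarrow> 0 \<le> w t"
    and C: "C \<ge> 0" and ineq: "\<And>t. t \<ge> 0 \<Longrightarrow> w t \<le> C * integral {0..t} w" and t: "t \<ge> 0"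
  shows "w t = 0"
proof -
  define G where "G t = integral {0..t} w" for t
  have G: "(G has_vector_derivative w t) (at t within {0..})" if "t \<ge> 0" for t
    unfolding G_def by (rule FTC_atLeast[OF w that])
  have "exp (- C * t) * G t \<le> exp (- C * 0) * G 0"
  proof (cases "t = 0")
    case False
    show ?thesis
    proof (rule DERIV_nonpos_imp_decreasing_open[of 0 t "\<lambda>t. exp (- C * t) * G t"])
      show "0 \<le> t" by (rule t)
      fix s assume s: "0 < s" "s < t"
      have "at s within {0..} = at s" using s by (intro at_within_interior) simp
      then have "(G has_real_derivative w s) (at s)"
        using G[of s] s by (simp add: has_real_derivative_iff_has_vector_derivative)
      then have "((\<lambda>t. exp (- C * t) * G t) has_real_derivative exp (- C * s) * (w s - C * G s)) (at s)"
        by (auto intro!: derivative_eq_intros simp: algebra_simps)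
      moreover have "exp (- C * s) * (w s - C * G s) \<le> 0"
        using ineq[of s] s by (intro mult_nonneg_nonpos) (auto simp: G_def)
      ultimately show "\<exists>y. ((\<lambda>t. exp (- C * t) * G t) has_real_derivative y) (at s) \<and> y \<le> 0" by blast
    next
      have "continuous_on {0..} G" using G by (rule has_vector_derivative_atLeast_continuous)
      then have "continuous_on {0..t} G" by (rule continuous_on_subset) auto
      then show "continuous_on {0..t} (\<lambda>t. exp (- C * t) * G t)" by (intro continuous_intros)
    qed
  qed simp
  then have "exp (- C * t) * G t \<le> 0" by (simp add: G_def)
  then have "G t \<le> 0" by (simp add: mult_le_0_iff)
  then show ?thesis using ineq[OF t] nonneg[OF t] C mult_nonneg_nonpos[OF C, of "G t"] by (simp add: G_def)
qed

section \<open>The mean-field drift\<close>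

text \<open>
  The interaction law as the dynamics see it: a probability density for every flux, which
  depends on the flux in a Lipschitz way in the \<open>L\<^sup>1\<close> norm. Fluxes of probability measures on \<open>M\<close> stay
  in the unit ball, so that the Lipschitz condition is stated there.
\<close>

locale mean_field =
  fixes M :: "'a::euclidean_space set" and \<mu> :: "'a measure" and K :: "'a \<Rightarrow> 'a \<Rightarrow> real" and \<theta> :: real
  assumes compact_M: "compact M" and norm_M: "\<And>m. m \<in> M \<Longrightarrow> norm m \<le> 1"
    and sets_\<mu>: "sets \<mu> = sets (borel_on M)"
    and K_measurable: "\<And>J. K J \<in> borel_measurable \<mu>"
    and K_nonneg: "\<And>J m. m \<in> M \<Longrightarrow> 0 \<le> K J m"
    and K_integrable: "\<And>J. integrable \<mu> (K J)" and K_integral: "\<And>J. (\<integral>m. K J m \<partial>\<mu>) = 1"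
    and \<theta>_nonneg: "0 \<le> \<theta>"
    and K_lipschitz: "\<And>J J'. norm J \<le> 1 \<Longrightarrow> norm J' \<le> 1 \<Longrightarrow> (\<integral>m. \<bar>K J m - K J' m\<bar> \<partial>\<mu>) \<le> \<theta> * norm (J - J')"
begin

lemma space_\<mu>: "space \<mu> = M"
  using sets_eq_imp_space_eq[OF sets_\<mu>] by (simp add: space_restrict_space)

definition gain :: "('a \<Rightarrow> real) \<Rightarrow> 'a \<Rightarrow> real" where
  "gain \<phi> J = (\<integral>m. \<phi> m * K J m \<partial>\<mu>)"

context
  fixes \<phi> :: "'a \<Rightarrow> real" and B :: real
  assumes \<phi>: "\<phi> \<in> borel_measurable (borel_on M)" and B: "\<And>m. m \<in> M \<Longrightarrow> \<bar>\<phi> m\<bar> \<le> B"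
begin

lemma \<phi>_\<mu>: "\<phi> \<in> borel_measurable \<mu>"
  using \<phi> by (simp add: measurable_cong_sets[OF sets_\<mu> refl])

lemma integrable_times_bounded:
  assumes f: "integrable \<mu> f"
  shows "integrable \<mu> (\<lambda>m. \<phi> m * f m)"
proof (rule Bochner_Integration.integrable_bound[of _ "\<lambda>m. B * f m"])
  show "AE m in \<mu>. norm (\<phi> m * f m) \<le> norm (B * f m)"
  proof (rule AE_I2)
    fix m assume "m \<in> space \<mu>"
    then have "\<bar>\<phi> m\<bar> \<le> \<bar>B\<bar>" using B[of m] by (simp add: space_\<mu>)
    then show "norm (\<phi> m * f m) \<le> norm (B * f m)" by (simp add: abs_mult mult_right_mono)
  qed
qed (use f \<phi>_\<mu> in auto)

lemma gain_integrable: "integrable \<mu> (\<lambda>m. \<phi> m * K J m)"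
  by (rule integrable_times_bounded[OF K_integrable])

lemma gain_lipschitz:
  assumes J: "norm J \<le> 1" "norm J' \<le> 1"
  shows "\<bar>gain \<phi> J - gain \<phi> J'\<bar> \<le> B * \<theta> * norm (J - J')"
proof (cases "M = {}")
  case True
  have "(\<integral>m. K 0 m \<partial>\<mu>) = (\<integral>m. 0 \<partial>\<mu>)"
    by (rule Bochner_Integration.integral_cong) (simp_all add: space_\<mu> True)
  then show ?thesis using K_integral[of 0] by simp
next
  case False
  then have B0: "0 \<le> B" using B by force
  have int: "integrable \<mu> (\<lambda>m. \<bar>K J m - K J' m\<bar>)" using K_integrable by simp
  have "gain \<phi> J - gain \<phi> J' = (\<integral>m. \<phi> m * (K J m - K J' m) \<partial>\<mu>)"
    unfolding gain_def using gain_integrable by (simp add: right_diff_distrib)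
  also have "\<bar>\<dots>\<bar> \<le> (\<integral>m. \<bar>\<phi> m * (K J m - K J' m)\<bar> \<partial>\<mu>)" by (rule integral_abs_bound)
  also have "\<dots> \<le> (\<integral>m. B * \<bar>K J m - K J' m\<bar> \<partial>\<mu>)"
  proof (rule integral_mono)
    show "integrable \<mu> (\<lambda>m. \<bar>\<phi> m * (K J m - K J' m)\<bar>)"
      using integrable_times_bounded K_integrable by (intro integrable_abs) auto
    show "integrable \<mu> (\<lambda>m. B * \<bar>K J m - K J' m\<bar>)" using int by simp
    fix m assume "m \<in> space \<mu>"
    then show "\<bar>\<phi> m * (K J m - K J' m)\<bar> \<le> B * \<bar>K J m - K J' m\<bar>"
      using B[of m] by (simp add: space_\<mu> abs_mult mult_right_mono)
  qed
  also have "\<dots> = B * (\<integral>m. \<bar>K J m - K J' m\<bar> \<partial>\<mu>)" by simp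
  also have "\<dots> \<le> B * (\<theta> * norm (J - J'))" using K_lipschitz[OF J] B0 by (rule mult_left_mono)
  finally show ?thesis by simp
qed

lemma gain_bound: "\<bar>gain \<phi> J\<bar> \<le> B"
proof -
  have "\<bar>gain \<phi> J\<bar> \<le> (\<integral>m. \<bar>\<phi> m * K J m\<bar> \<partial>\<mu>)" unfolding gain_def by (rule integral_abs_bound)
  also have "\<dots> \<le> (\<integral>m. B * K J m \<partial>\<mu>)"
  proof (rule integral_mono)
    show "integrable \<mu> (\<lambda>m. \<bar>\<phi> m * K J m\<bar>)" using gain_integrable by (rule integrable_abs)
    show "integrable \<mu> (\<lambda>m. B * K J m)" using K_integrable by simp
    fix m assume "m \<in> space \<mu>"
    then show "\<bar>\<phi> m * K J m\<bar> \<le> B * K J m"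
      using B[of m] K_nonneg[of m J] by (simp add: space_\<mu> abs_mult mult_right_mono)
  qed
  also have "\<dots> = B" using K_integral by simp
  finally show ?thesis .
qed

end

lemma density_K:
  shows "density \<mu> (K J) \<in> prob_measures M"
    and "\<phi> \<in> borel_measurable (borel_on M) \<Longrightarrow> (\<integral>m. \<phi> m \<partial>density \<mu> (K J)) = gain \<phi> J"
proof -
  have AE: "AE m in \<mu>. 0 \<le> K J m" using K_nonneg by (intro AE_I2) (simp add: space_\<mu>)
  have "(\<integral>\<^sup>+m. ennreal (K J m) \<partial>\<mu>) = ennreal (\<integral>m. K J m \<partial>\<mu>)"
    by (rule nn_integral_eq_integral[OF K_integrable AE])
  then have "emeasure (density \<mu> (K J)) (space (density \<mu> (K J))) = 1"
    using K_measurable by (simp add: emeasure_density K_integral cong: nn_integral_cong)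
  then show "density \<mu> (K J) \<in> prob_measures M"
    by (intro prob_measuresI prob_spaceI) (auto simp: sets_\<mu>)
  assume "\<phi> \<in> borel_measurable (borel_on M)"
  then have "\<phi> \<in> borel_measurable \<mu>" by (simp add: measurable_cong_sets[OF sets_\<mu> refl])
  then show "(\<integral>m. \<phi> m \<partial>density \<mu> (K J)) = gain \<phi> J"
    using AE K_measurable by (subst integral_real_density) (auto simp: gain_def mult.commute)
qed

lemma coordinate_Cb: "(\<lambda>m. m \<bullet> b) \<in> Cb M"
  by (intro compact_Cb compact_M continuous_intros)

lemma coordinate_bound: "b \<in> Basis \<Longrightarrow> m \<in> M \<Longrightarrow> \<bar>m \<bullet> b\<bar> \<le> 1"
  using norm_M[of m] Basis_le_norm[of b m] by linarith

lemma flux_inner: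
  assumes \<nu>: "\<nu> \<in> prob_measures M"
  shows "flux \<nu> \<bullet> b = (\<integral>m. m \<bullet> b \<partial>\<nu>)" and "norm (flux \<nu>) \<le> 1"
proof -
  interpret prob_space \<nu> using prob_measuresD(1)[OF \<nu>] .
  have "(\<lambda>m. m) \<in> borel_measurable (borel_on M)" by (rule measurable_restrict_space1) simp
  then have "(\<lambda>m. m) \<in> borel_measurable \<nu>" by (simp add: measurable_cong_sets[OF prob_measuresD(2)[OF \<nu>] refl])
  then have int: "integrable \<nu> (\<lambda>m. m)"
    using norm_M prob_measuresD(3)[OF \<nu>] by (intro integrable_const_bound[of _ 1]) auto
  then show "flux \<nu> \<bullet> b = (\<integral>m. m \<bullet> b \<partial>\<nu>)" unfolding flux_def by (simp add: integral_inner_left)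
  have "norm (flux \<nu>) \<le> (\<integral>m. norm m \<partial>\<nu>)" unfolding flux_def by (rule integral_norm_bound)
  also have "\<dots> \<le> (\<integral>m. 1 \<partial>\<nu>)"
    using int norm_M prob_measuresD(3)[OF \<nu>] by (intro integral_mono) auto
  finally show "norm (flux \<nu>) \<le> 1" using prob_space by simp
qed

text \<open>
  The weak form of the right-hand side \<open>M\<^sub>\<nu> - \<nu>\<close>: a gain that depends on the flux alone, minus a linear
  loss.
\<close>

lemma Q_BGK_eq:
  assumes \<nu>: "\<nu> \<in> prob_measures M" and \<phi>: "\<phi> \<in> Cb M"
  shows "Q_BGK \<mu> K \<phi> \<nu> = gain \<phi> (flux \<nu>) - (\<integral>m. \<phi> m \<partial>\<nu>)"
proof -
  interpret prob_space \<nu> using prob_measuresD(1)[OF \<nu>] .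
  obtain B where B: "\<And>m. m \<in> M \<Longrightarrow> \<bar>\<phi> m\<bar> \<le> B" using Cb_bounded[OF \<phi>] by metis
  have "(\<integral>m'. (\<phi> m' - \<phi> m) * K (flux \<nu>) m' \<partial>\<mu>) = gain \<phi> (flux \<nu>) - \<phi> m" for m
    using gain_integrable[OF Cb_borel[OF \<phi>] B] K_integrable K_integral by (simp add: gain_def left_diff_distrib)
  then show ?thesis
    unfolding Q_BGK_def using Cb_integrable[OF \<phi> \<nu>] prob_space by simp
qed

text \<open>
  The drift of the test functions in \<open>\<Phi>\<close> depends on the measure only through the integrals of
  these test functions, provided that \<open>\<Phi>\<close> contains the coordinates, which determine the flux.
\<close>

lemma Q_BGK_lipschitz:
  assumes \<nu>: "\<nu> \<in> prob_measures M" "\<nu>' \<in> prob_measures M"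
    and \<Phi>: "finite \<Phi>" "\<Phi> \<subseteq> Cb M" "(\<lambda>b m. m \<bullet> b) ` Basis \<subseteq> \<Phi>"
    and B: "\<And>\<phi> m. \<phi> \<in> \<Phi> \<Longrightarrow> m \<in> M \<Longrightarrow> \<bar>\<phi> m\<bar> \<le> B" and \<phi>: "\<phi> \<in> \<Phi>"
  shows "\<bar>Q_BGK \<mu> K \<phi> \<nu> - Q_BGK \<mu> K \<phi> \<nu>'\<bar>
    \<le> (B * \<theta> * DIM('a) + 1) * (\<Sum>\<phi>\<in>\<Phi>. \<bar>(\<integral>m. \<phi> m \<partial>\<nu>) - (\<integral>m. \<phi> m \<partial>\<nu>')\<bar>)"
proof -
  let ?d = "\<lambda>\<phi>. \<bar>(\<integral>m. \<phi> m \<partial>\<nu>) - (\<integral>m. \<phi> m \<partial>\<nu>')\<bar>"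
  have d_le: "?d \<psi> \<le> sum ?d \<Phi>" if "\<psi> \<in> \<Phi>" for \<psi>
    using \<Phi>(1) that by (intro member_le_sum) auto
  have d0: "0 \<le> sum ?d \<Phi>" by (intro sum_nonneg) auto
  have "norm (flux \<nu> - flux \<nu>') \<le> (\<Sum>b\<in>Basis. \<bar>(flux \<nu> - flux \<nu>') \<bullet> b\<bar>)" by (rule norm_le_l1)
  also have "\<dots> = (\<Sum>b\<in>Basis. ?d (\<lambda>m. m \<bullet> b))"
    by (simp add: inner_diff_left flux_inner(1)[OF \<nu>(1)] flux_inner(1)[OF \<nu>(2)])
  also have "\<dots> \<le> (\<Sum>b\<in>(Basis :: 'a set). sum ?d \<Phi>)"
    using \<Phi>(3) by (intro sum_mono d_le) auto
  also have "\<dots> = DIM('a) * sum ?d \<Phi>" by simp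
  finally have flux: "norm (flux \<nu> - flux \<nu>') \<le> DIM('a) * sum ?d \<Phi>" .
  have \<phi>C: "\<phi> \<in> Cb M" using \<phi> \<Phi>(2) by auto
  have B0: "0 \<le> B"
  proof -
    obtain m where "m \<in> M" using prob_space.not_empty[OF prob_measuresD(1)[OF \<nu>(1)]] prob_measuresD(3)[OF \<nu>(1)] by auto
    then show ?thesis using B[OF \<phi>, of m] by linarith
  qed
  have "\<bar>gain \<phi> (flux \<nu>) - gain \<phi> (flux \<nu>')\<bar> \<le> B * \<theta> * norm (flux \<nu> - flux \<nu>')"
    by (rule gain_lipschitz[OF Cb_borel[OF \<phi>C] B[OF \<phi>] flux_inner(2)[OF \<nu>(1)] flux_inner(2)[OF \<nu>(2)]])
  also have "\<dots> \<le> B * \<theta> * (DIM('a) * sum ?d \<Phi>)"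
    using flux B0 \<theta>_nonneg by (intro mult_left_mono) auto
  finally show ?thesis
    unfolding Q_BGK_eq[OF \<nu>(1) \<phi>C] Q_BGK_eq[OF \<nu>(2) \<phi>C] using d_le[OF \<phi>] by (simp add: algebra_simps)
qed

end

section \<open>Existence and uniqueness of the solution\<close>

context mean_field begin

text \<open>
  At an independent exponential time before \<open>t\<close> a particle was last redrawn; \<open>h s\<close> is the mean of a test
  function under the law used for redrawing at time \<open>s\<close>, and the value \<open>c\<close> for \<open>s < 0\<close> stands for a particle
  that still has its initial law. Since \<open>h - c\<close> vanishes at negative times, subtracting \<open>c\<close> leaves an
  integral over \<open>[0, t]\<close>.
\<close>

lemma renewal_representation:
  fixes h :: "real \<Rightarrow> real"
  assumes \<Phi>: "continuous_on {0..} \<Phi>" and h: "h \<in> borel_measurable borel" "\<And>s. \<bar>h s\<bar> \<le> B"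
    and h_eq: "\<And>s. s < 0 \<Longrightarrow> h s = c" "\<And>s. s \<ge> 0 \<Longrightarrow> h s = \<Phi> s" and t: "t \<ge> 0"
  shows "(\<integral>s. h (t - s) \<partial>density lborel (\<lambda>s. ennreal (exponential_density 1 s)))
    = c + exp (- t) * integral {0..t} (\<lambda>s. exp s * (\<Phi> s - c))"
proof -
  let ?E = "density lborel (\<lambda>s. ennreal (exponential_density 1 s))"
  interpret E: prob_space ?E by (rule prob_space_exponential_density) simp
  have "integrable ?E (\<lambda>s. h (t - s))"
    using h by (intro E.integrable_const_bound[of _ B]) auto
  then have "(\<integral>s. h (t - s) \<partial>?E) = c + (\<integral>s. h (t - s) - c \<partial>?E)" using E.prob_space by simp
  also have "(\<integral>s. h (t - s) - c \<partial>?E) = (\<integral>s. exponential_density 1 s * (h (t - s) - c) \<partial>lborel)"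
    using h(1) by (subst integral_real_density) (auto simp: exponential_density_def)
  also have "\<dots> = (\<integral>s. exponential_density 1 (t - s) * (h s - c) \<partial>lborel)"
    by (subst lborel_integral_real_affine[where c = "-1" and t = t]) auto
  also have "\<dots> = (LINT s:{0..t}|lborel. exp (- t) * (exp s * (\<Phi> s - c)))"
    unfolding set_lebesgue_integral_def
    by (intro Bochner_Integration.integral_cong)
      (auto simp: exponential_density_def h_eq indicator_def not_le exp_diff exp_minus field_simps)
  also have "\<dots> = integral {0..t} (\<lambda>s. exp (- t) * (exp s * (\<Phi> s - c)))"
    by (intro set_borel_integral_eq_integral borel_integrable_atLeastAtMost' continuous_intros
        continuous_on_subset[OF \<Phi>]) auto
  finally show ?thesis by simp
qed

text \<open>
  The flux solves a closed ordinary differential equation. Given its solution \<open>J\<close>, the equation for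
  \<open>\<nu>\<close> is linear with a source, and a particle with law \<open>\<nu> t\<close> is redrawn at rate one from the density
  prescribed by \<open>J\<close>. Hence \<open>\<nu> t\<close> is a mixture over the exponential time since the last redrawing. That
  the flux of this mixture is \<open>J\<close> again follows from uniqueness for a linear equation.
\<close>

lemma solution_exists:
  assumes \<nu>\<^sub>0: "\<nu>\<^sub>0 \<in> prob_measures M"
  obtains \<nu> where "\<nu> 0 = \<nu>\<^sub>0" "\<And>t. \<nu> t \<in> prob_measures M"
    "\<And>\<phi> t. \<phi> \<in> Cb M \<Longrightarrow> t \<ge> 0 \<Longrightarrow>
       ((\<lambda>t. \<integral>m. \<phi> m \<partial>\<nu> t) has_vector_derivative Q_BGK \<mu> K \<phi> (\<nu> t)) (at t within {0..})"
proof -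
  have M_ne: "M \<noteq> {}"
    using prob_space.not_empty[OF prob_measuresD(1)[OF \<nu>\<^sub>0]] prob_measuresD(3)[OF \<nu>\<^sub>0] by auto
  \<comment> \<open>Projecting on the unit ball makes the vector field globally Lipschitz; the solution never leaves the ball.\<close>
  define P where "P = closest_point (cball (0::'a) 1)"
  have P_ball: "norm (P J) \<le> 1" for J
    using closest_point_in_set[of "cball 0 1" J] by (simp add: P_def)
  have P_lip: "norm (P J - P J') \<le> norm (J - J')" for J J'
    using closest_point_lipschitz[of "cball (0::'a) 1" J J'] by (simp add: P_def dist_norm)
  have P_self: "P J = J" if "norm J \<le> 1" for J
    unfolding P_def using that by (intro closest_point_self) simp
  have gain_P_lip: "\<bar>gain \<phi> (P J) - gain \<phi> (P J')\<bar> \<le> B * \<theta> * norm (J - J')"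
    if "\<phi> \<in> borel_measurable (borel_on M)" "\<And>m. m \<in> M \<Longrightarrow> \<bar>\<phi> m\<bar> \<le> B" for \<phi> B J J'
  proof -
    have "0 \<le> B" using that(2) M_ne by force
    then have "B * \<theta> * norm (P J - P J') \<le> B * \<theta> * norm (J - J')"
      using P_lip \<theta>_nonneg by (intro mult_left_mono) auto
    then show ?thesis using gain_lipschitz[OF that P_ball P_ball, of J J'] by linarith
  qed
  \<comment> \<open>The vector field of the flux, in coordinates.\<close>
  define G where "G J = (\<Sum>b\<in>Basis. gain (\<lambda>m. m \<bullet> b) (P J) *\<^sub>R b) - J" for J
  have G_inner: "G J \<bullet> b = gain (\<lambda>m. m \<bullet> b) (P J) - J \<bullet> b" if "b \<in> Basis" for b J
    using that by (simp add: G_def inner_diff_left)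
  have "norm (G J - G J') \<le> (DIM('a) * (\<theta> + 1)) * norm (J - J')" for J J'
  proof -
    have "norm (G J - G J') \<le> (\<Sum>b\<in>Basis. \<bar>(G J - G J') \<bullet> b\<bar>)" by (rule norm_le_l1)
    also have "\<dots> \<le> (\<Sum>b\<in>(Basis :: 'a set). (\<theta> + 1) * norm (J - J'))"
    proof (rule sum_mono)
      fix b :: 'a assume b: "b \<in> Basis"
      have "\<bar>gain (\<lambda>m. m \<bullet> b) (P J) - gain (\<lambda>m. m \<bullet> b) (P J')\<bar> \<le> 1 * \<theta> * norm (J - J')"
        using gain_P_lip[OF Cb_borel[OF coordinate_Cb] coordinate_bound[OF b]] .
      moreover have "\<bar>(J - J') \<bullet> b\<bar> \<le> norm (J - J')" using Basis_le_norm[OF b] .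
      ultimately show "\<bar>(G J - G J') \<bullet> b\<bar> \<le> (\<theta> + 1) * norm (J - J')"
        by (simp add: inner_diff_left G_inner[OF b] algebra_simps)
    qed
    finally show ?thesis by (simp add: algebra_simps)
  qed
  then obtain J where J0: "J 0 = flux \<nu>\<^sub>0"
    and J: "\<And>t. t \<ge> 0 \<Longrightarrow> (J has_vector_derivative G (J t)) (at t within {0..})"
    using picard_lindelof_global[of G "DIM('a) * (\<theta> + 1)"] by metis
  have J_cont: "continuous_on {0..} J" using J by (rule has_vector_derivative_atLeast_continuous)
  have gain_cont: "continuous_on {0..} (\<lambda>s. gain \<phi> (P (J s)))"
    if "\<phi> \<in> borel_measurable (borel_on M)" "\<And>m. m \<in> M \<Longrightarrow> \<bar>\<phi> m\<bar> \<le> B" for \<phi> B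
  proof -
    have "0 \<le> B" using that(2) M_ne by force
    then have "(B * \<theta>)-lipschitz_on UNIV (\<lambda>J. gain \<phi> (P J))"
      using gain_P_lip[OF that] \<theta>_nonneg by (intro lipschitz_onI) (auto simp: dist_norm)
    from lipschitz_on_continuous_on[OF this] J_cont show ?thesis
      by (rule continuous_on_compose2) auto
  qed
  \<comment> \<open>Negative times encode that no redrawing has happened yet.\<close>
  define \<kappa> where "\<kappa> s = (if s < 0 then \<nu>\<^sub>0 else density \<mu> (K (P (J s))))" for s
  have \<kappa>_prob: "\<kappa> s \<in> prob_measures M" for s using \<nu>\<^sub>0 density_K(1) by (simp add: \<kappa>_def)
  have \<kappa>_meas: "\<kappa> \<in> borel \<rightarrow>\<^sub>M prob_algebra (borel_on M)"
  proof (rule measurable_prob_algebraI)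
    show "prob_space (\<kappa> s)" for s using \<kappa>_prob prob_measuresD(1) by blast
    show "\<kappa> \<in> borel \<rightarrow>\<^sub>M subprob_algebra (borel_on M)"
    proof (rule measurable_subprob_algebra)
      show "subprob_space (\<kappa> s)" for s using \<kappa>_prob prob_measuresD(1) prob_space_imp_subprob_space by blast
      show "sets (\<kappa> s) = sets (borel_on M)" for s using \<kappa>_prob prob_measuresD(2) by blast
      fix A assume A: "A \<in> sets (borel_on M)"
      have ind: "indicator A \<in> borel_measurable (borel_on M)" using A by simp
      have ind_bound: "\<bar>indicator A m :: real\<bar> \<le> 1" for m by (simp add: indicator_def)
      have "emeasure (\<kappa> s) A = ennreal (if s < 0 then measure \<nu>\<^sub>0 A else gain (indicator A) (P (J s)))" for s
      proof -
        have "emeasure (\<kappa> s) A = ennreal (measure (\<kappa> s) A)"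
          using prob_measuresD(1)[OF \<kappa>_prob[of s]]
          by (simp add: finite_measure.emeasure_eq_measure prob_space_def)
        moreover have "measure (\<kappa> s) A = gain (indicator A) (P (J s))" if "\<not> s < 0"
        proof -
          have "measure (\<kappa> s) A = (\<integral>m. indicator A m \<partial>\<kappa> s)"
            using A sets.sets_into_space[OF A] prob_measuresD(2,3)[OF \<kappa>_prob[of s]]
            by (simp add: Int_absorb2 space_restrict_space)
          also have "\<dots> = gain (indicator A) (P (J s))"
            using density_K(2)[OF ind] that by (simp add: \<kappa>_def)
          finally show ?thesis .
        qed
        ultimately show ?thesis by (simp add: \<kappa>_def)
      qed
      moreover have "(\<lambda>s. if s < 0 then measure \<nu>\<^sub>0 A else gain (indicator A) (P (J s))) \<in> borel_measurable borel"
      proof -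
        have "(\<lambda>s. indicator {0..} s *\<^sub>R gain (indicator A) (P (J s))) \<in> borel_measurable borel"
          using gain_cont[OF ind ind_bound] by (intro borel_measurable_continuous_on_indicator) auto
        then have "(\<lambda>s. measure \<nu>\<^sub>0 A * indicator {..<0} s + indicator {0..} s *\<^sub>R gain (indicator A) (P (J s)))
            \<in> borel_measurable borel" by simp
        then show ?thesis by (rule back_subst[of "\<lambda>f. f \<in> borel_measurable borel"]) (auto simp: fun_eq_iff)
      qed
      ultimately show "(\<lambda>s. emeasure (\<kappa> s) A) \<in> borel_measurable borel" by simp
    qed
  qed
  let ?E = "density lborel (\<lambda>s. ennreal (exponential_density 1 s))"
  interpret E: prob_space ?E by (rule prob_space_exponential_density) simp
  define \<nu> where "\<nu> t = (if t \<le> 0 then \<nu>\<^sub>0 else ?E \<bind> (\<lambda>s. \<kappa> (t - s)))" for t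
  have \<kappa>t_meas: "(\<lambda>s. \<kappa> (t - s)) \<in> ?E \<rightarrow>\<^sub>M prob_algebra (borel_on M)" for t
    by (rule measurable_compose[OF _ \<kappa>_meas]) simp
  have \<nu>_prob: "\<nu> t \<in> prob_measures M" for t
  proof (cases "t \<le> 0")
    case False
    have "?E \<bind> (\<lambda>s. \<kappa> (t - s)) \<in> space (prob_algebra (borel_on M))"
      using \<kappa>t_meas[of t] E.prob_space_axioms E.not_empty
      by (intro prob_measuresI E.prob_space_bind[of _ "borel_on M"] sets_bind[of _ _ "borel_on M"])
       (auto intro!: AE_I2 prob_measuresD \<kappa>_prob measurable_prob_algebraD)
    then show ?thesis using False by (simp add: \<nu>_def)
  qed (simp add: \<nu>_def \<nu>\<^sub>0)
  have rep: "(\<integral>m. \<phi> m \<partial>\<nu> t) = (\<integral>m. \<phi> m \<partial>\<nu>\<^sub>0)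
      + exp (- t) * integral {0..t} (\<lambda>s. exp s * (gain \<phi> (P (J s)) - (\<integral>m. \<phi> m \<partial>\<nu>\<^sub>0)))"
    if \<phi>: "\<phi> \<in> Cb M" and t: "t \<ge> 0" for \<phi> t
  proof (cases "t = 0")
    case False
    obtain B where B: "\<And>m. m \<in> M \<Longrightarrow> \<bar>\<phi> m\<bar> \<le> B" using Cb_bounded[OF \<phi>] by metis
    define h where "h s = (\<integral>m. \<phi> m \<partial>\<kappa> s)" for s
    have "(\<integral>m. \<phi> m \<partial>\<nu> t) = (\<integral>s. h (t - s) \<partial>?E)"
    proof -
      have "integral\<^sup>L (?E \<bind> (\<lambda>s. \<kappa> (t - s))) \<phi> = (\<integral>s. integral\<^sup>L (\<kappa> (t - s)) \<phi> \<partial>?E)"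
      proof (rule integral_bind)
        show "\<phi> \<in> borel_measurable (borel_on M)" by (rule Cb_borel[OF \<phi>])
        show "\<bar>\<phi> m\<bar> \<le> B" if "m \<in> space (borel_on M)" for m
          using that B by (simp add: space_restrict_space)
        show "(\<lambda>s. \<kappa> (t - s)) \<in> ?E \<rightarrow>\<^sub>M subprob_algebra (borel_on M)"
          by (rule measurable_prob_algebraD[OF \<kappa>t_meas])
        show "finite_measure ?E" by (rule E.finite_measure_axioms)
        show "AE s in ?E. emeasure (\<kappa> (t - s)) (space (\<kappa> (t - s))) \<le> ennreal 1"
          using prob_space.emeasure_space_1[OF prob_measuresD(1)[OF \<kappa>_prob]] by simp
      qed
      then show ?thesis using False t by (simp add: \<nu>_def h_def)
    qed
    also have "\<dots> = (\<integral>m. \<phi> m \<partial>\<nu>\<^sub>0)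
      + exp (- t) * integral {0..t} (\<lambda>s. exp s * (gain \<phi> (P (J s)) - (\<integral>m. \<phi> m \<partial>\<nu>\<^sub>0)))"
    proof (rule renewal_representation)
      show "h \<in> borel_measurable borel"
        unfolding h_def
        using measurable_compose[OF measurable_prob_algebraD[OF \<kappa>_meas]
            integral_measurable_subprob_algebra[OF Cb_borel[OF \<phi>]]] .
      show "\<bar>h s\<bar> \<le> B" for s unfolding h_def by (rule abs_integral_le_bound[OF \<kappa>_prob B \<phi>])
      show "h s = gain \<phi> (P (J s))" if "s \<ge> 0" for s
        using that density_K(2)[OF Cb_borel[OF \<phi>]] by (simp add: h_def \<kappa>_def)
    qed (use t gain_cont[OF Cb_borel[OF \<phi>] B] in \<open>auto simp: h_def \<kappa>_def\<close>)
    finally show ?thesis .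
  qed (simp add: \<nu>_def)
  have deriv: "((\<lambda>t. \<integral>m. \<phi> m \<partial>\<nu> t) has_vector_derivative gain \<phi> (P (J t)) - (\<integral>m. \<phi> m \<partial>\<nu> t)) (at t within {0..})"
    if \<phi>: "\<phi> \<in> Cb M" and t: "t \<ge> 0" for \<phi> t
  proof -
    obtain B where B: "\<And>m. m \<in> M \<Longrightarrow> \<bar>\<phi> m\<bar> \<le> B" using Cb_bounded[OF \<phi>] by metis
    let ?c = "\<integral>m. \<phi> m \<partial>\<nu>\<^sub>0" and ?f = "\<lambda>s. exp s * (gain \<phi> (P (J s)) - (\<integral>m. \<phi> m \<partial>\<nu>\<^sub>0))"
    have "continuous_on {0..} ?f"
      by (intro continuous_intros gain_cont[OF Cb_borel[OF \<phi>] B])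
    from FTC_atLeast[OF this t]
    have "((\<lambda>t. integral {0..t} ?f) has_real_derivative ?f t) (at t within {0..})"
      by (simp add: has_real_derivative_iff_has_vector_derivative)
    then have "((\<lambda>t. ?c + exp (- t) * integral {0..t} ?f) has_real_derivative
        gain \<phi> (P (J t)) - (?c + exp (- t) * integral {0..t} ?f)) (at t within {0..})"
      by (auto intro!: derivative_eq_intros simp: exp_minus field_simps)
    then have "((\<lambda>t. ?c + exp (- t) * integral {0..t} ?f) has_vector_derivative
        gain \<phi> (P (J t)) - (\<integral>m. \<phi> m \<partial>\<nu> t)) (at t within {0..})"
      using rep[OF \<phi> t] by (simp add: has_real_derivative_iff_has_vector_derivative)
    then show ?thesis
      by (rule has_vector_derivative_transform[rotated 2]) (use t rep[OF \<phi>] in auto)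
  qed
  have flux: "flux (\<nu> t) = J t" if t: "t \<ge> 0" for t
  proof (rule euclidean_eqI)
    fix b :: 'a assume b: "b \<in> Basis"
    let ?e = "\<lambda>t. (\<integral>m. m \<bullet> b \<partial>\<nu> t) - J t \<bullet> b"
    have d: "(?e has_vector_derivative - ?e t) (at t within {0..})" if t: "t \<ge> 0" for t
    proof -
      have "((\<lambda>t. J t \<bullet> b) has_vector_derivative G (J t) \<bullet> b) (at t within {0..})"
        using J[OF t] bounded_linear.has_vector_derivative[OF bounded_linear_inner_left] by blast
      from has_vector_derivative_diff[OF deriv[OF coordinate_Cb[of b] t] this]
      show ?thesis by (simp add: G_inner[OF b])
    qed
    have e_cont: "continuous_on {0..} ?e" using d by (rule has_vector_derivative_atLeast_continuous)
    have e0: "?e 0 = 0" using flux_inner(1)[OF \<nu>\<^sub>0, of b] J0 by (simp add: \<nu>_def)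
    have "\<bar>?e t\<bar> = 0"
    proof (rule gronwall_zero[where w = "\<lambda>t. \<bar>?e t\<bar>" and C = 1])
      show "continuous_on {0..} (\<lambda>t. \<bar>?e t\<bar>)" by (intro continuous_intros e_cont)
      fix s :: real assume s: "s \<ge> 0"
      have "((\<lambda>t. - ?e t) has_integral ?e s) {0..s}" using FTC_difference_atLeast[OF d s] e0 by simp
      moreover have "(\<lambda>t. \<bar>?e t\<bar>) integrable_on {0..s}"
        by (intro integrable_continuous_interval continuous_intros continuous_on_subset[OF e_cont]) auto
      ultimately have "norm (integral {0..s} (\<lambda>t. - ?e t)) \<le> integral {0..s} (\<lambda>t. \<bar>?e t\<bar>)"
        by (intro integral_norm_bound_integral) (auto simp: has_integral_integrable)
      then show "\<bar>?e s\<bar> \<le> 1 * integral {0..s} (\<lambda>t. \<bar>?e t\<bar>)"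
        using integral_unique[OF \<open>((\<lambda>t. - ?e t) has_integral ?e s) {0..s}\<close>] by simp
    qed (use t in auto)
    then show "flux (\<nu> t) \<bullet> b = J t \<bullet> b" using flux_inner(1)[OF \<nu>_prob] by simp
  qed
  show thesis
  proof (rule that[of \<nu>])
    show "\<nu> 0 = \<nu>\<^sub>0" by (simp add: \<nu>_def)
    show "\<nu> t \<in> prob_measures M" for t by (rule \<nu>_prob)
    fix \<phi> and t :: real assume \<phi>: "\<phi> \<in> Cb M" and t: "t \<ge> 0"
    have "P (J t) = flux (\<nu> t)" using flux[OF t] flux_inner(2)[OF \<nu>_prob] P_self by metis
    then show "((\<lambda>t. \<integral>m. \<phi> m \<partial>\<nu> t) has_vector_derivative Q_BGK \<mu> K \<phi> (\<nu> t)) (at t within {0..})"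
      using deriv[OF \<phi> t] Q_BGK_eq[OF \<nu>_prob \<phi>] by simp
  qed
qed

lemma AE_lborel_exists_between:
  fixes a b :: real
  assumes P: "AE t in lborel. P t" and ab: "a < b"
  obtains t where "a < t" "t < b" "P t"
proof -
  obtain N where N: "{t. \<not> P t} \<subseteq> N" "N \<in> sets lborel" "emeasure lborel N = 0"
    using AE_E[OF P] by auto
  have "\<not> {a<..<b} \<subseteq> N"
  proof
    assume "{a<..<b} \<subseteq> N"
    then have "emeasure lborel {a<..<b} \<le> emeasure lborel N" using N(2) by (rule emeasure_mono)
    then show False using ab N(3) by simp
  qed
  then obtain t where "t \<in> {a<..<b}" "t \<notin> N" by blast
  then show thesis using that[of t] N(1) by auto
qed

text \<open>
  A weak solution that is right-continuous satisfies the integral equation at every time, because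
  both of its sides are right-continuous; its integrand is only known to be bounded and continuous
  almost everywhere, which makes it integrable.
\<close>

lemma right_continuous_weak_solution:
  assumes x: "weak_solution_BGK M \<mu> K x"
    and right: "\<And>t. t \<ge> 0 \<Longrightarrow> limitin (weak_topology M) x (x t) (at_right t)"
    and \<phi>: "\<phi> \<in> Cb M" and t: "t \<ge> 0"
  shows "(\<lambda>s. Q_BGK \<mu> K \<phi> (x s)) integrable_on {0..t}"
    and "(\<integral>m. \<phi> m \<partial>x t) = (\<integral>m. \<phi> m \<partial>x 0) + integral {0..t} (\<lambda>s. Q_BGK \<mu> K \<phi> (x s))"
proof -
  let ?q = "\<lambda>s. Q_BGK \<mu> K \<phi> (x s)"
  obtain B where B: "B \<ge> 0" "\<And>m. m \<in> M \<Longrightarrow> \<bar>\<phi> m\<bar> \<le> B" using Cb_bounded[OF \<phi>] by metis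
  have x_in: "x t \<in> prob_measures M" if "t \<ge> 0" for t
    using x that by (simp add: weak_solution_BGK_def)
  have q_bound: "\<bar>?q s\<bar> \<le> 2 * B" if "s \<ge> 0" for s
    using gain_bound[OF Cb_borel[OF \<phi>] B(2), of "flux (x s)"] abs_integral_le_bound[OF x_in[OF that] B(2) \<phi>]
    unfolding Q_BGK_eq[OF x_in[OF that] \<phi>] by (simp add: abs_le_iff)
  have "AE t in lborel. 0 \<le> t \<longrightarrow> limitin (weak_topology M) x (x t) (at t within {0..})"
    using x by (simp add: weak_solution_BGK_def)
  from AE_E[OF this] obtain N where
    "{s \<in> space lborel. \<not> (0 \<le> s \<longrightarrow> limitin (weak_topology M) x (x s) (at s within {0..}))} \<subseteq> N"
    and N: "emeasure lborel N = 0" "N \<in> sets lborel" .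
  then have cont: "limitin (weak_topology M) x (x s) (at s within {0..})" if "0 \<le> s" "s \<notin> N" for s
    using that by auto
  have q_lim: "(?q \<longlongrightarrow> ?q s) (at s within {0..})" if s: "0 \<le> s" "s \<notin> N" for s
  proof -
    have lim: "((\<lambda>s. \<integral>m. \<psi> m \<partial>x s) \<longlongrightarrow> (\<integral>m. \<psi> m \<partial>x s)) (at s within {0..})" if "\<psi> \<in> Cb M" for \<psi>
      using cont[OF s] that by (simp add: limitin_weak_topology)
    define \<Phi> where "\<Phi> = insert \<phi> ((\<lambda>b m. m \<bullet> b) ` Basis)"
    have \<Phi>: "finite \<Phi>" "\<Phi> \<subseteq> Cb M" using \<phi> coordinate_Cb by (auto simp: \<Phi>_def)
    have \<Phi>_bound: "\<bar>\<psi> m\<bar> \<le> max B 1" if "\<psi> \<in> \<Phi>" "m \<in> M" for \<psi> m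
      using that B(2)[of m] coordinate_bound[of _ m] by (fastforce simp: \<Phi>_def le_max_iff_disj)
    let ?C = "max B 1 * \<theta> * DIM('a) + 1"
    have "((\<lambda>s'. ?C * (\<Sum>\<psi>\<in>\<Phi>. \<bar>(\<integral>m. \<psi> m \<partial>x s') - (\<integral>m. \<psi> m \<partial>x s)\<bar>)) \<longlongrightarrow>
        ?C * (\<Sum>\<psi>\<in>\<Phi>. \<bar>(\<integral>m. \<psi> m \<partial>x s) - (\<integral>m. \<psi> m \<partial>x s)\<bar>)) (at s within {0..})"
      using \<Phi>(2) by (intro tendsto_intros lim) auto
    then have "((\<lambda>s'. ?C * (\<Sum>\<psi>\<in>\<Phi>. \<bar>(\<integral>m. \<psi> m \<partial>x s') - (\<integral>m. \<psi> m \<partial>x s)\<bar>)) \<longlongrightarrow> 0) (at s within {0..})" by simp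
    moreover have "\<forall>\<^sub>F s' in at s within {0..}. norm (?q s' - ?q s)
        \<le> ?C * (\<Sum>\<psi>\<in>\<Phi>. \<bar>(\<integral>m. \<psi> m \<partial>x s') - (\<integral>m. \<psi> m \<partial>x s)\<bar>)"
    proof -
      have "\<forall>\<^sub>F s' in at s within {0..}. s' \<in> {0..}" by (simp add: eventually_at_filter)
      then show ?thesis
      proof eventually_elim
        case (elim s')
        then show ?case unfolding real_norm_def
          by (intro Q_BGK_lipschitz x_in s(1) \<Phi> \<Phi>_bound) (auto simp: \<Phi>_def)
      qed
    qed
    ultimately have "((\<lambda>s'. ?q s' - ?q s) \<longlongrightarrow> 0) (at s within {0..})"
      by (rule Lim_null_comparison[rotated])
    then show ?thesis by (rule LIM_zero_cancel)
  qed
  have integrable: "?q integrable_on {0..t}" for t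
  proof -
    define A where "A = {0..t} - N"
    have A: "A \<in> sets borel" "A \<in> sets lborel" using N(2) by (auto simp: A_def)
    have "continuous_on A ?q"
      unfolding continuous_on_def A_def
      by (auto intro!: tendsto_within_subset[OF q_lim, of _ "{0..t} - N"])
    from borel_measurable_continuous_on_indicator[OF A(1) this]
    have m: "(\<lambda>s. indicator A s *\<^sub>R ?q s) \<in> borel_measurable lborel" by simp
    have "integrable lborel (\<lambda>s. indicat_real {0..t} s * (2 * B))"
      by (intro integrable_mult_left integrable_real_indicator) (auto simp: emeasure_lborel_Icc_eq)
    then have "set_integrable lborel A ?q"
      unfolding set_integrable_def
      by (rule Bochner_Integration.integrable_bound[OF _ m]) (use q_bound B(1) in \<open>auto simp: A_def indicator_def\<close>)
    then have A_int: "?q integrable_on A" by (rule set_borel_integral_eq_integral(1))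
    have neg: "negligible N" using N by (simp add: negligible_iff_null_sets null_setsI null_sets_completionI)
    show ?thesis
    proof (rule integrable_spike_set[OF A_int])
      show "negligible {s \<in> A - {0..t}. ?q s \<noteq> 0}" by (rule negligible_subset[OF neg]) (auto simp: A_def)
      show "negligible {s \<in> {0..t} - A. ?q s \<noteq> 0}" by (rule negligible_subset[OF neg]) (auto simp: A_def)
    qed
  qed
  then show "?q integrable_on {0..t}" .
  let ?g = "\<lambda>t. (\<integral>m. \<phi> m \<partial>x t) - (\<integral>m. \<phi> m \<partial>x 0) - integral {0..t} ?q"
  have eq: "AE t in lborel. 0 \<le> t \<longrightarrow> ?g t = 0"
    using x \<phi> by (auto simp: weak_solution_BGK_def elim: eventually_mono)
  have "((\<lambda>s. \<integral>m. \<phi> m \<partial>x s) \<longlongrightarrow> (\<integral>m. \<phi> m \<partial>x t)) (at_right t)"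
    using right[OF t] \<phi> by (simp add: limitin_weak_topology)
  moreover have "((\<lambda>s. integral {0..s} ?q) \<longlongrightarrow> integral {0..t} ?q) (at_right t)"
  proof -
    have "continuous_on {0..t + 1} (\<lambda>s. integral {0..s} ?q)" by (rule indefinite_integral_continuous_1[OF integrable])
    then have "((\<lambda>s. integral {0..s} ?q) \<longlongrightarrow> integral {0..t} ?q) (at t within {0..t + 1})"
      using t by (simp add: continuous_on_def)
    then have "((\<lambda>s. integral {0..s} ?q) \<longlongrightarrow> integral {0..t} ?q) (at t within {t<..<t + 1})"
      by (rule tendsto_within_subset) (use t in auto)
    moreover have "at t within {t<..<t + 1} = at_right t"
      by (rule at_within_nhd[of _ "{..<t + 1}"]) auto
    ultimately show ?thesis by simp
  qed
  ultimately have g_lim: "(?g \<longlongrightarrow> ?g t) (at_right t)" by (intro tendsto_intros)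
  have "?g t = 0"
  proof (rule ccontr)
    assume "?g t \<noteq> 0"
    then have "\<forall>\<^sub>F s in at_right t. ?g s \<noteq> 0" by (rule tendsto_imp_eventually_ne[OF g_lim])
    then obtain b where b: "b > t" "\<And>s. t < s \<Longrightarrow> s < b \<Longrightarrow> ?g s \<noteq> 0"
      unfolding eventually_at_right_field by blast
    obtain s where "t < s" "s < b" "0 \<le> s \<longrightarrow> ?g s = 0"
      using AE_lborel_exists_between[OF eq b(1)] by metis
    then show False using b(2)[of s] t by auto
  qed
  then show "(\<integral>m. \<phi> m \<partial>x t) = (\<integral>m. \<phi> m \<partial>x 0) + integral {0..t} ?q" by simp
qed

text \<open>
  The differences of the integrals of a given test function and of the coordinates satisfy a closed
  system of Lipschitz integral inequalities, so that their sum vanishes by Gronwall's inequality.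
\<close>

lemma weak_solution_unique:
  assumes x: "weak_solution_BGK M \<mu> K x"
    and right: "\<And>t. t \<ge> 0 \<Longrightarrow> limitin (weak_topology M) x (x t) (at_right t)"
    and \<nu>: "\<And>t. \<nu> t \<in> prob_measures M"
    and d\<nu>: "\<And>\<phi> t. \<phi> \<in> Cb M \<Longrightarrow> t \<ge> 0 \<Longrightarrow>
       ((\<lambda>t. \<integral>m. \<phi> m \<partial>\<nu> t) has_vector_derivative Q_BGK \<mu> K \<phi> (\<nu> t)) (at t within {0..})"
    and init: "x 0 = \<nu> 0" and \<phi>: "\<phi> \<in> Cb M" and t: "t \<ge> 0"
  shows "(\<integral>m. \<phi> m \<partial>x t) = (\<integral>m. \<phi> m \<partial>\<nu> t)"
proof -
  obtain B where B: "B \<ge> 0" "\<And>m. m \<in> M \<Longrightarrow> \<bar>\<phi> m\<bar> \<le> B" using Cb_bounded[OF \<phi>] by metis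
  have x_in: "x t \<in> prob_measures M" if "t \<ge> 0" for t
    using x that by (simp add: weak_solution_BGK_def)
  define \<Phi> where "\<Phi> = insert \<phi> ((\<lambda>b m. m \<bullet> b) ` Basis)"
  have \<Phi>: "finite \<Phi>" "\<Phi> \<subseteq> Cb M" "(\<lambda>b m. m \<bullet> b) ` Basis \<subseteq> \<Phi>" using \<phi> coordinate_Cb by (auto simp: \<Phi>_def)
  have \<Phi>_bound: "\<bar>\<psi> m\<bar> \<le> max B 1" if "\<psi> \<in> \<Phi>" "m \<in> M" for \<psi> m
    using that B(2)[of m] coordinate_bound[of _ m] by (fastforce simp: \<Phi>_def le_max_iff_disj)
  define C where "C = max B 1 * \<theta> * DIM('a) + 1"
  have C: "C \<ge> 0" using \<theta>_nonneg by (simp add: C_def)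
  define d where "d \<psi> t = (\<integral>m. \<psi> m \<partial>x t) - (\<integral>m. \<psi> m \<partial>\<nu> t)" for \<psi> :: "'a \<Rightarrow> real" and t
  define w where "w t = (\<Sum>\<psi>\<in>\<Phi>. \<bar>d \<psi> t\<bar>)" for t
  have x_has: "((\<lambda>s. Q_BGK \<mu> K \<psi> (x s)) has_integral ((\<integral>m. \<psi> m \<partial>x t) - (\<integral>m. \<psi> m \<partial>x 0))) {0..t}"
    if "\<psi> \<in> Cb M" "t \<ge> 0" for \<psi> t
    using right_continuous_weak_solution[OF x right that] by (simp add: has_integral_integrable_integral)
  have d_has: "((\<lambda>s. Q_BGK \<mu> K \<psi> (x s) - Q_BGK \<mu> K \<psi> (\<nu> s)) has_integral d \<psi> t) {0..t}"
    if "\<psi> \<in> Cb M" "t \<ge> 0" for \<psi> t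
    using has_integral_diff[OF x_has[OF that] FTC_difference_atLeast[OF d\<nu>[OF that(1)] that(2)]]
    by (simp add: d_def init)
  have d_cont: "continuous_on {0..} (d \<psi>)" if \<psi>: "\<psi> \<in> Cb M" for \<psi>
  proof -
    have "continuous_on {0..T} (d \<psi>)" if "T \<ge> 0" for T
    proof -
      have "continuous_on {0..T} (\<lambda>t. integral {0..t} (\<lambda>s. Q_BGK \<mu> K \<psi> (x s) - Q_BGK \<mu> K \<psi> (\<nu> s)))"
        using d_has[OF \<psi> that] by (intro indefinite_integral_continuous_1) (rule has_integral_integrable)
      then show ?thesis
        by (rule continuous_on_eq) (use d_has[OF \<psi>] in \<open>auto intro: integral_unique\<close>)
    qed
    then show ?thesis
      unfolding continuous_on_eq_continuous_within
    proof (intro ballI)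
      fix t :: real assume c: "\<And>T. T \<ge> 0 \<Longrightarrow> \<forall>t\<in>{0..T}. continuous (at t within {0..T}) (d \<psi>)" and t: "t \<in> {0..}"
      have "continuous (at t within {0..t + 1}) (d \<psi>)" using c[of "t + 1"] t by simp
      moreover have "at t within {0..t + 1} = at t within {0..}"
        by (rule at_within_nhd[of _ "{..<t + 1}"]) auto
      ultimately show "continuous (at t within {0..}) (d \<psi>)" by simp
    qed
  qed
  have w_cont: "continuous_on {0..} w"
    unfolding w_def using \<Phi>(2) by (intro continuous_intros d_cont) auto
  have "w t = 0"
  proof (rule gronwall_zero[OF w_cont _ _ _ t])
    show "0 \<le> w t" for t unfolding w_def by (intro sum_nonneg) auto
    show "0 \<le> card \<Phi> * C" using C by simp
    fix t :: real assume t: "t \<ge> 0"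
    have "\<bar>d \<psi> t\<bar> \<le> integral {0..t} (\<lambda>s. C * w s)" if \<psi>: "\<psi> \<in> \<Phi>" for \<psi>
    proof -
      note D = d_has[of \<psi> t] 
      have \<psi>C: "\<psi> \<in> Cb M" using \<psi> \<Phi>(2) by auto
      have "norm (integral {0..t} (\<lambda>s. Q_BGK \<mu> K \<psi> (x s) - Q_BGK \<mu> K \<psi> (\<nu> s))) \<le> integral {0..t} (\<lambda>s. C * w s)"
      proof (rule integral_norm_bound_integral)
        show "(\<lambda>s. Q_BGK \<mu> K \<psi> (x s) - Q_BGK \<mu> K \<psi> (\<nu> s)) integrable_on {0..t}"
          using D[OF \<psi>C t] by (rule has_integral_integrable)
        show "(\<lambda>s. C * w s) integrable_on {0..t}"
          by (intro integrable_continuous_interval continuous_intros continuous_on_subset[OF w_cont]) auto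
        fix s assume "s \<in> {0..t}"
        then show "norm (Q_BGK \<mu> K \<psi> (x s) - Q_BGK \<mu> K \<psi> (\<nu> s)) \<le> C * w s"
          unfolding real_norm_def C_def w_def d_def
          by (intro Q_BGK_lipschitz x_in \<nu> \<Phi> \<Phi>_bound \<psi>) auto
      qed
      then show ?thesis using integral_unique[OF D[OF \<psi>C t]] by simp
    qed
    then have "w t \<le> (\<Sum>\<psi>\<in>\<Phi>. integral {0..t} (\<lambda>s. C * w s))" unfolding w_def by (intro sum_mono) (simp add: w_def)
    then show "w t \<le> card \<Phi> * C * integral {0..t} w" by simp
  qed
  then have "\<bar>d \<phi> t\<bar> = 0" unfolding w_def using \<Phi>(1) by (subst (asm) sum_nonneg_eq_0_iff) (auto simp: \<Phi>_def)
  then show ?thesis by (simp add: d_def)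
qed

end

section \<open>Kolmogorov's maximal inequality\<close>

text \<open>
  The event is split according to the first time \<open>k\<close> at which the level \<open>\<delta>\<close> is reached. On the \<open>k\<close>-th part
  the later increments are orthogonal to \<open>W k\<close>, so that the second moment of \<open>W n\<close> is there at least that
  of \<open>W k\<close>. Orthogonality to all bounded variables known before replaces conditional expectations in the
  definition of a martingale increment.
\<close>

lemma kolmogorov_maximal_inequality:
  fixes D :: "nat \<Rightarrow> 'w \<Rightarrow> real" and n :: nat and v \<delta> :: real
  assumes \<Omega>: "prob_space \<Omega>"
    and F: "\<And>k. subalgebra \<Omega> (F k)" "\<And>i j. i \<le> j \<Longrightarrow> sets (F i) \<subseteq> sets (F j)"
    and D: "\<And>k. D k \<in> borel_measurable (F (Suc k))" "\<And>k \<omega>. \<omega> \<in> space \<Omega> \<Longrightarrow> \<bar>D k \<omega>\<bar> \<le> C"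
    and orth: "\<And>k Z c. Z \<in> borel_measurable (F k) \<Longrightarrow> (\<And>\<omega>. \<omega> \<in> space \<Omega> \<Longrightarrow> \<bar>Z \<omega>\<bar> \<le> c) \<Longrightarrow>
       (\<integral>\<omega>. Z \<omega> * D k \<omega> \<partial>\<Omega>) = 0"
    and var: "\<And>k. (\<integral>\<omega>. (D k \<omega>)\<^sup>2 \<partial>\<Omega>) \<le> v" and \<delta>: "\<delta> > 0"
  defines "W k \<omega> \<equiv> \<Sum>i<k. D i \<omega>"
  shows "measure \<Omega> {\<omega> \<in> space \<Omega>. \<exists>k\<le>n. \<delta> \<le> \<bar>W k \<omega>\<bar>} \<le> n * v / \<delta>\<^sup>2"
proof -
  interpret prob_space \<Omega> by (rule \<Omega>)
  have spF: "space (F k) = space \<Omega>" for k using F(1) by (simp add: subalgebra_def)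
  have F_mono: "subalgebra (F j) (F i)" if "i \<le> j" for i j
    using F(2)[OF that] by (simp add: subalgebra_def spF)
  have W_F: "W k \<in> borel_measurable (F k)" for k
    unfolding W_def by (intro borel_measurable_sum measurable_from_subalg[OF F_mono D(1)]) auto
  have W_bound: "\<bar>W k \<omega>\<bar> \<le> real k * C" if "\<omega> \<in> space \<Omega>" for k \<omega>
  proof -
    have "\<bar>W k \<omega>\<bar> \<le> (\<Sum>i<k. \<bar>D i \<omega>\<bar>)" unfolding W_def by (rule sum_abs)
    also have "\<dots> \<le> (\<Sum>i<k. C)" using D(2)[OF that] by (intro sum_mono) auto
    finally show ?thesis by simp
  qed
  have to_\<Omega>: "f \<in> borel_measurable \<Omega>" if "f \<in> borel_measurable (F k)" for f :: "'w \<Rightarrow> real" and k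
    by (rule measurable_from_subalg[OF F(1) that])
  have D_\<Omega>: "D k \<in> borel_measurable \<Omega>" and W_\<Omega>: "W k \<in> borel_measurable \<Omega>" for k
    using to_\<Omega> D(1) W_F by blast+
  have C0: "0 \<le> C" using D(2) not_empty by force
  have int: "integrable \<Omega> f"
    if "f \<in> borel_measurable \<Omega>" "\<And>\<omega>. \<omega> \<in> space \<Omega> \<Longrightarrow> \<bar>f \<omega>\<bar> \<le> c" for f :: "'w \<Rightarrow> real" and c
    using that by (intro integrable_const_bound[of _ c]) auto
  have int_ZD: "integrable \<Omega> (\<lambda>\<omega>. Z \<omega> * D k \<omega>)"
    if "Z \<in> borel_measurable \<Omega>" "\<And>\<omega>. \<omega> \<in> space \<Omega> \<Longrightarrow> \<bar>Z \<omega>\<bar> \<le> c" for Z c k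
    by (rule int[of _ "c * C"]) (use that D_\<Omega> D(2) in \<open>auto simp: abs_mult intro!: mult_mono order_trans[OF abs_ge_zero that(2)]\<close>)
  have int_W2: "integrable \<Omega> (\<lambda>\<omega>. (W k \<omega>)\<^sup>2)" for k
  proof (rule int[of _ "(real k * C)\<^sup>2"])
    fix \<omega> assume "\<omega> \<in> space \<Omega>"
    from power_mono[OF W_bound[OF this, of k], of 2] show "\<bar>(W k \<omega>)\<^sup>2\<bar> \<le> (real k * C)\<^sup>2" by simp
  qed (use W_\<Omega> in auto)
  have int_D2: "integrable \<Omega> (\<lambda>\<omega>. (D k \<omega>)\<^sup>2)" for k
  proof (rule int[of _ "C\<^sup>2"])
    fix \<omega> assume "\<omega> \<in> space \<Omega>"
    from power_mono[OF D(2)[OF this, of k], of 2] show "\<bar>(D k \<omega>)\<^sup>2\<bar> \<le> C\<^sup>2" by simp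
  qed (use D_\<Omega> in auto)
  have second_moment: "(\<integral>\<omega>. (W n \<omega>)\<^sup>2 \<partial>\<Omega>) \<le> n * v" for n :: nat
  proof (induction n)
    case (Suc n)
    have "(W (Suc n) \<omega>)\<^sup>2 = (W n \<omega>)\<^sup>2 + 2 * (W n \<omega> * D n \<omega>) + (D n \<omega>)\<^sup>2" for \<omega>
      by (simp add: W_def power2_sum)
    then have "(\<integral>\<omega>. (W (Suc n) \<omega>)\<^sup>2 \<partial>\<Omega>)
        = (\<integral>\<omega>. (W n \<omega>)\<^sup>2 \<partial>\<Omega>) + 2 * (\<integral>\<omega>. W n \<omega> * D n \<omega> \<partial>\<Omega>) + (\<integral>\<omega>. (D n \<omega>)\<^sup>2 \<partial>\<Omega>)"
      using int_W2 int_D2 int_ZD[OF W_\<Omega> W_bound, of n n] by simp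
    also have "(\<integral>\<omega>. W n \<omega> * D n \<omega> \<partial>\<Omega>) = 0" by (rule orth[OF W_F W_bound])
    finally show ?case using Suc var[of n] by (simp add: algebra_simps)
  qed (simp add: W_def)
  define A where "A k = {\<omega> \<in> space \<Omega>. \<delta> \<le> \<bar>W k \<omega>\<bar> \<and> (\<forall>i<k. \<bar>W i \<omega>\<bar> < \<delta>)}" for k
  have A_F: "A k \<in> sets (F k)" for k
  proof -
    have "{\<omega> \<in> space (F k). \<delta> \<le> \<bar>W k \<omega>\<bar> \<and> (\<forall>i\<in>{..<k}. \<bar>W i \<omega>\<bar> < \<delta>)} \<in> sets (F k)"
      using W_F by (intro sets.sets_Collect sets.sets_Collect_finite_All borel_measurable_le borel_measurable_less
          borel_measurable_abs measurable_from_subalg[OF F_mono W_F] measurable_const) auto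
    then show ?thesis by (simp add: A_def spF Ball_def)
  qed
  have A_\<Omega>: "A k \<in> sets \<Omega>" for k using A_F F(1) by (auto simp: subalgebra_def)
  have A_disj: "disjoint_family A"
    unfolding disjoint_family_on_def
  proof (intro ballI impI)
    fix i j :: nat assume "i \<noteq> j"
    then consider "i < j" | "j < i" by linarith
    then show "A i \<inter> A j = {}" by cases (force simp: A_def)+
  qed
  have event: "{\<omega> \<in> space \<Omega>. \<exists>k\<le>n. \<delta> \<le> \<bar>W k \<omega>\<bar>} = (\<Union>k\<in>{..n}. A k)"
  proof (intro equalityI subsetI)
    fix \<omega> assume \<omega>: "\<omega> \<in> {\<omega> \<in> space \<Omega>. \<exists>k\<le>n. \<delta> \<le> \<bar>W k \<omega>\<bar>}"
    define k where "k = (LEAST k. \<delta> \<le> \<bar>W k \<omega>\<bar>)"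
    obtain k' where k': "k' \<le> n" "\<delta> \<le> \<bar>W k' \<omega>\<bar>" using \<omega> by blast
    have "\<delta> \<le> \<bar>W k \<omega>\<bar>" unfolding k_def using k'(2) by (rule LeastI[of "\<lambda>k. \<delta> \<le> \<bar>W k \<omega>\<bar>" k'])
    moreover have "k \<le> k'" unfolding k_def using k'(2) by (rule Least_le)
    moreover have "\<bar>W i \<omega>\<bar> < \<delta>" if "i < k" for i
      using not_less_Least[of i "\<lambda>k. \<delta> \<le> \<bar>W k \<omega>\<bar>"] that unfolding k_def by simp
    ultimately show "\<omega> \<in> (\<Union>k\<in>{..n}. A k)" using \<omega> k'(1) by (auto simp: A_def)
  qed (auto simp: A_def)
  have int_A: "integrable \<Omega> (\<lambda>\<omega>. indicator (A k) \<omega> * (W i \<omega>)\<^sup>2)" for k i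
    using integrable_mult_indicator[OF A_\<Omega> int_W2] by simp
  have cell: "\<delta>\<^sup>2 * prob (A k) \<le> (\<integral>\<omega>. indicator (A k) \<omega> * (W n \<omega>)\<^sup>2 \<partial>\<Omega>)" if k: "k \<le> n" for k
  proof -
    define Z where "Z \<omega> = indicator (A k) \<omega> * W k \<omega>" for \<omega>
    have Z_F: "Z \<in> borel_measurable (F k)" unfolding Z_def using A_F W_F by (intro borel_measurable_times) auto
    have Z_bound: "\<bar>Z \<omega>\<bar> \<le> real k * C" if "\<omega> \<in> space \<Omega>" for \<omega>
      using W_bound[OF that, of k] C0 by (simp add: Z_def indicator_def)
    have zero: "(\<integral>\<omega>. Z \<omega> * D i \<omega> \<partial>\<Omega>) = 0" if "k \<le> i" for i
      by (rule orth[OF measurable_from_subalg[OF F_mono[OF that] Z_F] Z_bound])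
    have int_ZDi: "integrable \<Omega> (\<lambda>\<omega>. Z \<omega> * D i \<omega>)" for i by (rule int_ZD[OF to_\<Omega>[OF Z_F] Z_bound])
    have "\<delta>\<^sup>2 * prob (A k) = (\<integral>\<omega>. \<delta>\<^sup>2 * indicator (A k) \<omega> \<partial>\<Omega>)"
      using A_\<Omega>[of k] sets.sets_into_space[OF A_\<Omega>] by (simp add: Int_absorb2)
    also have "\<dots> \<le> (\<integral>\<omega>. indicator (A k) \<omega> * (W k \<omega>)\<^sup>2 \<partial>\<Omega>)"
    proof (rule integral_mono[OF _ int_A])
      show "integrable \<Omega> (\<lambda>\<omega>. \<delta>\<^sup>2 * indicator (A k) \<omega>)" using A_\<Omega> by (intro integrable_mult_right integrable_real_indicator) (auto simp: emeasure_eq_measure)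
      fix \<omega>
      have "\<delta>\<^sup>2 \<le> (W k \<omega>)\<^sup>2" if "\<omega> \<in> A k" using that \<delta> power_mono[of \<delta> "\<bar>W k \<omega>\<bar>" 2] by (simp add: A_def)
      then show "\<delta>\<^sup>2 * indicator (A k) \<omega> \<le> indicator (A k) \<omega> * (W k \<omega>)\<^sup>2" by (simp add: indicator_def)
    qed
    also have "\<dots> = (\<integral>\<omega>. indicator (A k) \<omega> * (W k \<omega>)\<^sup>2 + 2 * (\<Sum>i\<in>{k..<n}. Z \<omega> * D i \<omega>) \<partial>\<Omega>)"
      using int_A int_ZDi zero by (simp add: Bochner_Integration.integral_sum)
    also have "\<dots> \<le> (\<integral>\<omega>. indicator (A k) \<omega> * (W n \<omega>)\<^sup>2 \<partial>\<Omega>)"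
    proof (rule integral_mono[OF _ int_A])
      show "integrable \<Omega> (\<lambda>\<omega>. indicator (A k) \<omega> * (W k \<omega>)\<^sup>2 + 2 * (\<Sum>i\<in>{k..<n}. Z \<omega> * D i \<omega>))"
        using int_A int_ZDi by simp
      fix \<omega>
      have "W n \<omega> = W k \<omega> + (\<Sum>i\<in>{k..<n}. D i \<omega>)"
        unfolding W_def using sum.atLeastLessThan_concat[of 0 k n "\<lambda>i. D i \<omega>"] k by (simp add: atLeast0LessThan)
      then have "(W n \<omega>)\<^sup>2 - (W k \<omega>)\<^sup>2 - 2 * (W k \<omega> * (\<Sum>i\<in>{k..<n}. D i \<omega>)) = (\<Sum>i\<in>{k..<n}. D i \<omega>)\<^sup>2"
        by (simp add: power2_sum)
      then have "(W k \<omega>)\<^sup>2 + 2 * (W k \<omega> * (\<Sum>i\<in>{k..<n}. D i \<omega>)) \<le> (W n \<omega>)\<^sup>2"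
        using zero_le_power2[of "\<Sum>i\<in>{k..<n}. D i \<omega>"] by linarith
      then show "indicator (A k) \<omega> * (W k \<omega>)\<^sup>2 + 2 * (\<Sum>i\<in>{k..<n}. Z \<omega> * D i \<omega>) \<le> indicator (A k) \<omega> * (W n \<omega>)\<^sup>2"
        by (simp add: Z_def indicator_def sum_distrib_left[symmetric])
    qed
    finally show ?thesis .
  qed
  have "\<delta>\<^sup>2 * prob {\<omega> \<in> space \<Omega>. \<exists>k\<le>n. \<delta> \<le> \<bar>W k \<omega>\<bar>} = (\<Sum>k\<le>n. \<delta>\<^sup>2 * prob (A k))"
    unfolding event using A_\<Omega> A_disj
    by (subst finite_measure_finite_Union) (auto simp: sum_distrib_left disjoint_family_on_def)
  also have "\<dots> \<le> (\<Sum>k\<le>n. \<integral>\<omega>. indicator (A k) \<omega> * (W n \<omega>)\<^sup>2 \<partial>\<Omega>)" by (intro sum_mono cell) simp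
  also have "\<dots> = (\<integral>\<omega>. (\<Sum>k\<le>n. indicator (A k) \<omega>) * (W n \<omega>)\<^sup>2 \<partial>\<Omega>)"
    unfolding sum_distrib_right by (rule Bochner_Integration.integral_sum[symmetric, OF int_A])
  also have "\<dots> \<le> (\<integral>\<omega>. (W n \<omega>)\<^sup>2 \<partial>\<Omega>)"
  proof (rule integral_mono[OF _ int_W2])
    show "integrable \<Omega> (\<lambda>\<omega>. (\<Sum>k\<le>n. indicator (A k) \<omega>) * (W n \<omega>)\<^sup>2)"
      unfolding sum_distrib_right by (intro Bochner_Integration.integrable_sum int_A)
    fix \<omega>
    have "(\<Sum>k\<le>n. indicator (A k) \<omega>) = (indicator (\<Union>k\<in>{..n}. A k) \<omega> :: real)"
      using A_disj by (intro indicator_UN_disjoint[symmetric]) (auto simp: disjoint_family_on_def)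
    then have "(\<Sum>k\<le>n. indicator (A k) \<omega>) \<le> (1 :: real)" by (simp only: indicator_le_1)
    from mult_right_mono[OF this, of "(W n \<omega>)\<^sup>2"]
    show "(\<Sum>k\<le>n. indicator (A k) \<omega>) * (W n \<omega>)\<^sup>2 \<le> (W n \<omega>)\<^sup>2" by simp
  qed
  also have "\<dots> \<le> n * v" by (rule second_moment)
  finally show ?thesis using \<delta> by (simp add: field_simps)
qed

section \<open>The Markov property for bounded functions\<close>

lemma natural_filtration_subalgebra:
  assumes "\<And>t. t \<ge> 0 \<Longrightarrow> X t \<in> \<Omega> \<rightarrow>\<^sub>M S"
  shows "subalgebra \<Omega> (natural_filtration \<Omega> S X s)"
  unfolding subalgebra_def natural_filtration_def
  using assms by (auto simp: space_measure_of_conv sets_measure_of_conv intro!: sets.sigma_sets_subset dest: measurable_sets)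

lemma natural_filtration_mono:
  assumes "s \<le> t"
  shows "sets (natural_filtration \<Omega> S X s) \<subseteq> sets (natural_filtration \<Omega> S X t)"
  unfolding natural_filtration_def using assms
  by (subst (1 2) sets_measure_of) (auto intro!: sigma_sets_mono', fastforce)

lemma natural_filtration_measurable:
  assumes "\<And>t. t \<ge> 0 \<Longrightarrow> X t \<in> \<Omega> \<rightarrow>\<^sub>M S" "0 \<le> u" "u \<le> s"
  shows "X u \<in> natural_filtration \<Omega> S X s \<rightarrow>\<^sub>M S"
proof (rule measurableI)
  have sp: "space (natural_filtration \<Omega> S X s) = space \<Omega>"
    by (simp add: natural_filtration_def space_measure_of_conv)
  show "X u \<omega> \<in> space S" if "\<omega> \<in> space (natural_filtration \<Omega> S X s)" for \<omega>
    using that assms(1)[OF assms(2)] by (simp add: sp measurable_space)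
  fix A assume A: "A \<in> sets S"
  show "X u -` A \<inter> space (natural_filtration \<Omega> S X s) \<in> sets (natural_filtration \<Omega> S X s)"
    unfolding sp unfolding natural_filtration_def using assms(2,3) A
    by (subst sets_measure_of) (auto intro!: sigma_sets.Basic)
qed

text \<open>
  For \<open>Z \<ge> 0\<close> both sides integrate \<open>f\<close> against a finite measure on the state space: the law of \<open>X (s + t)\<close>
  under the measure with density \<open>Z\<close>, and the law of \<open>X s\<close> under that measure followed by the kernel
  \<open>P t\<close>. On sets these measures agree by the definition of the conditional expectation. A bounded \<open>Z\<close>
  becomes nonnegative by adding a constant.
\<close>

lemma markov_process_integral:
  fixes f :: "'s \<Rightarrow> real"
  assumes X: "markov_process S P \<Omega> X" and st: "0 \<le> s" "0 \<le> t"
    and Z: "Z \<in> borel_measurable (natural_filtration \<Omega> S X s)" "\<And>\<omega>. \<omega> \<in> space \<Omega> \<Longrightarrow> \<bar>Z \<omega>\<bar> \<le> c"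
    and f: "f \<in> borel_measurable S" "\<And>x. x \<in> space S \<Longrightarrow> \<bar>f x\<bar> \<le> B"
  shows "(\<integral>\<omega>. Z \<omega> * f (X (s + t) \<omega>) \<partial>\<Omega>) = (\<integral>\<omega>. Z \<omega> * (\<integral>y. f y \<partial>P t (X s \<omega>)) \<partial>\<Omega>)"
proof -
  let ?F = "natural_filtration \<Omega> S X s"
  interpret prob_space \<Omega> using X by (simp add: markov_process_def)
  have Xm: "X u \<in> \<Omega> \<rightarrow>\<^sub>M S" if "u \<ge> 0" for u using X that by (simp add: markov_process_def)
  have P: "P t \<in> S \<rightarrow>\<^sub>M prob_algebra S" using X st by (simp add: markov_process_def transition_semigroup_def)
  then have P': "P t \<in> S \<rightarrow>\<^sub>M subprob_algebra S" by (rule measurable_prob_algebraD)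
  have sub: "subalgebra \<Omega> ?F" by (rule natural_filtration_subalgebra[OF Xm])
  interpret fin: finite_measure_subalgebra \<Omega> ?F
    by (intro finite_measure_subalgebra.intro finite_measure_subalgebra_axioms.intro sub finite_measure_axioms)
  have P_prob: "prob_space (P t x)" "sets (P t x) = sets S" if "x \<in> space S" for x
    using measurable_space[OF P that] by (auto simp: space_prob_algebra)
  have X_in: "X u \<omega> \<in> space S" if "u \<ge> 0" "\<omega> \<in> space \<Omega>" for u \<omega> using measurable_space[OF Xm] that by blast
  have Pf: "(\<lambda>x. \<integral>y. f y \<partial>P t x) \<in> borel_measurable S"
    using measurable_compose[OF P' integral_measurable_subprob_algebra[OF f(1)]] .
  have Pf_bound: "\<bar>\<integral>y. f y \<partial>P t x\<bar> \<le> B" if x: "x \<in> space S" for x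
  proof -
    interpret p: prob_space "P t x" by (rule P_prob[OF x])
    have sp: "space (P t x) = space S" using P_prob(2)[OF x] by (rule sets_eq_imp_space_eq)
    have int: "integrable (P t x) f"
      using f by (intro p.integrable_const_bound[of _ B]) (auto simp: sp measurable_cong_sets[OF P_prob(2)[OF x] refl])
    have "\<bar>\<integral>y. f y \<partial>P t x\<bar> \<le> (\<integral>y. \<bar>f y\<bar> \<partial>P t x)" by (rule integral_abs_bound)
    also have "\<dots> \<le> (\<integral>y. B \<partial>P t x)" using int f(2) by (intro integral_mono) (auto simp: sp)
    finally show ?thesis using p.prob_space by simp
  qed
  have pos: "(\<integral>\<omega>. Z \<omega> * f (X (s + t) \<omega>) \<partial>\<Omega>) = (\<integral>\<omega>. Z \<omega> * (\<integral>y. f y \<partial>P t (X s \<omega>)) \<partial>\<Omega>)"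
    if Z: "Z \<in> borel_measurable ?F" "\<And>\<omega>. \<omega> \<in> space \<Omega> \<Longrightarrow> 0 \<le> Z \<omega> \<and> Z \<omega> \<le> c" for Z c
  proof -
    have Z\<Omega>: "Z \<in> borel_measurable \<Omega>" by (rule measurable_from_subalg[OF sub Z(1)])
    have Z_AE: "AE \<omega> in \<Omega>. 0 \<le> Z \<omega>" using Z(2) by simp
    have int_Z: "integrable \<Omega> (\<lambda>\<omega>. Z \<omega> * g \<omega>)"
      if "g \<in> borel_measurable \<Omega>" "\<And>\<omega>. \<omega> \<in> space \<Omega> \<Longrightarrow> \<bar>g \<omega>\<bar> \<le> b" for g b
    proof (rule integrable_const_bound[of _ "c * b"])
      show "AE \<omega> in \<Omega>. norm (Z \<omega> * g \<omega>) \<le> c * b"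
      proof (rule AE_I2)
        fix \<omega> assume "\<omega> \<in> space \<Omega>"
        then show "norm (Z \<omega> * g \<omega>) \<le> c * b"
          using Z(2)[of \<omega>] that(2)[of \<omega>] by (auto simp: abs_mult intro!: mult_mono)
      qed
    qed (use Z\<Omega> that in auto)
    define \<Omega>Z where "\<Omega>Z = density \<Omega> (\<lambda>\<omega>. ennreal (Z \<omega>))"
    have fin_\<Omega>Z: "finite_measure \<Omega>Z"
    proof (rule finite_measureI)
      have "emeasure \<Omega>Z (space \<Omega>Z) = (\<integral>\<^sup>+\<omega>. ennreal (Z \<omega>) \<partial>\<Omega>)"
        using Z\<Omega> by (simp add: \<Omega>Z_def emeasure_density cong: nn_integral_cong)
      also have "\<dots> = ennreal (\<integral>\<omega>. Z \<omega> \<partial>\<Omega>)"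
        using int_Z[of "\<lambda>_. 1" 1] Z_AE by (intro nn_integral_eq_integral) auto
      finally show "emeasure \<Omega>Z (space \<Omega>Z) \<noteq> \<infinity>" by simp
    qed
    have X\<Omega>Z: "X u \<in> \<Omega>Z \<rightarrow>\<^sub>M S" if "u \<ge> 0" for u using Xm[OF that] by (simp add: \<Omega>Z_def)
    have int_\<Omega>Z: "(\<integral>\<omega>. g \<omega> \<partial>\<Omega>Z) = (\<integral>\<omega>. Z \<omega> * g \<omega> \<partial>\<Omega>)" if "g \<in> borel_measurable \<Omega>" for g :: "_ \<Rightarrow> real"
      unfolding \<Omega>Z_def using that Z\<Omega> Z_AE by (subst integral_real_density) auto
    let ?d = "distr \<Omega>Z S (X s)"
    have ne: "space S \<noteq> {}" using not_empty X_in[OF st(1)] by blast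
    have "distr \<Omega>Z S (X (s + t)) = ?d \<bind> P t"
    proof (rule measure_eqI)
      show sets_eq: "sets (distr \<Omega>Z S (X (s + t))) = sets (?d \<bind> P t)"
        using ne P_prob(2) by (subst sets_bind[of _ _ S]) auto
      fix A assume "A \<in> sets (distr \<Omega>Z S (X (s + t)))"
      then have A: "A \<in> sets S" by simp
      have PA: "(\<lambda>x. measure (P t x) A) \<in> borel_measurable S"
        unfolding measure_def
        by (intro borel_measurable_enn2real measurable_compose[OF P' measurable_emeasure_subprob_algebra[OF A]])
      have PA_X: "(\<lambda>\<omega>. measure (P t (X s \<omega>)) A) \<in> borel_measurable \<Omega>"
        by (rule measurable_compose[OF Xm[OF st(1)] PA])
      have ind: "(\<lambda>\<omega>. indicat_real A (X (s + t) \<omega>)) \<in> borel_measurable \<Omega>"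
        using A Xm st by (intro measurable_compose[OF Xm borel_measurable_indicator]) auto
      have ce: "AE \<omega> in \<Omega>. real_cond_exp \<Omega> ?F (\<lambda>\<omega>. indicat_real A (X (s + t) \<omega>)) \<omega> = measure (P t (X s \<omega>)) A"
        using X st A by (simp add: markov_process_def)
      have "(\<integral>\<omega>. Z \<omega> * indicat_real A (X (s + t) \<omega>) \<partial>\<Omega>)
        = (\<integral>\<omega>. Z \<omega> * real_cond_exp \<Omega> ?F (\<lambda>\<omega>. indicat_real A (X (s + t) \<omega>)) \<omega> \<partial>\<Omega>)"
        by (rule fin.real_cond_exp_intg(2)[symmetric, OF int_Z[OF ind, of 1] Z(1) ind]) (simp add: indicator_def)
      also have "\<dots> = (\<integral>\<omega>. Z \<omega> * measure (P t (X s \<omega>)) A \<partial>\<Omega>)"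
      proof (rule integral_cong_AE)
        show "(\<lambda>\<omega>. Z \<omega> * real_cond_exp \<Omega> ?F (\<lambda>\<omega>. indicat_real A (X (s + t) \<omega>)) \<omega>) \<in> borel_measurable \<Omega>"
          using Z\<Omega> borel_measurable_cond_exp2 by (rule borel_measurable_times)
        show "(\<lambda>\<omega>. Z \<omega> * measure (P t (X s \<omega>)) A) \<in> borel_measurable \<Omega>"
          using Z\<Omega> PA_X by (rule borel_measurable_times)
        show "AE \<omega> in \<Omega>. Z \<omega> * real_cond_exp \<Omega> ?F (\<lambda>\<omega>. indicat_real A (X (s + t) \<omega>)) \<omega>
          = Z \<omega> * measure (P t (X s \<omega>)) A" using ce by eventually_elim simp
      qed
      finally have eq: "(\<integral>\<omega>. Z \<omega> * indicat_real A (X (s + t) \<omega>) \<partial>\<Omega>) = (\<integral>\<omega>. Z \<omega> * measure (P t (X s \<omega>)) A \<partial>\<Omega>)" .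
      have "emeasure (distr \<Omega>Z S (X (s + t))) A = ennreal (measure (distr \<Omega>Z S (X (s + t))) A)"
        using finite_measure.emeasure_eq_measure[OF finite_measure.finite_measure_distr[OF fin_\<Omega>Z X\<Omega>Z]] st by simp
      also have "measure (distr \<Omega>Z S (X (s + t))) A = (\<integral>x. indicator A x \<partial>distr \<Omega>Z S (X (s + t)))"
        using A sets.sets_into_space[OF A] by (simp add: Int_absorb2)
      also have "\<dots> = (\<integral>\<omega>. indicator A (X (s + t) \<omega>) \<partial>\<Omega>Z)"
        using A X\<Omega>Z st by (intro integral_distr) auto
      also have "\<dots> = (\<integral>\<omega>. Z \<omega> * measure (P t (X s \<omega>)) A \<partial>\<Omega>)"
        using int_\<Omega>Z[OF ind] eq by simp
      also have "\<dots> = (\<integral>\<omega>. measure (P t (X s \<omega>)) A \<partial>\<Omega>Z)" using int_\<Omega>Z[OF PA_X] by simp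
      also have "\<dots> = (\<integral>x. measure (P t x) A \<partial>?d)"
        using integral_distr[OF X\<Omega>Z[OF st(1)] PA] by simp
      also have "ennreal \<dots> = (\<integral>\<^sup>+x. ennreal (measure (P t x) A) \<partial>?d)"
      proof (rule nn_integral_eq_integral[symmetric])
        interpret d: finite_measure ?d by (rule finite_measure.finite_measure_distr[OF fin_\<Omega>Z X\<Omega>Z[OF st(1)]])
        show "integrable ?d (\<lambda>x. measure (P t x) A)"
          using PA P_prob(1) by (intro d.integrable_const_bound[of _ 1]) (auto intro!: prob_space.prob_le_1)
      qed simp
      also have "\<dots> = (\<integral>\<^sup>+x. emeasure (P t x) A \<partial>?d)"
        using P_prob(1) by (intro nn_integral_cong)
          (auto simp: finite_measure.emeasure_eq_measure prob_space_def)
      also have "\<dots> = emeasure (?d \<bind> P t) A"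
        using ne P' A by (intro emeasure_bind[symmetric, of _ _ S]) auto
      finally show "emeasure (distr \<Omega>Z S (X (s + t))) A = emeasure (?d \<bind> P t) A" .
    qed
    then have "(\<integral>x. f x \<partial>distr \<Omega>Z S (X (s + t))) = (\<integral>x. f x \<partial>(?d \<bind> P t))" by simp
    also have "\<dots> = (\<integral>x. \<integral>y. f y \<partial>P t x \<partial>?d)"
    proof (rule integral_bind[OF f])
      show "P t \<in> ?d \<rightarrow>\<^sub>M subprob_algebra S" using P' by simp
      show "finite_measure ?d" by (rule finite_measure.finite_measure_distr[OF fin_\<Omega>Z X\<Omega>Z[OF st(1)]])
      show "AE x in ?d. emeasure (P t x) (space (P t x)) \<le> ennreal 1"
        using prob_space.emeasure_space_1[OF P_prob(1)] by (intro AE_I2) simp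
    qed
    also have "\<dots> = (\<integral>\<omega>. (\<integral>y. f y \<partial>P t (X s \<omega>)) \<partial>\<Omega>Z)" by (rule integral_distr[OF X\<Omega>Z[OF st(1)] Pf])
    also have "\<dots> = (\<integral>\<omega>. Z \<omega> * (\<integral>y. f y \<partial>P t (X s \<omega>)) \<partial>\<Omega>)"
      by (rule int_\<Omega>Z[OF measurable_compose[OF Xm[OF st(1)] Pf]])
    also have "(\<integral>x. f x \<partial>distr \<Omega>Z S (X (s + t))) = (\<integral>\<omega>. f (X (s + t) \<omega>) \<partial>\<Omega>Z)"
      using X\<Omega>Z st f(1) by (intro integral_distr) auto
    also have "\<dots> = (\<integral>\<omega>. Z \<omega> * f (X (s + t) \<omega>) \<partial>\<Omega>)"
      using st by (intro int_\<Omega>Z measurable_compose[OF Xm f(1)]) auto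
    finally show ?thesis .
  qed
  have c: "0 \<le> c" using Z(2) not_empty by force
  have Z\<Omega>: "Z \<in> borel_measurable \<Omega>" by (rule measurable_from_subalg[OF sub Z(1)])
  have split: "(\<integral>\<omega>. Z \<omega> * g \<omega> \<partial>\<Omega>) = (\<integral>\<omega>. (Z \<omega> + c) * g \<omega> \<partial>\<Omega>) - (\<integral>\<omega>. c * g \<omega> \<partial>\<Omega>)"
    if "g \<in> borel_measurable \<Omega>" "\<And>\<omega>. \<omega> \<in> space \<Omega> \<Longrightarrow> \<bar>g \<omega>\<bar> \<le> B" for g
  proof -
    have "integrable \<Omega> (\<lambda>\<omega>. Z \<omega> * g \<omega>)"
    proof (rule integrable_const_bound[of _ "c * B"])
      show "AE \<omega> in \<Omega>. norm (Z \<omega> * g \<omega>) \<le> c * B"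
        using Z(2) that(2) c by (intro AE_I2) (auto simp: abs_mult intro!: mult_mono)
    qed (use Z\<Omega> that in auto)
    moreover have "integrable \<Omega> (\<lambda>\<omega>. c * g \<omega>)"
      using that by (intro integrable_mult_right integrable_const_bound[of _ B]) auto
    ultimately show ?thesis by (simp add: distrib_right)
  qed
  have "(\<integral>\<omega>. (Z \<omega> + c) * f (X (s + t) \<omega>) \<partial>\<Omega>) = (\<integral>\<omega>. (Z \<omega> + c) * (\<integral>y. f y \<partial>P t (X s \<omega>)) \<partial>\<Omega>)"
  proof (rule pos[of _ "2 * c"])
    show "0 \<le> Z \<omega> + c \<and> Z \<omega> + c \<le> 2 * c" if "\<omega> \<in> space \<Omega>" for \<omega> using Z(2)[OF that] by (simp add: abs_le_iff)
  qed (use Z(1) in simp)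
  moreover have "(\<integral>\<omega>. c * f (X (s + t) \<omega>) \<partial>\<Omega>) = (\<integral>\<omega>. c * (\<integral>y. f y \<partial>P t (X s \<omega>)) \<partial>\<Omega>)"
    by (rule pos[of _ c]) (use c in auto)
  moreover have "(\<lambda>\<omega>. f (X (s + t) \<omega>)) \<in> borel_measurable \<Omega>" "(\<lambda>\<omega>. \<integral>y. f y \<partial>P t (X s \<omega>)) \<in> borel_measurable \<Omega>"
    using st measurable_compose[OF Xm f(1)] measurable_compose[OF Xm[OF st(1)] Pf] by auto
  ultimately show ?thesis
    using f(2) Pf_bound X_in st split[of "\<lambda>\<omega>. f (X (s + t) \<omega>)"] split[of "\<lambda>\<omega>. \<integral>y. f y \<partial>P t (X s \<omega>)"] by auto
qed

section \<open>The generator of the particle process on cylindrical functions\<close>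

abbreviation empirical :: "'a::euclidean_space set \<Rightarrow> nat \<Rightarrow> (nat \<Rightarrow> 'a) \<Rightarrow> 'a measure" where
  "empirical M N x \<equiv> atoms M N (\<lambda>_. 1 / real N) x"

lemma empirical_measuresE:
  assumes "\<nu> \<in> empirical_measures N M"
  obtains x where "\<And>i. i < N \<Longrightarrow> x i \<in> M" "\<nu> = empirical M N x"
proof -
  obtain x where \<nu>: "\<nu> \<in> prob_measures M" and x: "\<forall>i<N. x i \<in> M"
    and m: "\<forall>A\<in>sets \<nu>. measure \<nu> A = (\<Sum>i<N. indicator A (x i)) / real N"
    using assms by (auto simp: empirical_measures_def)
  have "\<nu> = empirical M N x"
  proof (rule measure_eqI)
    show s: "sets \<nu> = sets (empirical M N x)" using prob_measuresD(2)[OF \<nu>] by (simp add: sets_atoms)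
    fix A assume A: "A \<in> sets \<nu>"
    have "emeasure \<nu> A = ennreal (measure \<nu> A)"
      using prob_measuresD(1)[OF \<nu>] by (simp add: finite_measure.emeasure_eq_measure prob_space_def)
    also have "\<dots> = emeasure (empirical M N x) A"
      using m A x prob_measuresD(2)[OF \<nu>] by (subst emeasure_atoms) (auto simp: sum_divide_distrib)
    finally show "emeasure \<nu> A = emeasure (empirical M N x) A" .
  qed
  then show thesis using that x by blast
qed

text \<open>
  Moving an atom from \<open>x i\<close> to \<open>m'\<close>. At a point without mass the truncated subtraction destroys
  additivity, so that the resulting measure is the zero measure.
\<close>

lemma jump_at_atom:
  assumes N: "N > 0" and x: "\<And>i. i < N \<Longrightarrow> x i \<in> M" and i: "i < N" and m': "m' \<in> M"
  shows "jump N (empirical M N x) (x i) m' = empirical M N (x(i := m'))"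
proof -
  let ?\<nu> = "empirical M N x" and ?\<nu>' = "empirical M N (x(i := m'))"
  have x': "\<And>j. j < N \<Longrightarrow> (x(i := m')) j \<in> M" using x m' by auto
  have eq: "emeasure ?\<nu> A - ennreal (1 / real N) * indicator A (x i) + ennreal (1 / real N) * indicator A m'
    = emeasure ?\<nu>' A" if A: "A \<in> sets ?\<nu>" for A
  proof -
    let ?r = "\<Sum>j\<in>{..<N} - {i}. (1 / real N) * indicator A (x j)"
    have r: "0 \<le> ?r" by (intro sum_nonneg) auto
    have A': "A \<in> sets (borel_on M)" using A by (simp add: sets_atoms)
    have "emeasure ?\<nu> A = ennreal (\<Sum>j<N. 1 / real N * indicator A (x j))"
      using x A' by (intro emeasure_atoms) auto
    also have "(\<Sum>j<N. 1 / real N * indicator A (x j)) = 1 / real N * indicator A (x i) + ?r"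
      using i by (subst sum.remove[of _ i]) auto
    finally have 1: "emeasure ?\<nu> A = ennreal (1 / real N * indicator A (x i) + ?r)" .
    have "emeasure ?\<nu>' A = ennreal (\<Sum>j<N. 1 / real N * indicator A ((x(i := m')) j))"
      using x' A' by (intro emeasure_atoms) auto
    also have "(\<Sum>j<N. 1 / real N * indicator A ((x(i := m')) j)) = 1 / real N * indicator A m' + ?r"
      using i by (subst sum.remove[of _ i]) (auto intro!: sum.cong)
    finally have 2: "emeasure ?\<nu>' A = ennreal (1 / real N * indicator A m' + ?r)" .
    have ind: "ennreal (1 / real N) * indicator A m = ennreal (1 / real N * indicator A m)" for m
      by (simp add: indicator_def)
    have "ennreal (1 / real N * indicator A (x i) + ?r) - ennreal (1 / real N * indicator A (x i)) = ennreal ?r"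
      by (subst ennreal_minus) auto
    then show ?thesis unfolding 1 2 ind using r by (simp add: ennreal_plus[symmetric] add.commute del: ennreal_plus)
  qed
  have sp: "space ?\<nu> = space ?\<nu>'" "sets ?\<nu> = sets ?\<nu>'" by (auto simp: sets_atoms intro!: sets_eq_imp_space_eq)
  have "jump N ?\<nu> (x i) m' = measure_of (space ?\<nu>) (sets ?\<nu>) (emeasure ?\<nu>')"
    unfolding jump_def by (rule measure_of_eq) (auto simp: sets.space_closed sets.sigma_sets_eq eq)
  also have "\<dots> = ?\<nu>'" unfolding sp by (rule measure_of_of_measure)
  finally show ?thesis .
qed

lemma jump_off_atoms:
  assumes N: "N > 0" and x: "\<And>i. i < N \<Longrightarrow> x i \<in> M" and m: "m \<in> M" "m \<notin> x ` {..<N}"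
  shows "jump N (empirical M N x) m m' = null_measure (borel_on M)"
proof -
  let ?\<nu> = "empirical M N x"
  define lam where "lam A = emeasure ?\<nu> A - ennreal (1 / real N) * indicator A m + ennreal (1 / real N) * indicator A m'" for A
  define a where "a = x 0"
  have a: "a \<in> M" "a \<noteq> m" using x[OF N] m(2) N by (auto simp: a_def)
  have sg: "{y} \<in> sets (borel_on M)" if "y \<in> M" for y
    using that by (auto simp: sets_restrict_space intro!: image_eqI[of _ _ "{y}"])
  define p where "p = 1 / real N"
  have p: "p > 0" using N by (simp add: p_def)
  define q where "q = (\<Sum>i\<in>{..<N} - {0}. p * indicator {a} (x i))"
  have q: "q \<ge> 0" unfolding q_def using p by (intro sum_nonneg) auto
  have em: "emeasure ?\<nu> A = ennreal (\<Sum>i<N. p * indicator A (x i))" if "A \<in> sets (borel_on M)" for A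
    unfolding p_def using x that by (intro emeasure_atoms) auto
  have e_m: "emeasure ?\<nu> {m} = 0"
    unfolding em[OF sg[OF m(1)]] using m(2) by (subst sum.neutral) (auto simp: indicator_def)
  have e_a: "emeasure ?\<nu> {a} = ennreal (p + q)"
    unfolding em[OF sg[OF a(1)]] using N by (subst sum.remove[of _ 0]) (auto simp: q_def a_def)
  have ma: "{m} \<union> {a} \<in> sets (borel_on M)" using sg m(1) a(1) by (intro sets.Un) auto
  have e_ma: "emeasure ?\<nu> ({m} \<union> {a}) = ennreal (p + q)"
  proof -
    have "emeasure ?\<nu> ({m} \<union> {a}) = emeasure ?\<nu> {m} + emeasure ?\<nu> {a}"
      using sg m(1) a by (intro plus_emeasure[symmetric]) (auto simp: sets_atoms)
    then show ?thesis by (simp add: e_m e_a)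
  qed
  have nm: "\<not> measure_space (space ?\<nu>) (sigma_sets (space ?\<nu>) (sets ?\<nu>)) lam"
  proof
    assume ms: "measure_space (space ?\<nu>) (sigma_sets (space ?\<nu>) (sets ?\<nu>)) lam"
    then have "countably_additive (sets ?\<nu>) lam" "positive (sets ?\<nu>) lam" by (auto simp: measure_space_def sets.sigma_sets_eq)
    then have "additive (sets ?\<nu>) lam" by (intro sets.countably_additive_additive)
    then have add: "lam ({m} \<union> {a}) = lam {m} + lam {a}"
      using sg m(1) a by (intro additiveD) (auto simp: sets_atoms)
    have l1: "lam ({m} \<union> {a}) = ennreal q + ennreal p * indicator ({m} \<union> {a}) m'"
      unfolding lam_def e_ma unfolding p_def[symmetric] using p q by (simp add: ennreal_minus)
    have l2: "lam {m} = ennreal p * indicator {m} m'"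
      unfolding lam_def e_m unfolding p_def[symmetric] by simp
    have l3: "lam {a} = ennreal (p + q) + ennreal p * indicator {a} m'"
      unfolding lam_def e_a unfolding p_def[symmetric] using a(2) by simp
    have ind: "indicator ({m} \<union> {a}) m' = (indicator {m} m' + indicator {a} m' :: ennreal)"
      using a(2) by (auto simp: indicator_def)
    have "ennreal q + ennreal p * indicator ({m} \<union> {a}) m'
      = ennreal p * indicator {m} m' + (ennreal (p + q) + ennreal p * indicator {a} m')"
      using add unfolding l1 l2 l3 .
    also have "\<dots> = ennreal (p + q) + ennreal p * indicator ({m} \<union> {a}) m'"
      unfolding ind by (simp only: distrib_left ac_simps)
    finally have "ennreal q + ennreal p * indicator ({m} \<union> {a}) m' = ennreal (p + q) + ennreal p * indicator ({m} \<union> {a}) m'" .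
    moreover have "ennreal p * indicator ({m} \<union> {a}) m' \<noteq> \<infinity>" by (simp add: indicator_def)
    ultimately have "ennreal q = ennreal (p + q)" using ennreal_add_left_cancel by (metis add.commute)
    then show False using p q by simp
  qed
  show ?thesis
    unfolding jump_def lam_def[symmetric]
  proof (rule measure_eqI)
    show "sets (measure_of (space ?\<nu>) (sets ?\<nu>) lam) = sets (null_measure (borel_on M))"
      unfolding sets.sets_measure_of_eq by (simp add: sets_atoms)
    show "emeasure (measure_of (space ?\<nu>) (sets ?\<nu>) lam) A = emeasure (null_measure (borel_on M)) A" for A
      unfolding emeasure_measure_of_conv using nm by simp
  qed
qed

text \<open>
  A function that is constant off the finitely many atoms is measurable, whatever its values at the
  atoms are.
\<close>

lemma integral_empirical_off_atoms:
  fixes g :: "'a::euclidean_space \<Rightarrow> real"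
  assumes x: "\<And>i. i < N \<Longrightarrow> x i \<in> M" and g: "\<And>m. m \<in> M \<Longrightarrow> m \<notin> x ` {..<N} \<Longrightarrow> g m = c"
  shows "(\<integral>m. g m \<partial>empirical M N x) = (\<Sum>i<N. g (x i)) / real N"
proof -
  have "g \<in> borel_measurable (borel_on M)"
  proof (rule measurable_discrete_difference[where f = "\<lambda>_. c" and X = "x ` {..<N}"])
    show "{y} \<in> sets (borel_on M)" if "y \<in> x ` {..<N}" for y
      using that x by (auto simp: sets_restrict_space intro!: image_eqI[of _ _ "{y}"])
  qed (auto simp: g space_restrict_space)
  then show ?thesis using x by (subst integral_atoms) (auto simp: sum_divide_distrib)
qed

context mean_field begin

lemma particle_generator_empirical:
  fixes \<Psi> :: "'a measure \<Rightarrow> real"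
  assumes N: "N > 0" and x: "\<And>i. i < N \<Longrightarrow> x i \<in> M"
  defines "\<nu> \<equiv> empirical M N x"
  shows "particle_generator N \<mu> K \<Psi> \<nu>
    = (\<Sum>i<N. \<integral>m'. (\<Psi> (empirical M N (x(i := m'))) - \<Psi> \<nu>) * K (flux \<nu>) m' \<partial>\<mu>)"
proof -
  let ?g = "\<lambda>m. \<integral>m'. (\<Psi> (jump N \<nu> m m') - \<Psi> \<nu>) * K (flux \<nu>) m' \<partial>\<mu>"
  have "(\<integral>m. ?g m \<partial>\<nu>) = (\<Sum>i<N. ?g (x i)) / real N"
    unfolding \<nu>_def
    by (rule integral_empirical_off_atoms[OF x,
        where c = "\<integral>m'. (\<Psi> (null_measure (borel_on M)) - \<Psi> (empirical M N x)) * K (flux (empirical M N x)) m' \<partial>\<mu>"])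
      (simp_all add: jump_off_atoms[OF N x])
  also have "(\<Sum>i<N. ?g (x i)) = (\<Sum>i<N. \<integral>m'. (\<Psi> (empirical M N (x(i := m'))) - \<Psi> \<nu>) * K (flux \<nu>) m' \<partial>\<mu>)"
  proof (intro sum.cong refl Bochner_Integration.integral_cong)
    fix i m' assume "i \<in> {..<N}" "m' \<in> space \<mu>"
    then show "(\<Psi> (jump N \<nu> (x i) m') - \<Psi> \<nu>) * K (flux \<nu>) m'
        = (\<Psi> (empirical M N (x(i := m'))) - \<Psi> \<nu>) * K (flux \<nu>) m'"
      unfolding \<nu>_def using jump_at_atom[of N x M i m', OF N x] space_\<mu> by simp
  qed
  finally show ?thesis using N by (simp add: particle_generator_def)
qed

context
  fixes \<phi> :: "'a \<Rightarrow> real" and B :: real and N :: nat and \<nu> :: "'a measure"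
  assumes \<phi>: "\<phi> \<in> Cb M" and B: "\<And>m. m \<in> M \<Longrightarrow> \<bar>\<phi> m\<bar> \<le> B"
    and N: "N > 0" and \<nu>: "\<nu> \<in> empirical_measures N M"
begin

text \<open>
  One jump changes \<open>\<langle>\<nu>, \<phi>\<rangle>\<close> by \<open>(\<phi> m' - \<phi> m) / N\<close>, and jumps occur at total rate \<open>N\<close>. The first-order terms add
  up to the drift of the limit equation; the squares of the changes, at most \<open>(2 B / N)\<^sup>2\<close>, leave a
  contribution of order \<open>1/N\<close>.
\<close>

lemma generator_linear_and_square:
  shows "particle_generator N \<mu> K (\<lambda>\<nu>. \<integral>m. \<phi> m \<partial>\<nu>) \<nu> = Q_BGK \<mu> K \<phi> \<nu>"
    and "particle_generator N \<mu> K (\<lambda>\<nu>. (\<integral>m. \<phi> m \<partial>\<nu>)\<^sup>2) \<nu>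
      \<le> 2 * (\<integral>m. \<phi> m \<partial>\<nu>) * Q_BGK \<mu> K \<phi> \<nu> + 4 * B\<^sup>2 / real N"
proof -
  obtain x where x: "\<And>i. i < N \<Longrightarrow> x i \<in> M" and \<nu>_eq: "\<nu> = empirical M N x"
    using empirical_measuresE[OF \<nu>] by metis
  have \<nu>P: "\<nu> \<in> prob_measures M" using \<nu> by (simp add: empirical_measures_def)
  let ?f = "\<lambda>\<nu>. \<integral>m. \<phi> m \<partial>\<nu>" and ?J = "flux \<nu>"
  define d where "d i m' = (\<phi> m' - \<phi> (x i)) / real N" for i m'
  have f_emp: "?f (empirical M N y) = (\<Sum>i<N. \<phi> (y i)) / real N" if "\<And>i. i < N \<Longrightarrow> y i \<in> M" for y
    using that by (subst integral_atoms) (auto simp: Cb_borel[OF \<phi>] sum_divide_distrib)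
  have f_jump: "?f (empirical M N (x(i := m'))) = ?f \<nu> + d i m'" if "i < N" "m' \<in> M" for i m'
  proof -
    have "?f (empirical M N (x(i := m'))) = (\<Sum>j<N. \<phi> ((x(i := m')) j)) / real N"
      using that x by (intro f_emp) auto
    also have "(\<Sum>j<N. \<phi> ((x(i := m')) j)) = \<phi> m' + (\<Sum>j\<in>{..<N} - {i}. \<phi> (x j))"
      using that(1) by (subst sum.remove[of _ i]) (auto intro!: sum.cong)
    also have "(\<Sum>j\<in>{..<N} - {i}. \<phi> (x j)) = (\<Sum>j<N. \<phi> (x j)) - \<phi> (x i)"
      using that(1) by (subst sum.remove[of "{..<N}" i]) auto
    finally show ?thesis by (simp add: \<nu>_eq f_emp[OF x] d_def add_divide_distrib diff_divide_distrib fun_upd_def)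
  qed
  have d_meas: "(\<lambda>m'. d i m') \<in> borel_measurable (borel_on M)" for i
    unfolding d_def using Cb_borel[OF \<phi>] by simp
  have d_bound: "\<bar>d i m'\<bar> \<le> 2 * B / real N" if "i < N" "m' \<in> M" for i m'
    using B[OF that(2)] B[OF x[OF that(1)]] by (simp add: d_def divide_right_mono)
  have d_int: "integrable \<mu> (\<lambda>m'. d i m' * K ?J m')" if "i < N" for i
    by (rule gain_integrable[OF d_meas d_bound[OF that]])
  have d2_bound: "\<bar>(d i m')\<^sup>2\<bar> \<le> (2 * B / real N)\<^sup>2" if "i < N" "m' \<in> M" for i m'
    using power_mono[OF d_bound[OF that] abs_ge_zero, of 2] by simp
  have d2_meas: "(\<lambda>m'. (d i m')\<^sup>2) \<in> borel_measurable (borel_on M)" for i using d_meas by simp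
  have d2_int: "integrable \<mu> (\<lambda>m'. (d i m')\<^sup>2 * K ?J m')" if "i < N" for i
    by (rule gain_integrable[OF d2_meas d2_bound[OF that]])
  have sum_d: "(\<Sum>i<N. \<integral>m'. d i m' * K ?J m' \<partial>\<mu>) = Q_BGK \<mu> K \<phi> \<nu>"
  proof -
    have "(\<integral>m'. d i m' * K ?J m' \<partial>\<mu>) = (gain \<phi> ?J - \<phi> (x i)) / real N" for i
    proof -
      have "(\<integral>m'. d i m' * K ?J m' \<partial>\<mu>) = (\<integral>m'. (\<phi> m' * K ?J m' - \<phi> (x i) * K ?J m') / real N \<partial>\<mu>)"
        by (simp add: d_def left_diff_distrib)
      also have "\<dots> = (gain \<phi> ?J - \<phi> (x i)) / real N"
        using gain_integrable[OF Cb_borel[OF \<phi>] B] K_integrable K_integral by (simp add: gain_def)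
      finally show ?thesis .
    qed
    then have "(\<Sum>i<N. \<integral>m'. d i m' * K ?J m' \<partial>\<mu>) = (\<Sum>i<N. gain \<phi> ?J / real N) - (\<Sum>i<N. \<phi> (x i)) / real N"
      by (simp add: diff_divide_distrib sum_subtractf sum_divide_distrib)
    moreover have "?f \<nu> = (\<Sum>i<N. \<phi> (x i)) / real N" unfolding \<nu>_eq by (rule f_emp[OF x])
    ultimately show ?thesis using N Q_BGK_eq[OF \<nu>P \<phi>] by simp
  qed
  have gen: "particle_generator N \<mu> K \<Psi> \<nu>
    = (\<Sum>i<N. \<integral>m'. (\<Psi> (empirical M N (x(i := m'))) - \<Psi> \<nu>) * K ?J m' \<partial>\<mu>)" for \<Psi>
    unfolding \<nu>_eq by (rule particle_generator_empirical[OF N x])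
  have "particle_generator N \<mu> K ?f \<nu> = (\<Sum>i<N. \<integral>m'. d i m' * K ?J m' \<partial>\<mu>)"
    unfolding gen using f_jump space_\<mu> by (intro sum.cong refl Bochner_Integration.integral_cong) auto
  then show "particle_generator N \<mu> K ?f \<nu> = Q_BGK \<mu> K \<phi> \<nu>" using sum_d by simp
  have "particle_generator N \<mu> K (\<lambda>\<nu>. (?f \<nu>)\<^sup>2) \<nu>
      = (\<Sum>i<N. \<integral>m'. 2 * ?f \<nu> * (d i m' * K ?J m') + (d i m')\<^sup>2 * K ?J m' \<partial>\<mu>)"
    unfolding gen
  proof (intro sum.cong refl Bochner_Integration.integral_cong)
    fix i m' assume "i \<in> {..<N}" "m' \<in> space \<mu>"
    then have "(?f (empirical M N (x(i := m'))))\<^sup>2 - (?f \<nu>)\<^sup>2 = 2 * ?f \<nu> * d i m' + (d i m')\<^sup>2"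
      using f_jump space_\<mu> by (simp add: power2_sum)
    then show "((?f (empirical M N (x(i := m'))))\<^sup>2 - (?f \<nu>)\<^sup>2) * K ?J m'
        = 2 * ?f \<nu> * (d i m' * K ?J m') + (d i m')\<^sup>2 * K ?J m'"
      by (simp add: algebra_simps)
  qed
  also have "\<dots> = (\<Sum>i<N. 2 * ?f \<nu> * (\<integral>m'. d i m' * K ?J m' \<partial>\<mu>) + gain (\<lambda>m'. (d i m')\<^sup>2) ?J)"
    using d_int d2_int by (intro sum.cong refl) (simp add: gain_def)
  also have "\<dots> = 2 * ?f \<nu> * Q_BGK \<mu> K \<phi> \<nu> + (\<Sum>i<N. gain (\<lambda>m'. (d i m')\<^sup>2) ?J)"
    by (simp add: sum.distrib sum_distrib_left[symmetric] sum_d)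
  also have "\<dots> \<le> 2 * ?f \<nu> * Q_BGK \<mu> K \<phi> \<nu> + (\<Sum>i<N. (2 * B / real N)\<^sup>2)"
  proof (intro add_left_mono sum_mono)
    fix i assume i: "i \<in> {..<N}"
    then have "i < N" by simp
    from gain_bound[OF d2_meas d2_bound[OF this], of ?J]
    show "gain (\<lambda>m'. (d i m')\<^sup>2) ?J \<le> (2 * B / real N)\<^sup>2" by simp
  qed
  also have "(\<Sum>i<N. (2 * B / real N)\<^sup>2) = 4 * B\<^sup>2 / real N"
    using N by (simp add: power_divide power2_eq_square field_simps)
  finally show "particle_generator N \<mu> K (\<lambda>\<nu>. (?f \<nu>)\<^sup>2) \<nu>
      \<le> 2 * ?f \<nu> * Q_BGK \<mu> K \<phi> \<nu> + 4 * B\<^sup>2 / real N" .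
qed

end

lemma space_particle_state_space: "space (particle_state_space N M) = empirical_measures N M"
  by (auto simp: space_restrict_space empirical_measures_def)

lemma integral_measurable_state:
  assumes "\<phi> \<in> Cb M"
  shows "(\<lambda>\<nu>. \<integral>m. \<phi> m \<partial>\<nu>) \<in> borel_measurable (particle_state_space N M)"
  unfolding prob_algebra_def
  by (intro measurable_restrict_space1 integral_measurable_subprob_algebra Cb_borel assms)

text \<open>
  Over a short time \<open>h\<close>, the mean of \<open>\<langle>\<nu>, \<phi>\<rangle>\<close> follows the drift of the limit equation, whatever
  \<open>N\<close> is, and its variance is of order \<open>h/N\<close>.
\<close>

lemma one_step_moments:
  assumes gen: "has_generator (particle_state_space N M) P (particle_test_functions N M) (particle_generator N \<mu> K)"
    and N: "N > 0" and \<phi>: "\<phi> \<in> Cb M" and B: "\<And>m. m \<in> M \<Longrightarrow> \<bar>\<phi> m\<bar> \<le> B" and \<eta>: "\<eta> > 0"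
  shows "\<forall>\<^sub>F h in at_right 0. \<forall>\<nu>\<in>empirical_measures N M.
     \<bar>(\<integral>\<nu>'. (\<integral>m. \<phi> m \<partial>\<nu>') \<partial>P h \<nu>) - (\<integral>m. \<phi> m \<partial>\<nu>) - h * Q_BGK \<mu> K \<phi> \<nu>\<bar> \<le> h * \<eta> \<and>
     (\<integral>\<nu>'. (\<integral>m. \<phi> m \<partial>\<nu>')\<^sup>2 \<partial>P h \<nu>) - (\<integral>\<nu>'. (\<integral>m. \<phi> m \<partial>\<nu>') \<partial>P h \<nu>)\<^sup>2 \<le> h * (4 * B\<^sup>2 / real N + \<eta>)"
proof -
  let ?f = "\<lambda>\<nu>. \<integral>m. \<phi> m \<partial>\<nu>"
  have emp_P: "\<nu> \<in> prob_measures M" if "\<nu> \<in> empirical_measures N M" for \<nu>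
    using that by (simp add: empirical_measures_def)
  have f_bound: "\<bar>?f \<nu>\<bar> \<le> B" if "\<nu> \<in> empirical_measures N M" for \<nu>
    using abs_integral_le_bound[OF emp_P[OF that] B \<phi>] .
  have f_cont: "continuous_map (subtopology (weak_topology M) (empirical_measures N M)) euclideanreal ?f"
  proof (rule continuous_map_from_subtopology, unfold continuous_map_def, intro conjI allI impI)
    fix U assume "openin euclideanreal U"
    then have "openin (weak_topology M) {\<nu> \<in> prob_measures M. ?f \<nu> \<in> U}"
      unfolding weak_topology_def using \<phi> by (intro topology_generated_by_Basis) auto
    then show "openin (weak_topology M) {\<nu> \<in> topspace (weak_topology M). ?f \<nu> \<in> U}"
      by (simp add: topspace_weak_topology)
  qed simp
  have f_test: "?f \<in> particle_test_functions N M" "(\<lambda>\<nu>. (?f \<nu>)\<^sup>2) \<in> particle_test_functions N M"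
  proof -
    have "bounded (?f ` empirical_measures N M)" using f_bound by (auto simp: bounded_iff)
    then show "?f \<in> particle_test_functions N M" using f_cont by (simp add: particle_test_functions_def)
    have "\<bar>(?f \<nu>)\<^sup>2\<bar> \<le> B\<^sup>2" if "\<nu> \<in> empirical_measures N M" for \<nu>
      using power_mono[OF f_bound[OF that] abs_ge_zero, of 2] by simp
    then have "bounded ((\<lambda>\<nu>. (?f \<nu>)\<^sup>2) ` empirical_measures N M)" by (auto simp: bounded_iff)
    then show "(\<lambda>\<nu>. (?f \<nu>)\<^sup>2) \<in> particle_test_functions N M"
      using continuous_map_real_pow[OF f_cont, of 2] by (simp add: particle_test_functions_def)
  qed
  define \<eta>' where "\<eta>' = \<eta> / (1 + 2 * \<bar>B\<bar>)"
  have \<eta>': "\<eta>' > 0" "\<eta>' \<le> \<eta>" "\<eta>' * (1 + 2 * \<bar>B\<bar>) = \<eta>" using \<eta> by (auto simp: \<eta>'_def field_simps)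
  have lim: "\<forall>\<^sub>F h in at_right 0. \<forall>\<nu>\<in>empirical_measures N M.
      dist (((\<integral>\<nu>'. g \<nu>' \<partial>P h \<nu>) - g \<nu>) / h) (particle_generator N \<mu> K g \<nu>) < \<eta>'"
    if "g \<in> particle_test_functions N M" for g
    using gen that \<eta>'(1) unfolding has_generator_def space_particle_state_space uniform_limit_iff by blast
  have "\<forall>\<^sub>F h in at_right (0::real). h > 0" by (simp add: eventually_at_right_less)
  with lim[OF f_test(1)] lim[OF f_test(2)] show ?thesis
  proof eventually_elim
    case (elim h)
    show ?case
    proof
      fix \<nu> assume \<nu>: "\<nu> \<in> empirical_measures N M"
      define f where "f = ?f \<nu>"
      define q where "q = Q_BGK \<mu> K \<phi> \<nu>"
      define p1 where "p1 = (\<integral>\<nu>'. ?f \<nu>' \<partial>P h \<nu>)"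
      define p2 where "p2 = (\<integral>\<nu>'. (?f \<nu>')\<^sup>2 \<partial>P h \<nu>)"
      note h = \<open>h > 0\<close>
      have "\<bar>(p1 - f) / h - q\<bar> < \<eta>'"
        using elim(1)[rule_format, OF \<nu>] generator_linear_and_square(1)[OF \<phi> B N \<nu>] by (simp add: dist_real_def p1_def f_def q_def)
      then have "\<bar>(p1 - f) / h - q\<bar> * h \<le> \<eta>' * h" using h by (intro mult_right_mono) auto
      moreover have "\<bar>(p1 - f) / h - q\<bar> * h = \<bar>p1 - f - h * q\<bar>"
      proof -
        have "p1 - f - h * q = ((p1 - f) / h - q) * h" using h by (simp add: field_simps)
        then show ?thesis using h by (simp add: abs_mult)
      qed
      ultimately have 1: "\<bar>p1 - f - h * q\<bar> \<le> h * \<eta>'" by (simp add: mult.commute)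
      have "\<bar>(p2 - f\<^sup>2) / h - particle_generator N \<mu> K (\<lambda>\<nu>. (?f \<nu>)\<^sup>2) \<nu>\<bar> < \<eta>'"
        using elim(2)[rule_format, OF \<nu>] by (simp add: dist_real_def p2_def f_def)
      then have "(p2 - f\<^sup>2) / h \<le> 2 * f * q + 4 * B\<^sup>2 / real N + \<eta>'"
        using generator_linear_and_square(2)[OF \<phi> B N \<nu>] unfolding f_def q_def by linarith
      then have 2: "p2 - f\<^sup>2 \<le> h * (2 * f * q + 4 * B\<^sup>2 / real N + \<eta>')"
        using h by (simp add: pos_divide_le_eq mult.commute)
      have "0 \<le> (p1 - f)\<^sup>2" by simp
      then have "f\<^sup>2 + 2 * f * (p1 - f) \<le> p1\<^sup>2" by (simp add: power2_eq_square algebra_simps)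
      moreover have "- (f * (p1 - f - h * q)) \<le> \<bar>B\<bar> * (h * \<eta>')"
      proof -
        have "- (f * (p1 - f - h * q)) \<le> \<bar>f\<bar> * \<bar>p1 - f - h * q\<bar>" by (simp add: abs_mult[symmetric])
        also have "\<dots> \<le> \<bar>B\<bar> * (h * \<eta>')"
          using f_bound[OF \<nu>] 1 by (intro mult_mono) (auto simp: f_def)
        finally show ?thesis .
      qed
      ultimately have "p2 - p1\<^sup>2 \<le> h * (4 * B\<^sup>2 / real N + \<eta>') + 2 * (\<bar>B\<bar> * (h * \<eta>'))"
        using 2 by (simp add: algebra_simps)
      also have "\<dots> = h * (4 * B\<^sup>2 / real N + \<eta>' * (1 + 2 * \<bar>B\<bar>))" by (simp add: algebra_simps)
      finally have "p2 - p1\<^sup>2 \<le> h * (4 * B\<^sup>2 / real N + \<eta>)" unfolding \<eta>'(3) .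
      moreover have "\<bar>p1 - f - h * q\<bar> \<le> h * \<eta>" using 1 \<eta>'(2) h by (meson mult_left_mono less_imp_le order_trans)
      ultimately show "\<bar>(\<integral>\<nu>'. ?f \<nu>' \<partial>P h \<nu>) - ?f \<nu> - h * Q_BGK \<mu> K \<phi> \<nu>\<bar> \<le> h * \<eta> \<and>
        (\<integral>\<nu>'. (?f \<nu>')\<^sup>2 \<partial>P h \<nu>) - (\<integral>\<nu>'. ?f \<nu>' \<partial>P h \<nu>)\<^sup>2 \<le> h * (4 * B\<^sup>2 / real N + \<eta>)"
        unfolding p1_def p2_def f_def q_def by blast
    qed
  qed
qed

end

section \<open>Concentration of the particle process around the solution\<close>

lemma discrete_gronwall:
  fixes e :: "nat \<Rightarrow> real"
  assumes ineq: "\<And>k. k \<le> n \<Longrightarrow> e k \<le> a + b * (\<Sum>i<k. e i)" and b: "0 \<le> b" and k: "k \<le> n"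
  shows "e k \<le> a * (1 + b) ^ k"
proof -
  have "a + b * (\<Sum>i<k. e i) \<le> a * (1 + b) ^ k" if "k \<le> n" for k
    using that
  proof (induction k)
    case (Suc k)
    have "a + b * (\<Sum>i<Suc k. e i) = (a + b * (\<Sum>i<k. e i)) + b * e k" by (simp add: algebra_simps)
    also have "\<dots> \<le> (a + b * (\<Sum>i<k. e i)) + b * (a + b * (\<Sum>i<k. e i))"
      using ineq[of k] Suc.prems b by (intro add_left_mono mult_left_mono) auto
    also have "\<dots> = (1 + b) * (a + b * (\<Sum>i<k. e i))" by (simp add: algebra_simps)
    also have "\<dots> \<le> (1 + b) * (a * (1 + b) ^ k)" using Suc b by (intro mult_left_mono) auto
    finally show ?case by (simp add: mult.left_commute)
  qed simp
  then show ?thesis using ineq[OF k] k by (meson order_trans)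
qed

definition discrepancy :: "('a \<Rightarrow> real) set \<Rightarrow> 'a measure \<Rightarrow> 'a measure \<Rightarrow> real" where
  "discrepancy \<Phi> \<sigma> \<sigma>' = (\<Sum>\<phi>\<in>\<Phi>. \<bar>(\<integral>m. \<phi> m \<partial>\<sigma>) - (\<integral>m. \<phi> m \<partial>\<sigma>')\<bar>)"

context mean_field begin

definition drift_lip :: "real \<Rightarrow> real" where "drift_lip B = B * \<theta> * DIM('a) + 1"

text \<open>
  On a time grid of step \<open>h\<close>, the deviations of \<open>\<langle>X, \<phi>\<rangle>\<close> from its one-step conditional means are martingale
  increments, with the maximal inequality of Kolmogorov. Working on the grid replaces martingales in
  continuous time by the generator, which is the derivative of the one-step means.
\<close>

lemma grid_maximal_inequality:
  fixes n :: nat and v \<delta> h :: real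
  assumes X: "markov_process (particle_state_space N M) P \<Omega> X"
    and \<phi>: "\<phi> \<in> Cb M" and B: "\<And>m. m \<in> M \<Longrightarrow> \<bar>\<phi> m\<bar> \<le> B" and h: "h \<ge> 0" and \<delta>: "\<delta> > 0"
    and var: "\<And>\<nu>. \<nu> \<in> empirical_measures N M \<Longrightarrow>
       (\<integral>\<nu>'. (\<integral>m. \<phi> m \<partial>\<nu>')\<^sup>2 \<partial>P h \<nu>) - (\<integral>\<nu>'. (\<integral>m. \<phi> m \<partial>\<nu>') \<partial>P h \<nu>)\<^sup>2 \<le> v"
  defines "W k \<omega> \<equiv> \<Sum>i<k. (\<integral>m. \<phi> m \<partial>X (real (Suc i) * h) \<omega>) - (\<integral>\<nu>'. (\<integral>m. \<phi> m \<partial>\<nu>') \<partial>P h (X (real i * h) \<omega>))"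
  shows "{\<omega> \<in> space \<Omega>. \<exists>k\<le>n. \<delta> \<le> \<bar>W k \<omega>\<bar>} \<in> sets \<Omega>"
    and "measure \<Omega> {\<omega> \<in> space \<Omega>. \<exists>k\<le>n. \<delta> \<le> \<bar>W k \<omega>\<bar>} \<le> n * v / \<delta>\<^sup>2"
proof -
  let ?S = "particle_state_space N M"
  define f where "f \<nu> = (\<integral>m. \<phi> m \<partial>\<nu>)" for \<nu> :: "'a measure"
  define pf where "pf \<nu> = (\<integral>\<nu>'. f \<nu>' \<partial>P h \<nu>)" for \<nu> :: "'a measure"
  define F where "F k = natural_filtration \<Omega> ?S X (real k * h)" for k :: nat
  define D where "D k \<omega> = f (X (real (Suc k) * h) \<omega>) - pf (X (real k * h) \<omega>)" for k \<omega>
  interpret prob_space \<Omega> using X by (simp add: markov_process_def)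
  have Xm: "X t \<in> \<Omega> \<rightarrow>\<^sub>M ?S" if "t \<ge> 0" for t using X that by (simp add: markov_process_def)
  have Ph: "P h \<in> ?S \<rightarrow>\<^sub>M prob_algebra ?S" using X h by (simp add: markov_process_def transition_semigroup_def)
  have P_prob: "prob_space (P h \<nu>)" "sets (P h \<nu>) = sets ?S" "space (P h \<nu>) = empirical_measures N M"
    if "\<nu> \<in> empirical_measures N M" for \<nu>
    using measurable_space[OF Ph, of \<nu>] that sets_eq_imp_space_eq[of "P h \<nu>" ?S]
    by (auto simp: space_particle_state_space space_prob_algebra)
  have X_in: "X t \<omega> \<in> empirical_measures N M" if "t \<ge> 0" "\<omega> \<in> space \<Omega>" for t \<omega>
    using measurable_space[OF Xm] that by (simp add: space_particle_state_space)
  have f_meas: "f \<in> borel_measurable ?S" unfolding f_def by (rule integral_measurable_state[OF \<phi>])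
  have f_bound: "\<bar>f \<nu>\<bar> \<le> B" if "\<nu> \<in> empirical_measures N M" for \<nu>
    unfolding f_def using that by (intro abs_integral_le_bound[OF _ B \<phi>]) (auto simp: empirical_measures_def)
  have pf_meas: "pf \<in> borel_measurable ?S"
    unfolding pf_def
    using measurable_compose[OF measurable_prob_algebraD[OF Ph] integral_measurable_subprob_algebra[OF f_meas]] .
  have f2_meas: "(\<lambda>\<nu>. (f \<nu>)\<^sup>2) \<in> borel_measurable ?S" using f_meas by simp
  have f2_bound: "\<bar>(f \<nu>)\<^sup>2\<bar> \<le> B\<^sup>2" if "\<nu> \<in> empirical_measures N M" for \<nu>
    using power_mono[OF f_bound[OF that] abs_ge_zero, of 2] by simp
  have mean_bound: "\<bar>\<integral>\<nu>'. g \<nu>' \<partial>P h \<nu>\<bar> \<le> b"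
    if \<nu>: "\<nu> \<in> empirical_measures N M" and g: "g \<in> borel_measurable ?S" "\<And>\<nu>. \<nu> \<in> empirical_measures N M \<Longrightarrow> \<bar>g \<nu>\<bar> \<le> b"
    for \<nu> b and g :: "'a measure \<Rightarrow> real"
  proof -
    interpret p: prob_space "P h \<nu>" by (rule P_prob(1)[OF \<nu>])
    have "integrable (P h \<nu>) g"
      using g P_prob(2,3)[OF \<nu>] by (intro p.integrable_const_bound[of _ b]) (auto cong: measurable_cong_sets)
    then have "(\<integral>\<nu>'. \<bar>g \<nu>'\<bar> \<partial>P h \<nu>) \<le> (\<integral>\<nu>'. b \<partial>P h \<nu>)"
      using g(2) P_prob(3)[OF \<nu>] by (intro integral_mono) auto
    from order_trans[OF integral_abs_bound this] show ?thesis using p.prob_space by simp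
  qed
  have pf_bound: "\<bar>pf \<nu>\<bar> \<le> B" if "\<nu> \<in> empirical_measures N M" for \<nu>
    unfolding pf_def by (rule mean_bound[OF that f_meas f_bound])
  have sub: "subalgebra \<Omega> (F k)" for k unfolding F_def by (rule natural_filtration_subalgebra[OF Xm])
  have F_mono: "sets (F i) \<subseteq> sets (F j)" if "i \<le> j" for i j
    unfolding F_def using that h by (intro natural_filtration_mono mult_right_mono) auto
  have X_F: "X (real i * h) \<in> F k \<rightarrow>\<^sub>M ?S" if "i \<le> k" for i k
    unfolding F_def using that h by (intro natural_filtration_measurable[OF Xm] mult_right_mono) auto
  have step: "real (Suc k) * h = real k * h + h" for k by (simp add: algebra_simps)
  have kh: "0 \<le> real k * h" for k using h by simp
  have bounded_int: "integrable \<Omega> g" if "g \<in> borel_measurable \<Omega>" "\<And>\<omega>. \<omega> \<in> space \<Omega> \<Longrightarrow> \<bar>g \<omega>\<bar> \<le> b" for g :: "_ \<Rightarrow> real" and b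
    using that by (intro integrable_const_bound[of _ b]) auto
  have fX: "(\<lambda>\<omega>. f (X (real k * h) \<omega>)) \<in> borel_measurable \<Omega>" and pX: "(\<lambda>\<omega>. pf (X (real k * h) \<omega>)) \<in> borel_measurable \<Omega>" for k
    using measurable_compose[OF Xm[OF kh] f_meas] measurable_compose[OF Xm[OF kh] pf_meas] by auto
  have fX_bound: "\<bar>f (X (real k * h) \<omega>)\<bar> \<le> B" and pX_bound: "\<bar>pf (X (real k * h) \<omega>)\<bar> \<le> B" if "\<omega> \<in> space \<Omega>" for k \<omega>
    using f_bound pf_bound X_in[OF kh that] by auto
  have W_eq: "W k \<omega> = (\<Sum>i<k. D i \<omega>)" for k \<omega> by (simp add: W_def D_def f_def pf_def)
  have D_F: "D k \<in> borel_measurable (F (Suc k))" for k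
    unfolding D_def
    by (intro borel_measurable_diff measurable_compose[OF X_F f_meas] measurable_compose[OF X_F pf_meas]) auto
  have D_\<Omega>: "D k \<in> borel_measurable \<Omega>" for k by (rule measurable_from_subalg[OF sub D_F])
  show "{\<omega> \<in> space \<Omega>. \<exists>k\<le>n. \<delta> \<le> \<bar>W k \<omega>\<bar>} \<in> sets \<Omega>"
    unfolding W_eq using D_\<Omega> by measurable
  have orth: "(\<integral>\<omega>. Z \<omega> * D k \<omega> \<partial>\<Omega>) = 0"
    if Z: "Z \<in> borel_measurable (F k)" "\<And>\<omega>. \<omega> \<in> space \<Omega> \<Longrightarrow> \<bar>Z \<omega>\<bar> \<le> c" for k Z c
  proof -
    have Z\<Omega>: "Z \<in> borel_measurable \<Omega>" by (rule measurable_from_subalg[OF sub Z(1)])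
    have int: "integrable \<Omega> (\<lambda>\<omega>. Z \<omega> * g \<omega>)"
      if "g \<in> borel_measurable \<Omega>" "\<And>\<omega>. \<omega> \<in> space \<Omega> \<Longrightarrow> \<bar>g \<omega>\<bar> \<le> B" for g
    proof (rule bounded_int[of _ "c * B"])
      fix \<omega> assume \<omega>: "\<omega> \<in> space \<Omega>"
      then have "0 \<le> c" using Z(2) abs_ge_zero order_trans by blast
      then show "\<bar>Z \<omega> * g \<omega>\<bar> \<le> c * B" using Z(2)[OF \<omega>] that(2)[OF \<omega>] by (auto simp: abs_mult intro!: mult_mono)
    qed (use Z\<Omega> that in auto)
    have "(\<integral>\<omega>. Z \<omega> * f (X (real k * h + h) \<omega>) \<partial>\<Omega>) = (\<integral>\<omega>. Z \<omega> * (\<integral>\<nu>'. f \<nu>' \<partial>P h (X (real k * h) \<omega>)) \<partial>\<Omega>)"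
      by (rule markov_process_integral[OF X kh h, where c = c and B = B, OF _ _ f_meas])
        (use Z f_bound in \<open>auto simp: space_particle_state_space F_def\<close>)
    then show ?thesis
      using int[OF fX fX_bound, of "Suc k"] int[OF pX pX_bound, of k]
      by (simp add: D_def pf_def step right_diff_distrib del: of_nat_Suc)
  qed
  have var_D: "(\<integral>\<omega>. (D k \<omega>)\<^sup>2 \<partial>\<Omega>) \<le> v" for k
  proof -
    let ?Y = "X (real k * h)" and ?Y' = "X (real (Suc k) * h)"
    define p2 where "p2 \<nu> = (\<integral>\<nu>'. (f \<nu>')\<^sup>2 \<partial>P h \<nu>)" for \<nu> :: "'a measure"
    have p2_meas: "p2 \<in> borel_measurable ?S"
      unfolding p2_def
      using measurable_compose[OF measurable_prob_algebraD[OF Ph] integral_measurable_subprob_algebra[OF f2_meas]] .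
    have p2_int: "integrable \<Omega> (\<lambda>\<omega>. p2 (?Y \<omega>))"
      using mean_bound[OF _ f2_meas f2_bound] X_in[OF kh]
      by (intro bounded_int[of _ "B\<^sup>2"] measurable_compose[OF Xm[OF kh] p2_meas]) (auto simp: p2_def)
    have f2_int: "integrable \<Omega> (\<lambda>\<omega>. (f (?Y' \<omega>))\<^sup>2)"
      using f2_bound X_in[OF kh] by (intro bounded_int[of _ "B\<^sup>2"] measurable_compose[OF Xm[OF kh] f2_meas]) (auto simp del: of_nat_Suc)
    have pf2_int: "integrable \<Omega> (\<lambda>\<omega>. (pf (?Y \<omega>))\<^sup>2)"
    proof (rule bounded_int[of _ "B\<^sup>2"])
      fix \<omega> assume "\<omega> \<in> space \<Omega>"
      from power_mono[OF pX_bound[OF this, of k] abs_ge_zero, of 2] show "\<bar>(pf (?Y \<omega>))\<^sup>2\<bar> \<le> B\<^sup>2" by simp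
    qed (use pX in simp)
    have pD_int: "integrable \<Omega> (\<lambda>\<omega>. pf (?Y \<omega>) * D k \<omega>)"
    proof (rule bounded_int[of _ "B * (2 * B)"])
      fix \<omega> assume \<omega>: "\<omega> \<in> space \<Omega>"
      have "\<bar>D k \<omega>\<bar> \<le> 2 * B" using fX_bound[OF \<omega>, of "Suc k"] pX_bound[OF \<omega>, of k] by (simp add: D_def del: of_nat_Suc)
      then show "\<bar>pf (?Y \<omega>) * D k \<omega>\<bar> \<le> B * (2 * B)"
        using pX_bound[OF \<omega>, of k] order_trans[OF abs_ge_zero pX_bound[OF \<omega>, of k]] by (auto simp: abs_mult intro!: mult_mono)
    qed (use pX D_\<Omega> in auto)
    have "(\<integral>\<omega>. 1 * (f (X (real k * h + h) \<omega>))\<^sup>2 \<partial>\<Omega>) = (\<integral>\<omega>. 1 * (\<integral>\<nu>'. (f \<nu>')\<^sup>2 \<partial>P h (?Y \<omega>)) \<partial>\<Omega>)"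
      by (rule markov_process_integral[OF X kh h, where c = 1 and B = "B\<^sup>2", OF _ _ f2_meas])
        (use f2_bound in \<open>auto simp: space_particle_state_space\<close>)
    then have m2: "(\<integral>\<omega>. (f (?Y' \<omega>))\<^sup>2 \<partial>\<Omega>) = (\<integral>\<omega>. p2 (?Y \<omega>) \<partial>\<Omega>)" by (simp add: step p2_def del: of_nat_Suc)
    have "(\<lambda>\<omega>. pf (?Y \<omega>)) \<in> borel_measurable (F k)" by (rule measurable_compose[OF X_F pf_meas]) simp
    from orth[OF this pX_bound] have o: "(\<integral>\<omega>. pf (?Y \<omega>) * D k \<omega> \<partial>\<Omega>) = 0" .
    have "(D k \<omega>)\<^sup>2 = (f (?Y' \<omega>))\<^sup>2 - (pf (?Y \<omega>))\<^sup>2 - 2 * (pf (?Y \<omega>) * D k \<omega>)" for \<omega>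
      by (simp add: D_def power2_eq_square algebra_simps)
    then have "(\<integral>\<omega>. (D k \<omega>)\<^sup>2 \<partial>\<Omega>) = (\<integral>\<omega>. p2 (?Y \<omega>) - (pf (?Y \<omega>))\<^sup>2 \<partial>\<Omega>)"
      using f2_int pf2_int pD_int p2_int o m2 by simp
    also have "\<dots> \<le> (\<integral>\<omega>. v \<partial>\<Omega>)"
      using var X_in[OF kh] p2_int pf2_int
      by (intro integral_mono) (auto simp: p2_def pf_def f_def)
    finally show ?thesis using prob_space by simp
  qed
  show "measure \<Omega> {\<omega> \<in> space \<Omega>. \<exists>k\<le>n. \<delta> \<le> \<bar>W k \<omega>\<bar>} \<le> n * v / \<delta>\<^sup>2"
    unfolding W_eq
  proof (rule kolmogorov_maximal_inequality[where F = F and C = "2 * B", OF prob_space_axioms sub F_mono D_F _ orth var_D \<delta>])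
    show "\<bar>D k \<omega>\<bar> \<le> 2 * B" if "\<omega> \<in> space \<Omega>" for k \<omega>
      using fX_bound[OF that, of "Suc k"] pX_bound[OF that, of k] by (simp add: D_def del: of_nat_Suc)
  qed
qed

context
  fixes \<nu> :: "real \<Rightarrow> 'a measure" and \<Phi> :: "('a \<Rightarrow> real) set" and B :: real
  assumes \<nu>: "\<And>t. \<nu> t \<in> prob_measures M"
    and d\<nu>: "\<And>\<phi> t. \<phi> \<in> Cb M \<Longrightarrow> t \<ge> 0 \<Longrightarrow>
       ((\<lambda>t. \<integral>m. \<phi> m \<partial>\<nu> t) has_vector_derivative Q_BGK \<mu> K \<phi> (\<nu> t)) (at t within {0..})"
    and \<Phi>: "finite \<Phi>" "\<Phi> \<subseteq> Cb M" "(\<lambda>b m. m \<bullet> b) ` Basis \<subseteq> \<Phi>"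
    and B: "\<And>\<phi> m. \<phi> \<in> \<Phi> \<Longrightarrow> m \<in> M \<Longrightarrow> \<bar>\<phi> m\<bar> \<le> B" and B0: "0 \<le> B"
begin

lemma drift_lip_nonneg: "0 \<le> drift_lip B"
  using B0 \<theta>_nonneg by (simp add: drift_lip_def)

lemma drift_lipschitz:
  assumes "\<sigma> \<in> prob_measures M" "\<sigma>' \<in> prob_measures M" "\<phi> \<in> \<Phi>"
  shows "\<bar>Q_BGK \<mu> K \<phi> \<sigma> - Q_BGK \<mu> K \<phi> \<sigma>'\<bar> \<le> drift_lip B * discrepancy \<Phi> \<sigma> \<sigma>'"
  unfolding drift_lip_def discrepancy_def by (rule Q_BGK_lipschitz) (use assms \<Phi> B in auto)

lemma drift_bound:
  assumes "\<sigma> \<in> prob_measures M" "\<phi> \<in> \<Phi>"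
  shows "\<bar>Q_BGK \<mu> K \<phi> \<sigma>\<bar> \<le> 2 * B"
proof -
  have \<phi>: "\<phi> \<in> Cb M" using assms \<Phi>(2) by auto
  show ?thesis
    using gain_bound[OF Cb_borel[OF \<phi>] B[OF assms(2)], of "flux \<sigma>"]
      abs_integral_le_bound[OF assms(1) B[OF assms(2)] \<phi>]
    unfolding Q_BGK_eq[OF assms(1) \<phi>] by (simp add: abs_le_iff)
qed

lemma solution_has_integral:
  assumes "\<phi> \<in> Cb M" "0 \<le> s" "s \<le> t"
  shows "((\<lambda>u. Q_BGK \<mu> K \<phi> (\<nu> u)) has_integral ((\<integral>m. \<phi> m \<partial>\<nu> t) - (\<integral>m. \<phi> m \<partial>\<nu> s))) {s..t}"
proof (rule fundamental_theorem_of_calculus[OF assms(3)])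
  fix u assume "u \<in> {s..t}"
  then show "((\<lambda>t. \<integral>m. \<phi> m \<partial>\<nu> t) has_vector_derivative Q_BGK \<mu> K \<phi> (\<nu> u)) (at u within {s..t})"
    using assms(2) by (intro has_vector_derivative_within_subset[OF d\<nu>[OF assms(1)]]) auto
qed

lemma solution_lipschitz:
  assumes "0 \<le> s" "s \<le> t"
  shows "discrepancy \<Phi> (\<nu> t) (\<nu> s) \<le> card \<Phi> * (2 * B * (t - s))"
proof -
  have "\<bar>(\<integral>m. \<phi> m \<partial>\<nu> t) - (\<integral>m. \<phi> m \<partial>\<nu> s)\<bar> \<le> 2 * B * (t - s)" if \<phi>: "\<phi> \<in> \<Phi>" for \<phi>
  proof -
    have "\<phi> \<in> Cb M" using \<phi> \<Phi>(2) by auto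
    have "norm ((\<integral>m. \<phi> m \<partial>\<nu> t) - (\<integral>m. \<phi> m \<partial>\<nu> s)) \<le> 2 * B * measure lborel {s..t}"
      by (rule has_integral_bound_real[OF _ finite.emptyI solution_has_integral[OF \<open>\<phi> \<in> Cb M\<close> assms]])
        (use drift_bound[OF \<nu> \<phi>] B0 in auto)
    then show ?thesis using assms by simp
  qed
  then have "discrepancy \<Phi> (\<nu> t) (\<nu> s) \<le> (\<Sum>\<phi>\<in>\<Phi>. 2 * B * (t - s))"
    unfolding discrepancy_def by (intro sum_mono)
  then show ?thesis by simp
qed

text \<open>Consistency of the explicit Euler scheme.\<close>

lemma solution_increment:
  assumes t: "0 \<le> t" and h: "0 \<le> h" and \<phi>: "\<phi> \<in> \<Phi>"
  shows "\<bar>(\<integral>m. \<phi> m \<partial>\<nu> (t + h)) - (\<integral>m. \<phi> m \<partial>\<nu> t) - h * Q_BGK \<mu> K \<phi> (\<nu> t)\<bar>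
    \<le> h * (drift_lip B * card \<Phi> * 2 * B * h)"
proof -
  have \<phi>C: "\<phi> \<in> Cb M" using \<phi> \<Phi>(2) by auto
  have hi: "((\<lambda>u. Q_BGK \<mu> K \<phi> (\<nu> u) - Q_BGK \<mu> K \<phi> (\<nu> t)) has_integral
      ((\<integral>m. \<phi> m \<partial>\<nu> (t + h)) - (\<integral>m. \<phi> m \<partial>\<nu> t) - measure lborel {t..t + h} *\<^sub>R Q_BGK \<mu> K \<phi> (\<nu> t))) {t..t + h}"
    using t h by (intro has_integral_diff solution_has_integral[OF \<phi>C] has_integral_const_real) auto
  have "norm ((\<integral>m. \<phi> m \<partial>\<nu> (t + h)) - (\<integral>m. \<phi> m \<partial>\<nu> t) - measure lborel {t..t + h} *\<^sub>R Q_BGK \<mu> K \<phi> (\<nu> t))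
      \<le> drift_lip B * card \<Phi> * 2 * B * h * measure lborel {t..t + h}"
  proof (rule has_integral_bound_real[OF _ finite.emptyI hi])
    show "0 \<le> drift_lip B * card \<Phi> * 2 * B * h" using drift_lip_nonneg B0 h by simp
    fix u assume u: "u \<in> {t..t + h} - {}"
    have "\<bar>Q_BGK \<mu> K \<phi> (\<nu> u) - Q_BGK \<mu> K \<phi> (\<nu> t)\<bar> \<le> drift_lip B * discrepancy \<Phi> (\<nu> u) (\<nu> t)"
      by (rule drift_lipschitz[OF \<nu> \<nu> \<phi>])
    also have "\<dots> \<le> drift_lip B * (card \<Phi> * (2 * B * (u - t)))"
      using u t drift_lip_nonneg by (intro mult_left_mono solution_lipschitz) auto
    also have "\<dots> \<le> drift_lip B * (card \<Phi> * (2 * B * h))"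
      using u B0 drift_lip_nonneg by (intro mult_left_mono) auto
    finally show "norm (Q_BGK \<mu> K \<phi> (\<nu> u) - Q_BGK \<mu> K \<phi> (\<nu> t)) \<le> drift_lip B * card \<Phi> * 2 * B * h"
      by (simp add: mult.assoc)
  qed
  then show ?thesis using h by (simp add: mult.commute)
qed

text \<open>
  Both the solution and the particle system perform an Euler step of the same scheme, up to small
  errors and the martingale increments; the scheme is stable by Gronwall's inequality.
\<close>

lemma grid_comparison:
  fixes Y :: "nat \<Rightarrow> 'a measure" and n :: nat and h \<eta> \<delta> \<delta>\<^sub>0 :: real
  assumes Y: "\<And>k. Y k \<in> prob_measures M" and h: "0 \<le> h"
    and drift: "\<And>\<phi> i. \<phi> \<in> \<Phi> \<Longrightarrow> \<bar>p \<phi> i - (\<integral>m. \<phi> m \<partial>Y i) - h * Q_BGK \<mu> K \<phi> (Y i)\<bar> \<le> h * \<eta>"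
    and mart: "\<And>\<phi> k. \<phi> \<in> \<Phi> \<Longrightarrow> k \<le> n \<Longrightarrow> \<bar>\<Sum>i<k. (\<integral>m. \<phi> m \<partial>Y (Suc i)) - p \<phi> i\<bar> \<le> \<delta>"
    and init: "\<And>\<phi>. \<phi> \<in> \<Phi> \<Longrightarrow> \<bar>(\<integral>m. \<phi> m \<partial>Y 0) - (\<integral>m. \<phi> m \<partial>\<nu> 0)\<bar> \<le> \<delta>\<^sub>0"
    and \<eta>: "0 \<le> \<eta>" and k: "k \<le> n"
  shows "discrepancy \<Phi> (Y k) (\<nu> (real k * h))
    \<le> card \<Phi> * (\<delta>\<^sub>0 + \<delta> + n * h * (\<eta> + drift_lip B * card \<Phi> * 2 * B * h)) * (1 + card \<Phi> * drift_lip B * h) ^ k"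
proof -
  define c where "c \<phi> k = (\<integral>m. \<phi> m \<partial>\<nu> (real k * h))" for \<phi> :: "'a \<Rightarrow> real" and k :: nat
  define y where "y \<phi> k = (\<integral>m. \<phi> m \<partial>Y k)" for \<phi> :: "'a \<Rightarrow> real" and k
  define q where "q \<phi> i = Q_BGK \<mu> K \<phi> (Y i) - Q_BGK \<mu> K \<phi> (\<nu> (real i * h))" for \<phi> i
  define e where "e k = discrepancy \<Phi> (Y k) (\<nu> (real k * h))" for k
  define \<rho> where "\<rho> = \<eta> + drift_lip B * card \<Phi> * 2 * B * h"
  have \<rho>0: "0 \<le> \<rho>" using \<eta> h B0 drift_lip_nonneg by (simp add: \<rho>_def)
  have each: "\<bar>y \<phi> k - c \<phi> k\<bar> \<le> \<delta>\<^sub>0 + \<delta> + n * h * \<rho> + drift_lip B * h * (\<Sum>i<k. e i)"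
    if \<phi>: "\<phi> \<in> \<Phi>" and k: "k \<le> n" for \<phi> k
  proof -
    have local: "\<bar>(p \<phi> i - y \<phi> i) - (c \<phi> (Suc i) - c \<phi> i)\<bar> \<le> h * \<rho> + drift_lip B * h * e i" for i
    proof -
      have "\<bar>c \<phi> (Suc i) - c \<phi> i - h * Q_BGK \<mu> K \<phi> (\<nu> (real i * h))\<bar> \<le> h * (drift_lip B * card \<Phi> * 2 * B * h)"
        using solution_increment[of "real i * h" h \<phi>] h \<phi> by (simp add: c_def algebra_simps)
      moreover have "\<bar>p \<phi> i - y \<phi> i - h * Q_BGK \<mu> K \<phi> (Y i)\<bar> \<le> h * \<eta>" using drift[OF \<phi>] by (simp add: y_def)
      moreover have "\<bar>h * q \<phi> i\<bar> \<le> h * (drift_lip B * e i)"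
        using drift_lipschitz[OF Y \<nu> \<phi>, of i "real i * h"] h by (simp add: q_def e_def abs_mult mult_left_mono)
      moreover have "(p \<phi> i - y \<phi> i) - (c \<phi> (Suc i) - c \<phi> i)
        = (p \<phi> i - y \<phi> i - h * Q_BGK \<mu> K \<phi> (Y i)) + h * q \<phi> i
          - (c \<phi> (Suc i) - c \<phi> i - h * Q_BGK \<mu> K \<phi> (\<nu> (real i * h)))"
        by (simp add: q_def algebra_simps)
      moreover have "h * \<rho> = h * \<eta> + h * (drift_lip B * card \<Phi> * 2 * B * h)" by (simp add: \<rho>_def distrib_left)
      ultimately show ?thesis by (simp add: mult.assoc mult.left_commute abs_le_iff)
    qed
    have "y \<phi> k - y \<phi> 0 = (\<Sum>i<k. y \<phi> (Suc i) - y \<phi> i)" "c \<phi> k - c \<phi> 0 = (\<Sum>i<k. c \<phi> (Suc i) - c \<phi> i)"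
      by (simp_all add: sum_lessThan_telescope)
    then have "y \<phi> k - c \<phi> k = (y \<phi> 0 - c \<phi> 0) + (\<Sum>i<k. y \<phi> (Suc i) - p \<phi> i)
        + (\<Sum>i<k. (p \<phi> i - y \<phi> i) - (c \<phi> (Suc i) - c \<phi> i))"
      by (simp add: sum_subtractf)
    moreover have "\<bar>y \<phi> 0 - c \<phi> 0\<bar> \<le> \<delta>\<^sub>0" using init[OF \<phi>] by (simp add: y_def c_def)
    moreover have "\<bar>\<Sum>i<k. y \<phi> (Suc i) - p \<phi> i\<bar> \<le> \<delta>" using mart[OF \<phi> k] by (simp add: y_def)
    moreover have "\<bar>\<Sum>i<k. (p \<phi> i - y \<phi> i) - (c \<phi> (Suc i) - c \<phi> i)\<bar> \<le> n * h * \<rho> + drift_lip B * h * (\<Sum>i<k. e i)"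
    proof -
      have "\<bar>\<Sum>i<k. (p \<phi> i - y \<phi> i) - (c \<phi> (Suc i) - c \<phi> i)\<bar> \<le> (\<Sum>i<k. h * \<rho> + drift_lip B * h * e i)"
        by (rule order_trans[OF sum_abs sum_mono[OF local]])
      also have "\<dots> = k * (h * \<rho>) + drift_lip B * h * (\<Sum>i<k. e i)" by (simp add: sum.distrib sum_distrib_left)
      also have "\<dots> \<le> n * (h * \<rho>) + drift_lip B * h * (\<Sum>i<k. e i)"
        using k h \<rho>0 by (intro add_right_mono mult_right_mono) auto
      finally show ?thesis by (simp add: mult.assoc)
    qed
    ultimately show ?thesis by linarith
  qed
  have "e k \<le> card \<Phi> * (\<delta>\<^sub>0 + \<delta> + n * h * \<rho>) * (1 + card \<Phi> * drift_lip B * h) ^ k"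
  proof (rule discrete_gronwall[OF _ _ k])
    show "0 \<le> card \<Phi> * drift_lip B * h" using drift_lip_nonneg h by simp
    fix k assume k: "k \<le> n"
    have "e k \<le> (\<Sum>\<phi>\<in>\<Phi>. \<delta>\<^sub>0 + \<delta> + n * h * \<rho> + drift_lip B * h * (\<Sum>i<k. e i))"
      unfolding e_def discrepancy_def using each[OF _ k] by (intro sum_mono) (simp add: y_def c_def e_def discrepancy_def)
    then show "e k \<le> card \<Phi> * (\<delta>\<^sub>0 + \<delta> + n * h * \<rho>) + card \<Phi> * drift_lip B * h * (\<Sum>i<k. e i)"
      by (simp add: algebra_simps)
  qed
  then show ?thesis by (simp add: e_def \<rho>_def)
qed

text \<open>
  Off the exceptional events of the maximal inequality, the comparison bounds the discrepancy by four
  errors of size at most \<open>\<delta>\<close>: the initial error, the martingale, the error of the generator and that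
  of the Euler scheme. The last two vanish with the step of the grid, and the probability of the
  exceptional events is of order \<open>1/N\<close>, up to a term that vanishes with the step as well.
\<close>

lemma discrepancy_grid_probability:
  fixes T \<delta> \<epsilon> \<rho> :: real
  assumes X: "particle_process N M \<mu> K \<Omega> X" and N: "N > 0"
    and X0: "AE \<omega> in \<Omega>. X 0 \<omega> = \<sigma>" and init: "\<And>\<phi>. \<phi> \<in> \<Phi> \<Longrightarrow> \<bar>(\<integral>m. \<phi> m \<partial>\<sigma>) - (\<integral>m. \<phi> m \<partial>\<nu> 0)\<bar> \<le> \<delta>"
    and T: "T > 0" and \<delta>: "\<delta> > 0" and \<epsilon>: "4 * \<delta> * card \<Phi> * exp (card \<Phi> * drift_lip B * T) \<le> \<epsilon>"
    and \<rho>: "\<rho> > 0" and N_large: "card \<Phi> * (T * (4 * B\<^sup>2 / real N) / \<delta>\<^sup>2) \<le> \<rho> / 2"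
  shows "\<forall>\<^sub>F n in sequentially.
    measure \<Omega> {\<omega> \<in> space \<Omega>. \<exists>k\<le>n. \<epsilon> < discrepancy \<Phi> (X (real k * (T / real n)) \<omega>) (\<nu> (real k * (T / real n)))} \<le> \<rho>"
proof -
  obtain P where P: "markov_process (particle_state_space N M) P \<Omega> X"
    "has_generator (particle_state_space N M) P (particle_test_functions N M) (particle_generator N \<mu> K)"
    using X by (auto simp: particle_process_def)
  interpret prob_space \<Omega> using P(1) by (simp add: markov_process_def)
  have Xm: "X t \<in> \<Omega> \<rightarrow>\<^sub>M particle_state_space N M" if "t \<ge> 0" for t
    using P(1) that by (simp add: markov_process_def)
  have X_in: "X t \<omega> \<in> empirical_measures N M" if "t \<ge> 0" "\<omega> \<in> space \<Omega>" for t \<omega>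
    using measurable_space[OF Xm] that by (simp add: space_particle_state_space)
  have X_P: "X t \<omega> \<in> prob_measures M" if "t \<ge> 0" "\<omega> \<in> space \<Omega>" for t \<omega>
    using X_in[OF that] by (simp add: empirical_measures_def)
  define c where "c = real (card \<Phi>)"
  \<comment> \<open>The tolerance for the generator: it adds at most one \<open>\<delta>\<close> to the error over \<open>[0, T]\<close> and at most \<open>\<rho>/2\<close> to the probability.\<close>
  define \<eta> where "\<eta> = min (\<delta> / T) (\<rho> * \<delta>\<^sup>2 / (2 * T * (c + 1)))"
  have c0: "c \<ge> 0" by (simp add: c_def)
  have \<eta>: "\<eta> > 0" using \<delta> T \<rho> c0 by (simp add: \<eta>_def)
  have "T * \<eta> \<le> T * (\<delta> / T)" unfolding \<eta>_def using T by (intro mult_left_mono) auto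
  then have \<eta>1: "T * \<eta> \<le> \<delta>" using T by simp
  have \<eta>2: "c * (T * \<eta> / \<delta>\<^sup>2) \<le> \<rho> / 2"
  proof -
    have "c * (T * \<eta> / \<delta>\<^sup>2) \<le> c * (T * (\<rho> * \<delta>\<^sup>2 / (2 * T * (c + 1))) / \<delta>\<^sup>2)"
      unfolding \<eta>_def using T c0 by (intro mult_left_mono divide_right_mono) auto
    also have "\<dots> = (c / (c + 1)) * (\<rho> / 2)"
    proof -
      have "c * (T * (\<rho> * \<delta>\<^sup>2 / (2 * T * d)) / \<delta>\<^sup>2) = (c / d) * (\<rho> / 2)" if "d > 0" for d
        using T \<delta> that by (simp add: field_simps)
      then show ?thesis using c0 by simp
    qed
    also have "\<dots> \<le> 1 * (\<rho> / 2)" using c0 \<rho> by (intro mult_right_mono) auto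
    finally show ?thesis by simp
  qed
  have h_lim: "filterlim (\<lambda>n. T / real n) (at_right 0) sequentially"
  proof (rule tendsto_imp_filterlim_at_right)
    show "(\<lambda>n. T / real n) \<longlonglongrightarrow> 0" by (rule lim_const_over_n)
    show "\<forall>\<^sub>F n in sequentially. T / real n > 0" using T by (intro eventually_sequentiallyI[of 1]) auto
  qed
  have moments: "\<forall>\<^sub>F n in sequentially. \<forall>\<phi>\<in>\<Phi>. \<forall>\<sigma>\<in>empirical_measures N M.
     \<bar>(\<integral>\<nu>'. (\<integral>m. \<phi> m \<partial>\<nu>') \<partial>P (T / real n) \<sigma>) - (\<integral>m. \<phi> m \<partial>\<sigma>) - (T / real n) * Q_BGK \<mu> K \<phi> \<sigma>\<bar> \<le> (T / real n) * \<eta> \<and>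
     (\<integral>\<nu>'. (\<integral>m. \<phi> m \<partial>\<nu>')\<^sup>2 \<partial>P (T / real n) \<sigma>) - (\<integral>\<nu>'. (\<integral>m. \<phi> m \<partial>\<nu>') \<partial>P (T / real n) \<sigma>)\<^sup>2
       \<le> (T / real n) * (4 * B\<^sup>2 / real N + \<eta>)"
  proof (rule eventually_ball_finite[OF \<Phi>(1)], rule ballI)
    fix \<phi> assume \<phi>: "\<phi> \<in> \<Phi>"
    then have "\<phi> \<in> Cb M" using \<Phi>(2) by auto
    from eventually_compose_filterlim[OF one_step_moments[OF P(2) N this B[OF \<phi>] \<eta>] h_lim]
    show "\<forall>\<^sub>F n in sequentially. \<forall>\<sigma>\<in>empirical_measures N M.
     \<bar>(\<integral>\<nu>'. (\<integral>m. \<phi> m \<partial>\<nu>') \<partial>P (T / real n) \<sigma>) - (\<integral>m. \<phi> m \<partial>\<sigma>) - (T / real n) * Q_BGK \<mu> K \<phi> \<sigma>\<bar> \<le> (T / real n) * \<eta> \<and>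
     (\<integral>\<nu>'. (\<integral>m. \<phi> m \<partial>\<nu>')\<^sup>2 \<partial>P (T / real n) \<sigma>) - (\<integral>\<nu>'. (\<integral>m. \<phi> m \<partial>\<nu>') \<partial>P (T / real n) \<sigma>)\<^sup>2
       \<le> (T / real n) * (4 * B\<^sup>2 / real N + \<eta>)" .
  qed
  have "(\<lambda>n. T * (drift_lip B * c * 2 * B * (T / real n))) \<longlonglongrightarrow> T * (drift_lip B * c * 2 * B * 0)"
    by (intro tendsto_intros lim_const_over_n)
  then have small: "\<forall>\<^sub>F n in sequentially. T * (drift_lip B * c * 2 * B * (T / real n)) < \<delta>"
    using \<delta> by (intro order_tendstoD(2)) auto
  show ?thesis
    using moments small eventually_gt_at_top[of 0]
  proof eventually_elim
    case (elim n)
    define h where "h = T / real n"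
    have h: "h > 0" "real n * h = T" using elim(3) T by (auto simp: h_def)
    note elim1 = elim(1)[folded h_def]
    define W where "W \<phi> k \<omega> = (\<Sum>i<k. (\<integral>m. \<phi> m \<partial>X (real (Suc i) * h) \<omega>)
        - (\<integral>\<nu>'. (\<integral>m. \<phi> m \<partial>\<nu>') \<partial>P h (X (real i * h) \<omega>)))" for \<phi> :: "'a \<Rightarrow> real" and k \<omega>
    define bad where "bad \<phi> = {\<omega> \<in> space \<Omega>. \<exists>k\<le>n. \<delta> \<le> \<bar>W \<phi> k \<omega>\<bar>}" for \<phi>
    have bad: "bad \<phi> \<in> sets \<Omega>" "measure \<Omega> (bad \<phi>) \<le> T * (4 * B\<^sup>2 / real N + \<eta>) / \<delta>\<^sup>2" if \<phi>: "\<phi> \<in> \<Phi>" for \<phi>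
    proof -
      have \<phi>C: "\<phi> \<in> Cb M" using \<phi> \<Phi>(2) by auto
      have var: "(\<integral>\<nu>'. (\<integral>m. \<phi> m \<partial>\<nu>')\<^sup>2 \<partial>P h \<sigma>) - (\<integral>\<nu>'. (\<integral>m. \<phi> m \<partial>\<nu>') \<partial>P h \<sigma>)\<^sup>2 \<le> h * (4 * B\<^sup>2 / real N + \<eta>)"
        if "\<sigma> \<in> empirical_measures N M" for \<sigma> using elim1 \<phi> that by blast
      note G = grid_maximal_inequality[OF P(1) \<phi>C B[OF \<phi>] less_imp_le[OF h(1)] \<delta> var, of n, folded W_def, folded bad_def]
      show "bad \<phi> \<in> sets \<Omega>" by (rule G(1))
      show "measure \<Omega> (bad \<phi>) \<le> T * (4 * B\<^sup>2 / real N + \<eta>) / \<delta>\<^sup>2"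
        using G(2) h(2) by (simp add: mult.assoc[symmetric])
    qed
    define E where "E = {\<omega> \<in> space \<Omega>. \<exists>k\<le>n. \<epsilon> < discrepancy \<Phi> (X (real k * h) \<omega>) (\<nu> (real k * h))}"
    have incl: "\<omega> \<in> (\<Union>\<phi>\<in>\<Phi>. bad \<phi>)" if \<omega>: "\<omega> \<in> E" "X 0 \<omega> = \<sigma>" for \<omega>
    proof (rule ccontr)
      assume good: "\<omega> \<notin> (\<Union>\<phi>\<in>\<Phi>. bad \<phi>)"
      have \<omega>\<Omega>: "\<omega> \<in> space \<Omega>" using \<omega> by (simp add: E_def)
      obtain k where k: "k \<le> n" "\<epsilon> < discrepancy \<Phi> (X (real k * h) \<omega>) (\<nu> (real k * h))" using \<omega> by (auto simp: E_def)
      have "discrepancy \<Phi> (X (real k * h) \<omega>) (\<nu> (real k * h))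
        \<le> card \<Phi> * (\<delta> + \<delta> + n * h * (\<eta> + drift_lip B * card \<Phi> * 2 * B * h)) * (1 + card \<Phi> * drift_lip B * h) ^ k"
      proof (rule grid_comparison[where Y = "\<lambda>k. X (real k * h) \<omega>"
            and p = "\<lambda>\<phi> i. \<integral>\<nu>'. (\<integral>m. \<phi> m \<partial>\<nu>') \<partial>P h (X (real i * h) \<omega>)"])
        show "X (real k * h) \<omega> \<in> prob_measures M" for k using X_P \<omega>\<Omega> h by simp
        show "\<bar>(\<integral>\<nu>'. (\<integral>m. \<phi> m \<partial>\<nu>') \<partial>P h (X (real i * h) \<omega>)) - (\<integral>m. \<phi> m \<partial>X (real i * h) \<omega>)
            - h * Q_BGK \<mu> K \<phi> (X (real i * h) \<omega>)\<bar> \<le> h * \<eta>" if "\<phi> \<in> \<Phi>" for \<phi> i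
          using elim1 that X_in[OF mult_nonneg_nonneg[OF of_nat_0_le_iff less_imp_le[OF h(1)]] \<omega>\<Omega>] by blast
        show "\<bar>\<Sum>i<k. (\<integral>m. \<phi> m \<partial>X (real (Suc i) * h) \<omega>) - (\<integral>\<nu>'. (\<integral>m. \<phi> m \<partial>\<nu>') \<partial>P h (X (real i * h) \<omega>))\<bar> \<le> \<delta>"
          if "\<phi> \<in> \<Phi>" "k \<le> n" for \<phi> k
        proof -
          have "\<not> \<delta> \<le> \<bar>W \<phi> k \<omega>\<bar>" using good that \<omega>\<Omega> unfolding bad_def by blast
          then show ?thesis unfolding W_def not_le by (rule less_imp_le)
        qed
        show "\<bar>(\<integral>m. \<phi> m \<partial>X (real 0 * h) \<omega>) - (\<integral>m. \<phi> m \<partial>\<nu> 0)\<bar> \<le> \<delta>" if "\<phi> \<in> \<Phi>" for \<phi>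
          using init[OF that] \<omega>(2) by simp
      qed (use h \<eta> k in auto)
      also have "\<dots> \<le> c * (4 * \<delta>) * exp (c * drift_lip B * T)"
      proof (rule mult_mono)
        have "n * h * (\<eta> + drift_lip B * card \<Phi> * 2 * B * h) \<le> 2 * \<delta>"
          using \<eta>1 elim(2) unfolding h(2) by (simp add: h_def c_def distrib_left)
        then show "card \<Phi> * (\<delta> + \<delta> + n * h * (\<eta> + drift_lip B * card \<Phi> * 2 * B * h)) \<le> c * (4 * \<delta>)"
          unfolding c_def by (intro mult_left_mono) auto
        have x0: "0 \<le> c * drift_lip B * h" using c0 drift_lip_nonneg h by simp
        have "(1 + c * drift_lip B * h) ^ k \<le> exp (c * drift_lip B * h) ^ k"
          using x0 exp_ge_add_one_self by (intro power_mono) auto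
        also have "\<dots> = exp (real k * (c * drift_lip B * h))" by (simp add: exp_of_nat_mult)
        also have "\<dots> \<le> exp (real n * (c * drift_lip B * h))" using k(1) x0 by (simp add: mult_right_mono)
        also have "real n * (c * drift_lip B * h) = c * drift_lip B * (real n * h)" by simp
        finally show "(1 + card \<Phi> * drift_lip B * h) ^ k \<le> exp (c * drift_lip B * T)" unfolding h(2) c_def .
      qed (use c0 \<delta> drift_lip_nonneg h in \<open>auto simp: c_def\<close>)
      also have "\<dots> \<le> \<epsilon>" using \<epsilon> by (simp add: c_def mult.commute mult.left_commute)
      finally show False using k(2) by simp
    qed
    have "measure \<Omega> E \<le> measure \<Omega> (\<Union>\<phi>\<in>\<Phi>. bad \<phi>)"
    proof (rule finite_measure_mono_AE)
      show "AE \<omega> in \<Omega>. \<omega> \<in> E \<longrightarrow> \<omega> \<in> (\<Union>\<phi>\<in>\<Phi>. bad \<phi>)" using X0 by eventually_elim (use incl in blast)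
      show "(\<Union>\<phi>\<in>\<Phi>. bad \<phi>) \<in> sets \<Omega>" using bad(1) \<Phi>(1) by (intro sets.finite_UN) auto
    qed
    also have "\<dots> \<le> (\<Sum>\<phi>\<in>\<Phi>. measure \<Omega> (bad \<phi>))"
      using bad(1) \<Phi>(1) by (intro finite_measure_subadditive_finite) auto
    also have "\<dots> \<le> (\<Sum>\<phi>\<in>\<Phi>. T * (4 * B\<^sup>2 / real N + \<eta>) / \<delta>\<^sup>2)" by (intro sum_mono bad(2))
    also have "\<dots> = c * (T * (4 * B\<^sup>2 / real N) / \<delta>\<^sup>2) + c * (T * \<eta> / \<delta>\<^sup>2)"
      by (simp add: c_def add_divide_distrib distrib_left)
    also have "\<dots> \<le> \<rho>" using N_large \<eta>2 unfolding c_def by linarith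
    finally show ?case by (simp add: E_def h_def)
  qed
qed

text \<open>
  Dyadic grids are nested, so that the exceptional events increase with the grid and their union has
  no larger probability than the bound for a single fine grid. Off the union the discrepancy is small
  at all dyadic times, hence at all times by right-continuity.
\<close>

lemma particle_concentration:
  fixes T \<epsilon> \<rho> :: real
  assumes X: "\<And>N. N > 0 \<Longrightarrow> particle_process N M \<mu> K (\<Omega> N) (X N)"
    and right: "\<And>N \<omega> t. N > 0 \<Longrightarrow> \<omega> \<in> space (\<Omega> N) \<Longrightarrow> t \<ge> 0 \<Longrightarrow>
       limitin (weak_topology M) (\<lambda>t. X N t \<omega>) (X N t \<omega>) (at_right t)"
    and X0: "\<And>N. N > 0 \<Longrightarrow> AE \<omega> in \<Omega> N. X N 0 \<omega> = \<sigma> N"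
    and init: "\<And>\<phi>. \<phi> \<in> Cb M \<Longrightarrow> (\<lambda>N. \<integral>m. \<phi> m \<partial>\<sigma> N) \<longlonglongrightarrow> (\<integral>m. \<phi> m \<partial>\<nu> 0)"
    and T: "T > 0" and \<epsilon>: "\<epsilon> > 0" and \<rho>: "\<rho> > 0"
  shows "\<forall>\<^sub>F N in sequentially. N > 0 \<and> (\<exists>G\<in>sets (\<Omega> N). measure (\<Omega> N) G \<le> \<rho> \<and>
    (\<forall>\<omega>\<in>space (\<Omega> N) - G. \<forall>t\<in>{0..T}. discrepancy \<Phi> (X N t \<omega>) (\<nu> t) \<le> \<epsilon>))"
proof -
  define \<delta> where "\<delta> = \<epsilon> / (4 * (card \<Phi> + 1) * exp (card \<Phi> * drift_lip B * T))"
  have \<delta>: "\<delta> > 0" using \<epsilon> by (simp add: \<delta>_def add_nonneg_pos)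
  have "4 * \<delta> * (card \<Phi> + 1) * exp (card \<Phi> * drift_lip B * T) = \<epsilon>"
    by (simp add: \<delta>_def field_simps add_nonneg_eq_0_iff)
  moreover have "4 * \<delta> * card \<Phi> * exp (card \<Phi> * drift_lip B * T) \<le> 4 * \<delta> * (card \<Phi> + 1) * exp (card \<Phi> * drift_lip B * T)"
    using \<delta> by (intro mult_right_mono mult_left_mono) auto
  ultimately have \<delta>_\<epsilon>: "4 * \<delta> * card \<Phi> * exp (card \<Phi> * drift_lip B * T) \<le> \<epsilon>" by simp
  have close: "\<forall>\<^sub>F N in sequentially. \<forall>\<phi>\<in>\<Phi>. \<bar>(\<integral>m. \<phi> m \<partial>\<sigma> N) - (\<integral>m. \<phi> m \<partial>\<nu> 0)\<bar> < \<delta>"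
  proof (rule eventually_ball_finite[OF \<Phi>(1)], rule ballI)
    fix \<phi> assume "\<phi> \<in> \<Phi>"
    then have "\<phi> \<in> Cb M" using \<Phi>(2) by auto
    from tendstoD[OF init[OF this] \<delta>]
    show "\<forall>\<^sub>F N in sequentially. \<bar>(\<integral>m. \<phi> m \<partial>\<sigma> N) - (\<integral>m. \<phi> m \<partial>\<nu> 0)\<bar> < \<delta>"
      by (simp add: dist_real_def)
  qed
  have "(\<lambda>N. card \<Phi> * (T * (4 * B\<^sup>2 / real N) / \<delta>\<^sup>2)) \<longlonglongrightarrow> card \<Phi> * (T * 0 / \<delta>\<^sup>2)"
    using \<delta> by (intro tendsto_intros lim_const_over_n) auto
  then have large: "\<forall>\<^sub>F N in sequentially. card \<Phi> * (T * (4 * B\<^sup>2 / real N) / \<delta>\<^sup>2) < \<rho> / 2"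
    using \<rho> by (intro order_tendstoD(2)) auto
  show ?thesis
    using close large eventually_gt_at_top[of 0]
  proof eventually_elim
    case (elim N)
    note N = elim(3)
    have "prob_space (\<Omega> N)" using X[OF N] by (auto simp: particle_process_def markov_process_def)
    then interpret prob_space "\<Omega> N" .
    have Xm: "X N t \<in> \<Omega> N \<rightarrow>\<^sub>M particle_state_space N M" if "t \<ge> 0" for t
      using X[OF N] that by (auto simp: particle_process_def markov_process_def)
    define d where "d t \<omega> = discrepancy \<Phi> (X N t \<omega>) (\<nu> t)" for t \<omega>
    have d_meas: "d t \<in> borel_measurable (\<Omega> N)" if "t \<ge> 0" for t
      unfolding d_def discrepancy_def using \<Phi>(2) that
      by (intro borel_measurable_sum borel_measurable_abs borel_measurable_diff measurable_const
          measurable_compose[OF Xm integral_measurable_state]) auto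
    define E where "E n = {\<omega> \<in> space (\<Omega> N). \<exists>k\<le>n. \<epsilon> < d (real k * (T / real n)) \<omega>}" for n :: nat
    have E_sets: "E n \<in> sets (\<Omega> N)" for n
    proof -
      have "E n = (\<Union>k\<in>{..n}. {\<omega> \<in> space (\<Omega> N). \<epsilon> < d (real k * (T / real n)) \<omega>})" by (auto simp: E_def)
      also have "\<dots> \<in> sets (\<Omega> N)"
        using T by (intro sets.finite_UN borel_measurable_less measurable_const d_meas) auto
      finally show ?thesis .
    qed
    have ev: "\<forall>\<^sub>F n in sequentially. prob (E n) \<le> \<rho>"
      unfolding E_def d_def
      by (rule discrepancy_grid_probability[OF X[OF N] N X0[OF N] _ T \<delta> \<delta>_\<epsilon> \<rho>])
        (use elim(1,2) in \<open>auto intro: less_imp_le\<close>)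
    have inc: "incseq (\<lambda>j. E (2 ^ j))"
    proof (rule incseq_SucI, rule subsetI)
      fix j \<omega> assume \<omega>: "\<omega> \<in> E (2 ^ j)"
      then obtain k where k: "k \<le> 2 ^ j" "\<epsilon> < d (real k * (T / real (2 ^ j))) \<omega>" by (auto simp: E_def)
      have "real (2 * k) * (T / real (2 ^ Suc j)) = real k * (T / real (2 ^ j))" by simp
      then show "\<omega> \<in> E (2 ^ Suc j)" using \<omega> k unfolding E_def by (auto intro!: exI[of _ "2 * k"])
    qed
    define G where "G = (\<Union>j. E (2 ^ j))"
    have G_sets: "G \<in> sets (\<Omega> N)" unfolding G_def using E_sets by auto
    have "(\<lambda>j. prob (E (2 ^ j))) \<longlonglongrightarrow> prob G"
      unfolding G_def using E_sets by (intro finite_Lim_measure_incseq[OF _ inc]) auto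
    moreover have "\<forall>\<^sub>F j in sequentially. prob (E (2 ^ j)) \<le> \<rho>"
    proof -
      have "filterlim (\<lambda>j. 2 ^ j :: nat) at_top sequentially"
        by (rule filterlim_subseq) (simp add: strict_mono_def)
      from eventually_compose_filterlim[OF ev this] show ?thesis .
    qed
    ultimately have G_prob: "prob G \<le> \<rho>" by (rule tendsto_upperbound) simp
    have "d t \<omega> \<le> \<epsilon>" if \<omega>: "\<omega> \<in> space (\<Omega> N) - G" and t: "t \<in> {0..T}" for t \<omega>
    proof (rule ccontr)
      assume "\<not> d t \<omega> \<le> \<epsilon>"
      then have big: "\<epsilon> < d t \<omega>" by simp
      have grid: "d (real k * (T / real (2 ^ j))) \<omega> \<le> \<epsilon>" if "k \<le> 2 ^ j" for k j
        using \<omega> that unfolding G_def E_def by force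
      show False
      proof (cases "t = T")
        case True then show False using grid[of 1 0] big by simp
      next
        case False
        then have tT: "0 \<le> t" "t < T" using t by auto
        have lim: "((\<lambda>s. d s \<omega>) \<longlongrightarrow> d t \<omega>) (at_right t)"
          unfolding d_def discrepancy_def
        proof (intro tendsto_intros)
          fix \<phi> assume "\<phi> \<in> \<Phi>"
          then have \<phi>: "\<phi> \<in> Cb M" using \<Phi>(2) by auto
          show "((\<lambda>s. \<integral>m. \<phi> m \<partial>X N s \<omega>) \<longlongrightarrow> (\<integral>m. \<phi> m \<partial>X N t \<omega>)) (at_right t)"
            using right[OF N _ tT(1), of \<omega>] \<omega> \<phi> by (simp add: limitin_weak_topology)
          have "continuous_on {0..} (\<lambda>t. \<integral>m. \<phi> m \<partial>\<nu> t)"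
            using d\<nu>[OF \<phi>] by (rule has_vector_derivative_atLeast_continuous)
          then have "((\<lambda>s. \<integral>m. \<phi> m \<partial>\<nu> s) \<longlongrightarrow> (\<integral>m. \<phi> m \<partial>\<nu> t)) (at t within {0..})"
            using tT by (simp add: continuous_on_def)
          then show "((\<lambda>s. \<integral>m. \<phi> m \<partial>\<nu> s) \<longlongrightarrow> (\<integral>m. \<phi> m \<partial>\<nu> t)) (at_right t)"
            by (rule tendsto_within_subset) (use tT in auto)
        qed
        obtain b where b: "b > t" "\<And>s. t < s \<Longrightarrow> s < b \<Longrightarrow> \<epsilon> < d s \<omega>"
          using order_tendstoD(1)[OF lim big] unfolding eventually_at_right_field by blast
        define b' where "b' = min b T"
        have b': "t < b'" using b tT by (simp add: b'_def)
        obtain j where j: "T / real (2 ^ j) < b' - t"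
        proof -
          have "\<exists>j. T / (b' - t) < 2 ^ j" by (rule real_arch_pow) simp
          then show thesis using that b' by (auto simp: field_simps)
        qed
        define h where "h = T / real (2 ^ j)"
        have h: "h > 0" "h < b' - t" "real (2 ^ j) * h = T" using T j by (auto simp: h_def)
        \<comment> \<open>The first grid point strictly after \<open>t\<close>.\<close>
        define k where "k = nat (\<lfloor>t / h\<rfloor> + 1)"
        have kr: "real k = real_of_int \<lfloor>t / h\<rfloor> + 1" using tT h by (simp add: k_def)
        have "t / h < real k" "real k \<le> t / h + 1" unfolding kr by linarith+
        then have kh: "t < real k * h" "real k * h \<le> t + h" using h by (auto simp: field_simps)
        then have "real k * h < real (2 ^ j) * h" using h b'_def by linarith
        then have "real k < real (2 ^ j)" using h(1) by (simp only: mult_less_cancel_right_pos)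
        then have "k \<le> 2 ^ j" by (simp only: of_nat_less_iff less_imp_le)
        from grid[OF this] have "d (real k * h) \<omega> \<le> \<epsilon>" unfolding h_def .
        moreover have "real k * h < b" using kh h b'_def by linarith
        ultimately show False using b(2)[of "real k * h"] kh by linarith
      qed
    qed
    then show ?case using G_sets G_prob N unfolding d_def by blast
  qed
qed

end

end

section \<open>The limit theorem\<close>

text \<open>
  The total mass is one, unless the volume is zero or infinite; then the normalisation gives the zero
  measure, of mass zero.
\<close>

lemma normalised_volume_le_1:
  assumes "normalised_volume k M \<mu>"
  shows "sets \<mu> = sets (borel_on M)" and "emeasure \<mu> (space \<mu>) \<le> 1"
proof -
  obtain vol where vol: "riemannian_volume k M vol"
    and \<mu>: "\<mu> = scale_measure (inverse (emeasure vol (space vol))) vol"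
    using assms by (auto simp: normalised_volume_def)
  show "sets \<mu> = sets (borel_on M)" using vol by (simp add: \<mu> riemannian_volume_def)
  have "inverse v * v \<le> 1" for v :: ennreal
    by (cases "v = 0 \<or> v = top") (auto simp: mult.commute[of "inverse v"] less_top divide_ennreal_def[symmetric])
  then show "emeasure \<mu> (space \<mu>) \<le> 1" by (simp add: \<mu> space_scale_measure)
qed

text \<open>
  As the mass of \<open>\<mu>\<close> is at most one, an essential supremum bounds an \<open>L\<^sup>1\<close> norm. The radius of the ball of
  fluxes is \<open>a = 1\<close>.
\<close>

lemma interaction_law_mean_field:
  assumes M: "compact M" "\<forall>m\<in>M. norm m \<le> 1"
    and vol: "normalised_volume k M \<mu>" and K: "interaction_law M \<mu> K \<alpha> L \<theta>"
  shows "mean_field M \<mu> K (max 0 (\<theta> 1))"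
proof
  note V = normalised_volume_le_1[OF vol]
  have sp: "space \<mu> = M" using sets_eq_imp_space_eq[OF V(1)] by (simp add: space_restrict_space)
  show "norm m \<le> 1" if "m \<in> M" for m using M that by auto
  show "compact M" by (rule M(1))
  show "sets \<mu> = sets (borel_on M)" by (rule V(1))
  show K_meas: "K J \<in> borel_measurable \<mu>" and K_nonneg: "m \<in> M \<Longrightarrow> 0 \<le> K J m" for J m
    using K by (auto simp: interaction_law_def)
  have "has_bochner_integral \<mu> (K J) 1" for J
    using K K_nonneg by (intro has_bochner_integral_nn_integral K_meas) (auto simp: interaction_law_def sp)
  then show K_int: "integrable \<mu> (K J)" and "(\<integral>m. K J m \<partial>\<mu>) = 1" for J
    by (auto simp: has_bochner_integral_iff)
  show "0 \<le> max 0 (\<theta> 1)" by simp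
  fix J J' :: 'a assume J: "norm J \<le> 1" "norm J' \<le> 1"
  interpret finite_measure \<mu>
    using V(2) by (intro finite_measureI) (auto simp: top_unique)
  let ?c = "max 0 (\<theta> 1) * norm (J - J')"
  have "esssup \<mu> (\<lambda>m. ereal \<bar>K J m - K J' m\<bar>) \<le> ereal (\<theta> 1 * norm (J - J'))"
    using K J by (simp add: interaction_law_def)
  from order_trans[OF _ this] have "AE m in \<mu>. ereal \<bar>K J m - K J' m\<bar> \<le> ereal (\<theta> 1 * norm (J - J'))"
    by (rule eventually_mono[OF esssup_AE])
  then have AE: "AE m in \<mu>. \<bar>K J m - K J' m\<bar> \<le> ?c"
  proof eventually_elim
    case (elim m)
    moreover have "\<theta> 1 * norm (J - J') \<le> ?c" by (intro mult_right_mono) auto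
    ultimately show ?case by simp
  qed
  have "(\<integral>m. \<bar>K J m - K J' m\<bar> \<partial>\<mu>) \<le> (\<integral>m. ?c \<partial>\<mu>)"
    using K_int AE by (intro integral_mono_AE) auto
  also have "\<dots> = measure \<mu> (space \<mu>) * ?c" by simp
  also have "\<dots> \<le> 1 * ?c"
  proof (rule mult_right_mono)
    show "measure \<mu> (space \<mu>) \<le> 1" unfolding measure_def using V(2) by (intro enn2real_leI) auto
  qed simp
  finally show "(\<integral>m. \<bar>K J m - K J' m\<bar> \<partial>\<mu>) \<le> ?c" by simp
qed

lemma Cb_finite_common_bound:
  assumes "finite \<Phi>" "\<Phi> \<subseteq> Cb M"
  obtains B where "B \<ge> 0" "\<And>\<phi> m. \<phi> \<in> \<Phi> \<Longrightarrow> m \<in> M \<Longrightarrow> \<bar>\<phi> m\<bar> \<le> B"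
proof -
  have "\<exists>B\<ge>0. \<forall>\<phi>\<in>\<Phi>. \<forall>m\<in>M. \<bar>\<phi> m\<bar> \<le> B"
    using assms
  proof (induction rule: finite_induct)
    case (insert \<phi> \<Phi>)
    obtain B where B: "B \<ge> 0" "\<forall>\<phi>\<in>\<Phi>. \<forall>m\<in>M. \<bar>\<phi> m\<bar> \<le> B" using insert by auto
    obtain B' where B': "B' \<ge> 0" "\<And>m. m \<in> M \<Longrightarrow> \<bar>\<phi> m\<bar> \<le> B'" using insert.prems Cb_bounded[of \<phi> M] by auto
    show ?case using B B' by (intro exI[of _ "max B B'"]) (auto simp: le_max_iff_disj)
  qed auto
  then show thesis using that by blast
qed

lemma limitin_within_subset:
  assumes "limitin T f l (at a within A)" "B \<subseteq> A"
  shows "limitin T f l (at a within B)"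
  using assms(1) filter_leD[OF at_le[OF assms(2)]] unfolding limitin_def by blast

lemma return_integral_continuous:
  assumes F: "continuous_map T euclideanreal F" and x: "x \<in> topspace T"
  shows "(\<integral>y. F y \<partial>return (borel_of T) x) = F x"
proof -
  have opens: "{U. openin T U} \<subseteq> Pow (topspace T)" by (auto dest: openin_subset)
  have sp: "space (borel_of T) = topspace T" unfolding borel_of_def by (rule space_measure_of[OF opens])
  have "F \<in> borel_measurable (borel_of T)"
  proof (rule borel_measurableI)
    fix V :: "real set" assume "open V"
    then have "openin T {y \<in> topspace T. F y \<in> V}"
      using F by (simp add: openin_continuous_map_preimage)
    moreover have "F -` V \<inter> space (borel_of T) = {y \<in> topspace T. F y \<in> V}" by (auto simp: sp)
    ultimately show "F -` V \<inter> space (borel_of T) \<in> sets (borel_of T)"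
      unfolding borel_of_def by (simp add: sets_measure_of[OF opens] sigma_sets.Basic)
  qed
  then show ?thesis using x by (intro integral_return) (simp_all add: sp)
qed

theorem theorem3:
  fixes M :: "'a::euclidean_space set"
    and k :: nat
    and \<mu> :: "'a measure"
    and K :: "'a \<Rightarrow> 'a \<Rightarrow> real"
    and \<alpha> L \<theta> :: "real \<Rightarrow> real"
    and r :: "'a measure \<Rightarrow> 'a measure \<Rightarrow> real"
    and \<Omega> :: "nat \<Rightarrow> 'w measure"
    and X :: "nat \<Rightarrow> real \<Rightarrow> 'w \<Rightarrow> 'a measure"
    and \<nu>N :: "nat \<Rightarrow> 'a measure"
    and \<nu>\<^sub>0 :: "'a measure"
  assumes "compact M" and "embedded_submanifold k M" and "\<forall>m\<in>M. norm m \<le> 1"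
    and "normalised_volume k M \<mu>"
    and "interaction_law M \<mu> K \<alpha> L \<theta>"
    and "Metric_space (prob_measures M) r"
    and "Metric_space.mtopology (prob_measures M) r = weak_topology M"
    and "\<forall>N>0. \<nu>N N \<in> empirical_measures N M"
    and "\<forall>N>0. particle_process N M \<mu> K (\<Omega> N) (X N)"
    and "\<forall>N>0. \<forall>\<omega>\<in>space (\<Omega> N). restrict (\<lambda>t. X N t \<omega>) {0..} \<in> skorohod_space (prob_measures M) r"
    and "\<forall>N>0. AE \<omega> in \<Omega> N. X N 0 \<omega> = \<nu>N N"
    and "\<nu>\<^sub>0 \<in> prob_measures M"
    and "\<forall>\<phi>\<in>Cb M. (\<lambda>N. \<integral>m. \<phi> m \<partial>\<nu>N N) \<longlonglongrightarrow> (\<integral>m. \<phi> m \<partial>\<nu>\<^sub>0)"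
  shows "\<exists>\<nu>. {x \<in> skorohod_space (prob_measures M) r. weak_solution_BGK M \<mu> K x \<and> x 0 = \<nu>\<^sub>0} = {\<nu>} \<and>
    converges_in_law (skorohod_topology (prob_measures M) r)
      \<Omega> (\<lambda>N \<omega>. restrict (\<lambda>t. X N t \<omega>) {0..})
      (return (borel_of (skorohod_topology (prob_measures M) r)) \<nu>)"
proof -
  let ?S = "prob_measures M"
  interpret mean_field M \<mu> K "max 0 (\<theta> 1)"
    by (rule interaction_law_mean_field[OF assms(1,3,4,5)])
  interpret skorohod ?S r by (rule skorohod.intro[OF assms(6)])
  note top = assms(7)
  obtain \<nu> where \<nu>0: "\<nu> 0 = \<nu>\<^sub>0" and \<nu>S: "\<And>t. \<nu> t \<in> ?S"
    and d\<nu>: "\<And>\<phi> t. \<phi> \<in> Cb M \<Longrightarrow> t \<ge> 0 \<Longrightarrow>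
       ((\<lambda>t. \<integral>m. \<phi> m \<partial>\<nu> t) has_vector_derivative Q_BGK \<mu> K \<phi> (\<nu> t)) (at t within {0..})"
    using solution_exists[OF assms(12)] by metis
  define x where "x = restrict \<nu> {0..}"
  have x_eq: "x t = \<nu> t" if "t \<ge> 0" for t using that by (simp add: x_def)
  have x_lim: "limitin (weak_topology M) x (x t) (at t within {0..})" if t: "t \<ge> 0" for t
    unfolding limitin_weak_topology x_eq[OF t]
  proof (intro conjI ballI \<nu>S)
    have ev: "\<forall>\<^sub>F s in at t within {0..}. s \<ge> (0::real)" by (simp add: eventually_at_filter)
    then show "\<forall>\<^sub>F s in at t within {0..}. x s \<in> ?S" by eventually_elim (simp add: x_eq \<nu>S)
    fix \<phi> assume \<phi>: "\<phi> \<in> Cb M"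
    have "continuous_on {0..} (\<lambda>t. \<integral>m. \<phi> m \<partial>\<nu> t)"
      using d\<nu>[OF \<phi>] by (rule has_vector_derivative_atLeast_continuous)
    then have "((\<lambda>s. \<integral>m. \<phi> m \<partial>\<nu> s) \<longlongrightarrow> (\<integral>m. \<phi> m \<partial>\<nu> t)) (at t within {0..})"
      using t by (simp add: continuous_on_def)
    then show "((\<lambda>s. \<integral>m. \<phi> m \<partial>x s) \<longlongrightarrow> (\<integral>m. \<phi> m \<partial>\<nu> t)) (at t within {0..})"
      by (rule Lim_transform_eventually) (use ev in \<open>auto elim!: eventually_mono simp: x_eq\<close>)
  qed
  have x_cadlag: "x \<in> cadlag"
    unfolding skorohod_space_def top
  proof (intro CollectI conjI allI impI)
    show "x \<in> {0..} \<rightarrow>\<^sub>E ?S" using \<nu>S by (auto simp: x_def)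
    show "limitin (weak_topology M) x (x t) (at_right t)" if "0 \<le> t" for t
      by (rule limitin_within_subset[OF x_lim[OF that]]) (use that in auto)
    show "\<exists>l. limitin (weak_topology M) x l (at_left t)" if "0 < t" for t
    proof -
      have "limitin (weak_topology M) x (x t) (at t within {0<..<t})"
        by (rule limitin_within_subset[OF x_lim]) (use that in auto)
      moreover have "at t within {0<..<t} = at_left t"
        by (rule at_within_nhd[of _ "{0<..}"]) (use that in auto)
      ultimately show ?thesis by auto
    qed
  qed
  have x_weak: "weak_solution_BGK M \<mu> K x"
    unfolding weak_solution_BGK_def
  proof (intro conjI allI impI AE_I2 ballI)
    show "x t \<in> ?S" if "0 \<le> t" for t using that by (simp add: x_eq \<nu>S)
    show "limitin (weak_topology M) x (x t) (at t within {0..})" if "0 \<le> t" for t by (rule x_lim[OF that])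
    fix t :: real and \<phi> assume t: "0 \<le> t" and \<phi>: "\<phi> \<in> Cb M"
    have "integral {0..t} (\<lambda>s. Q_BGK \<mu> K \<phi> (x s)) = integral {0..t} (\<lambda>s. Q_BGK \<mu> K \<phi> (\<nu> s))"
      by (rule Henstock_Kurzweil_Integration.integral_cong) (simp add: x_eq)
    also have "\<dots> = (\<integral>m. \<phi> m \<partial>\<nu> t) - (\<integral>m. \<phi> m \<partial>\<nu> 0)"
      by (rule integral_unique[OF FTC_difference_atLeast[OF d\<nu>[OF \<phi>] t]])
    finally show "(\<integral>m. \<phi> m \<partial>x t) = (\<integral>m. \<phi> m \<partial>x 0) + integral {0..t} (\<lambda>s. Q_BGK \<mu> K \<phi> (x s))"
      using t by (simp add: x_eq)
  qed
  have unique: "y = x" if y: "y \<in> cadlag" "weak_solution_BGK M \<mu> K y" "y 0 = \<nu>\<^sub>0" for y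
  proof (rule ext)
    fix t
    show "y t = x t"
    proof (cases "t \<ge> 0")
      case True
      have right: "limitin (weak_topology M) y (y t) (at_right t)" if "t \<ge> 0" for t
        using y(1) that by (simp add: skorohod_space_def top)
      show ?thesis
      proof (rule prob_measures_eqI[OF assms(6,7)])
        show "y t \<in> ?S" "x t \<in> ?S" using cadlag_in y(1) x_cadlag True by auto
        show "(\<integral>m. \<phi> m \<partial>y t) = (\<integral>m. \<phi> m \<partial>x t)" if "\<phi> \<in> Cb M" for \<phi>
          using weak_solution_unique[OF y(2) right \<nu>S d\<nu> _ that True] y(3) \<nu>0 True by (simp add: x_eq)
      qed
    next
      case False
      then show ?thesis using y(1) x_cadlag by (auto simp: skorohod_space_def PiE_def extensional_def)
    qed
  qed
  have "x 0 = \<nu>\<^sub>0" using \<nu>0 by (simp add: x_def)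
  then have "{y \<in> cadlag. weak_solution_BGK M \<mu> K y \<and> y 0 = \<nu>\<^sub>0} = {x}"
    using x_cadlag x_weak unique by blast
  moreover have "converges_in_law (skorohod_topology ?S r) \<Omega> (\<lambda>N \<omega>. restrict (\<lambda>t. X N t \<omega>) {0..})
      (return (borel_of (skorohod_topology ?S r)) x)"
    unfolding converges_in_law_def
  proof (intro allI impI, elim conjE)
    fix F assume F: "continuous_map (skorohod_topology ?S r) euclideanreal F"
      and F_bdd: "bounded (F ` topspace (skorohod_topology ?S r))"
    have tops: "topspace (skorohod_topology ?S r) = cadlag" by (simp add: skorohod_topology_def)
    define Y where "Y N \<omega> = restrict (\<lambda>t. X N t \<omega>) {0..}" for N \<omega>
    have Y: "Y N \<omega> \<in> cadlag" if "N > 0" "\<omega> \<in> space (\<Omega> N)" for N \<omega> using assms(10) that by (simp add: Y_def)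
    have Xm: "X N t \<in> \<Omega> N \<rightarrow>\<^sub>M particle_state_space N M" if "N > 0" "t \<ge> 0" for N t
      using assms(9)[rule_format, OF that(1)] that(2) unfolding particle_process_def markov_process_def by blast
    have \<Omega>: "prob_space (\<Omega> N)" if "N > 0" for N
      using assms(9)[rule_format, OF that] unfolding particle_process_def markov_process_def by blast
    obtain coord :: "nat \<Rightarrow> 'a measure \<Rightarrow> nat \<Rightarrow> real" and C decode where
      C: "\<And>j \<nu>. \<nu> \<in> ?S \<Longrightarrow> coord j \<nu> \<in> C j"
      "\<And>j. continuous_map (top_of_set (C j)) (weak_topology M) (decode j)"
      "\<And>\<nu>. \<nu> \<in> ?S \<Longrightarrow> limitin (weak_topology M) (\<lambda>j. decode j (coord j \<nu>)) \<nu> sequentially"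
      "\<And>j i. (\<lambda>\<nu>. coord j \<nu> i) \<in> borel_measurable (prob_algebra (borel_on M))"
      using finite_dimensional_approximation[OF assms(1)] by blast
    have FY: "(\<lambda>\<omega>. F (Y N \<omega>)) \<in> borel_measurable (\<Omega> N)" if N: "N > 0" for N
    proof (rule borel_measurable_continuous_functional[OF F Y[OF N] C(1) C(2)[folded top] C(3)[folded top]])
      fix t :: real and i j :: nat assume t: "t \<ge> 0"
      have "(\<lambda>\<omega>. coord j (X N t \<omega>) i) \<in> borel_measurable (\<Omega> N)"
        by (rule measurable_compose[OF Xm[OF N t] measurable_restrict_space1[OF C(4)]])
      then show "(\<lambda>\<omega>. coord j (Y N \<omega> t) i) \<in> borel_measurable (\<Omega> N)" using t by (simp add: Y_def)
    qed
    obtain c where c: "\<And>y. y \<in> cadlag \<Longrightarrow> \<bar>F y\<bar> \<le> c"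
      using F_bdd unfolding tops bounded_iff by auto
    have c0: "c \<ge> 0" using c[OF x_cadlag] by linarith
    have "(\<lambda>N. \<integral>\<omega>. F (Y N \<omega>) \<partial>\<Omega> N) \<longlonglongrightarrow> F x"
    proof (rule tendstoI)
      fix e :: real assume e: "e > 0"
      obtain d where d: "d > 0" "\<And>y. y \<in> cadlag \<Longrightarrow> skorohod_dist r x y < d \<Longrightarrow> \<bar>F y - F x\<bar> < e / 3"
        using continuous_functional_at[OF F x_cadlag, of "e / 3"] e by auto
      \<comment> \<open>Horizons after \<open>T\<close> contribute at most \<open>exp (-T) \<le> d/4\<close> to the Skorohod distance.\<close>
      define T where "T = max 1 (ln (4 / d))"
      have T: "T > 0" "exp (- T) \<le> d / 4"
      proof -
        have "exp (- T) \<le> exp (- ln (4 / d))" by (simp add: T_def)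
        also have "\<dots> = d / 4" using d(1) by (simp add: exp_minus)
        finally show "exp (- T) \<le> d / 4" .
      qed (simp add: T_def)
      have x_lim_T: "limitin (weak_topology M) x (x t) (at t within {0..T})" if "t \<in> {0..T}" for t
        by (rule limitin_within_subset[OF x_lim]) (use that in auto)
      obtain \<Phi>\<^sub>0 \<delta> where \<Phi>\<^sub>0: "finite \<Phi>\<^sub>0" "\<Phi>\<^sub>0 \<subseteq> Cb M" and \<delta>: "\<delta> > 0"
        and near: "\<And>t \<sigma>. t \<in> {0..T} \<Longrightarrow> \<sigma> \<in> ?S \<Longrightarrow>
          (\<And>\<phi>. \<phi> \<in> \<Phi>\<^sub>0 \<Longrightarrow> \<bar>(\<integral>m. \<phi> m \<partial>\<sigma>) - (\<integral>m. \<phi> m \<partial>x t)\<bar> < \<delta>) \<Longrightarrow> r (x t) \<sigma> < d / 4"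
        using uniform_weak_neighbourhood_of_path[OF assms(6,7) x_lim_T, of "d / 4"] d(1) by auto
      define \<Phi> where "\<Phi> = \<Phi>\<^sub>0 \<union> (\<lambda>b m. m \<bullet> b) ` Basis"
      have \<Phi>: "finite \<Phi>" "\<Phi> \<subseteq> Cb M" "(\<lambda>b m. m \<bullet> b) ` Basis \<subseteq> \<Phi>"
        using \<Phi>\<^sub>0 coordinate_Cb by (auto simp: \<Phi>_def)
      obtain B where B: "B \<ge> 0" "\<And>\<phi> m. \<phi> \<in> \<Phi> \<Longrightarrow> m \<in> M \<Longrightarrow> \<bar>\<phi> m\<bar> \<le> B"
        using Cb_finite_common_bound[OF \<Phi>(1,2)] by blast
      \<comment> \<open>On the exceptional event, of probability at most \<open>\<rho>\<close>, the values of \<open>F\<close> differ by up to \<open>2 * c\<close>.\<close>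
      define \<rho> where "\<rho> = e / (3 * (2 * c + 1))"
      have \<rho>: "\<rho> > 0" "2 * c * \<rho> < e / 3"
      proof -
        show "\<rho> > 0" using e c0 by (simp add: \<rho>_def)
        then have "2 * c * \<rho> < (2 * c + 1) * \<rho>" by (simp add: distrib_right)
        also have "\<dots> = e / 3"
        proof -
          have "b * (e / (3 * b)) = e / 3" if "b > 0" for b using that by simp
          from this[of "2 * c + 1"] show ?thesis using c0 unfolding \<rho>_def by simp
        qed
        finally show "2 * c * \<rho> < e / 3" .
      qed
      have right: "limitin (weak_topology M) (\<lambda>t. X N t \<omega>) (X N t \<omega>) (at_right t)"
        if "N > 0" "\<omega> \<in> space (\<Omega> N)" "t \<ge> 0" for N \<omega> t
      proof -
        have "limitin (weak_topology M) (Y N \<omega>) (Y N \<omega> t) (at_right t)"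
          using Y[OF that(1,2)] that(3) by (simp add: skorohod_space_def top)
        moreover have "\<forall>\<^sub>F s in at_right t. Y N \<omega> s = X N s \<omega>"
          unfolding eventually_at_right_field using that(3) by (intro exI[of _ "t + 1"]) (auto simp: Y_def)
        ultimately show ?thesis using that(3) limitin_transform_eventually by (fastforce simp: Y_def)
      qed
      have conv: "(\<lambda>N. \<integral>m. \<phi> m \<partial>\<nu>N N) \<longlonglongrightarrow> (\<integral>m. \<phi> m \<partial>\<nu> 0)" if "\<phi> \<in> Cb M" for \<phi>
        using assms(13) that \<nu>0 by simp
      have "\<forall>\<^sub>F N in sequentially. N > 0 \<and> (\<exists>G\<in>sets (\<Omega> N). measure (\<Omega> N) G \<le> \<rho> \<and>
          (\<forall>\<omega>\<in>space (\<Omega> N) - G. \<forall>t\<in>{0..T}. discrepancy \<Phi> (X N t \<omega>) (\<nu> t) \<le> \<delta> / 2))"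
      proof (rule particle_concentration[where \<sigma> = \<nu>N and B = B])
        show "\<nu> t \<in> ?S" for t by (rule \<nu>S)
        show "((\<lambda>t. \<integral>m. \<phi> m \<partial>\<nu> t) has_vector_derivative Q_BGK \<mu> K \<phi> (\<nu> t)) (at t within {0..})"
          if "\<phi> \<in> Cb M" "t \<ge> 0" for \<phi> t by (rule d\<nu>[OF that])
        show "\<bar>\<phi> m\<bar> \<le> B" if "\<phi> \<in> \<Phi>" "m \<in> M" for \<phi> m by (rule B(2)[OF that])
        show "particle_process N M \<mu> K (\<Omega> N) (X N)" "AE \<omega> in \<Omega> N. X N 0 \<omega> = \<nu>N N" if "N > 0" for N
          using assms(9,11) that by blast+
        show "limitin (weak_topology M) (\<lambda>t. X N t \<omega>) (X N t \<omega>) (at_right t)"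
          if "N > 0" "\<omega> \<in> space (\<Omega> N)" "t \<ge> 0" for N \<omega> t by (rule right[OF that])
        show "(\<lambda>N. \<integral>m. \<phi> m \<partial>\<nu>N N) \<longlonglongrightarrow> (\<integral>m. \<phi> m \<partial>\<nu> 0)" if "\<phi> \<in> Cb M" for \<phi>
          by (rule conv[OF that])
      qed (rule \<Phi> B(1) T(1) half_gt_zero[OF \<delta>] \<rho>(1))+
      then show "\<forall>\<^sub>F N in sequentially. dist (\<integral>\<omega>. F (Y N \<omega>) \<partial>\<Omega> N) (F x) < e"
      proof eventually_elim
        case (elim N)
        then obtain G where N: "N > 0" and G: "G \<in> sets (\<Omega> N)" "measure (\<Omega> N) G \<le> \<rho>"
          and G_close: "\<And>\<omega> t. \<omega> \<in> space (\<Omega> N) - G \<Longrightarrow> t \<in> {0..T} \<Longrightarrow> discrepancy \<Phi> (X N t \<omega>) (\<nu> t) \<le> \<delta> / 2"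
          by auto
        interpret N: prob_space "\<Omega> N" by (rule \<Omega>[OF N])
        have close: "\<bar>F (Y N \<omega>) - F x\<bar> \<le> e / 3" if \<omega>: "\<omega> \<in> space (\<Omega> N)" "\<omega> \<notin> G" for \<omega>
        proof -
          have r_close: "r (x t) (Y N \<omega> t) \<le> d / 4" if t: "t \<in> {0..T}" for t
          proof (rule less_imp_le[OF near[OF t]])
            show "Y N \<omega> t \<in> ?S" using cadlag_in[OF Y[OF N \<omega>(1)]] t by simp
            fix \<phi> assume \<phi>: "\<phi> \<in> \<Phi>\<^sub>0"
            have "\<bar>(\<integral>m. \<phi> m \<partial>X N t \<omega>) - (\<integral>m. \<phi> m \<partial>\<nu> t)\<bar> \<le> discrepancy \<Phi> (X N t \<omega>) (\<nu> t)"
              unfolding discrepancy_def using \<Phi>(1) \<phi>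
              by (intro member_le_sum[where f = "\<lambda>\<phi>. \<bar>(\<integral>m. \<phi> m \<partial>X N t \<omega>) - (\<integral>m. \<phi> m \<partial>\<nu> t)\<bar>"]) (auto simp: \<Phi>_def)
            also have "\<dots> \<le> \<delta> / 2" using \<omega> t by (intro G_close) auto
            finally show "\<bar>(\<integral>m. \<phi> m \<partial>Y N \<omega> t) - (\<integral>m. \<phi> m \<partial>x t)\<bar> < \<delta>"
              using t \<delta> by (simp add: Y_def x_eq)
          qed
          \<comment> \<open>The limit is continuous, so that the identity is a sufficient time change.\<close>
          have "skorohod_dist r x (Y N \<omega>) \<le> max 0 (d / 4 + measure lborel ({} :: real set) + exp (- T))"
          proof (rule dist_le_bound[OF id_time_change(1)])
            show "w \<le> 0" if "w \<in> log_slopes (\<lambda>t. t)" for w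
              using cSup_upper[OF that time_changeD(3)[OF id_time_change(1)]] by (simp add: id_time_change(2))
            show "r (x (min t u)) (Y N \<omega> (min t u)) \<le> d / 4" if "0 \<le> u" "u < T" "0 \<le> t" for u t
              using that by (intro r_close) auto
          qed (use d(1) in auto)
          also have "\<dots> < d" using T(2) d(1) by simp
          finally show ?thesis using d(2)[OF Y[OF N \<omega>(1)]] by simp
        qed
        have FY_int: "integrable (\<Omega> N) (\<lambda>\<omega>. F (Y N \<omega>))"
          using c Y[OF N] by (intro N.integrable_const_bound[of _ c] FY[OF N]) auto
        have G_int: "integrable (\<Omega> N) (indicat_real G)"
          using G(1) by (intro integrable_real_indicator) (auto simp: N.emeasure_eq_measure)
        have "(\<integral>\<omega>. F (Y N \<omega>) \<partial>\<Omega> N) - F x = (\<integral>\<omega>. F (Y N \<omega>) - F x \<partial>\<Omega> N)"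
          using FY_int N.prob_space by simp
        also have "\<bar>\<dots>\<bar> \<le> (\<integral>\<omega>. \<bar>F (Y N \<omega>) - F x\<bar> \<partial>\<Omega> N)" by (rule integral_abs_bound)
        also have "\<dots> \<le> (\<integral>\<omega>. e / 3 + 2 * c * indicator G \<omega> \<partial>\<Omega> N)"
        proof (rule integral_mono)
          show "integrable (\<Omega> N) (\<lambda>\<omega>. \<bar>F (Y N \<omega>) - F x\<bar>)" using FY_int by simp
          show "integrable (\<Omega> N) (\<lambda>\<omega>. e / 3 + 2 * c * indicator G \<omega>)" using G_int by simp
          fix \<omega> assume \<omega>: "\<omega> \<in> space (\<Omega> N)"
          show "\<bar>F (Y N \<omega>) - F x\<bar> \<le> e / 3 + 2 * c * indicator G \<omega>"
          proof (cases "\<omega> \<in> G")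
            case True
            have "\<bar>F (Y N \<omega>) - F x\<bar> \<le> 2 * c" using c[OF Y[OF N \<omega>]] c[OF x_cadlag] by (simp add: abs_le_iff)
            then show ?thesis using True e by simp
          next
            case False
            then show ?thesis using close[OF \<omega>] by simp
          qed
        qed
        also have "\<dots> = e / 3 + 2 * c * measure (\<Omega> N) G"
          using G_int G(1) N.prob_space sets.sets_into_space[OF G(1)] by (simp add: Int_absorb2)
        also have "\<dots> \<le> e / 3 + 2 * c * \<rho>" using G(2) c0 by (intro add_left_mono mult_left_mono) auto
        also have "\<dots> < e" using \<rho>(2) e by simp
        finally show ?case by (simp add: dist_real_def)
      qed
    qed
    then show "(\<lambda>N. \<integral>\<omega>. F (restrict (\<lambda>t. X N t \<omega>) {0..}) \<partial>\<Omega> N)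
        \<longlonglongrightarrow> (\<integral>y. F y \<partial>return (borel_of (skorohod_topology ?S r)) x)"
      using return_integral_continuous[OF F, of x] x_cadlag tops by (simp add: Y_def)
  qed
  ultimately show ?thesis by blast
qed

end
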